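(* For each fixed integer $n\ge 2$, $\lim_{d\to\infty} I(n,d)_{\mathrm{hol}}=\infty$.
   Context: For a reduced Stein space $X$, $\mathcal{O}(X)$ is the ring of holomorphic functions on $X$, and elements of $SL_n(\mathcal{O}(X))$ are identified with holomorphic maps $X\to SL_n(\mathbb{C})$; such an element is null-homotopic if this map is homotopic to a constant map through continuous maps $X\to SL_n(\mathbb{C})$. A holomorphic involution is a matrix $B\in GL_n(\mathcal{O}(X))$ with $B^2=I$. $I(n,d)_{\mathrm{hol}}$ denotes the minimal number such that, for any reduced Stein space $X$ of complex dimension $d$, every null-homotopic matrix $A\in SL_n(\mathcal{O}(X))$ factorizes as a product of $I(n,d)_{\mathrm{hol}}$ holomorphic involutions (such a finite number exists). *)

theory Defs
  imports "HOL-Analysis.Analysis"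
begin

section \<open>Holomorphic functions on open subsets of complex number space\<close>

text \<open>
  The embedding dimension of the local models of a complex space varies from chart to chart, so
  the \<open>m\<close>-dimensional complex number space is indexed by a natural number: its points are
  the extensional functions on \<open>{..<m}\<close>.
\<close>

definition Cn :: "nat \<Rightarrow> (nat \<Rightarrow> complex) topology" where
  "Cn m = product_topology (\<lambda>_. euclidean) {..<m}"

text \<open>Holomorphic means complex (totally) differentiable at every point.\<close>

definition holo_on :: "nat \<Rightarrow> (nat \<Rightarrow> complex) set \<Rightarrow> ((nat \<Rightarrow> complex) \<Rightarrow> complex) \<Rightarrow> bool" where
  "holo_on m D f \<longleftrightarrow> openin (Cn m) D \<and>
     (\<forall>z\<in>D. \<exists>c. ((\<lambda>w. (f w - f z - (\<Sum>i<m. c i * (w i - z i))) /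
                        complex_of_real (\<Sum>i<m. cmod (w i - z i))) \<longlongrightarrow> 0) (atin (Cn m) z))"

definition analytic_subset ::
  "nat \<Rightarrow> (nat \<Rightarrow> complex) set \<Rightarrow> (nat \<Rightarrow> complex) set \<Rightarrow> bool" where
  "analytic_subset m D A \<longleftrightarrow> openin (Cn m) D \<and> A \<subseteq> D \<and>
     (\<forall>z\<in>D. \<exists>V F. openin (Cn m) V \<and> z \<in> V \<and> V \<subseteq> D \<and> finite F \<and> (\<forall>f\<in>F. holo_on m V f) \<and>
        A \<inter> V = {w \<in> V. \<forall>f\<in>F. f w = 0})"

section \<open>Reduced complex spaces\<close>

text \<open>
  The structure sheaf of a reduced complex space is a sheaf of complex-valued functions.
  A section over an open set \<open>U\<close> is represented by any total function with the
  right values on \<open>U\<close>; the values outside \<open>U\<close> carry no meaning.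
\<close>

record 'a fspace =
  Top :: "'a topology"
  Sh :: "'a set \<Rightarrow> ('a \<Rightarrow> complex) set"

definition function_sheaf :: "'a fspace \<Rightarrow> bool" where
  "function_sheaf X \<longleftrightarrow>
     (\<forall>U f g. openin (Top X) U \<longrightarrow> f \<in> Sh X U \<longrightarrow> (\<forall>x\<in>U. f x = g x) \<longrightarrow> g \<in> Sh X U) \<and>
     (\<forall>U V f. openin (Top X) U \<longrightarrow> openin (Top X) V \<longrightarrow> V \<subseteq> U \<longrightarrow> f \<in> Sh X U \<longrightarrow> f \<in> Sh X V) \<and>
     (\<forall>U f. openin (Top X) U \<longrightarrow>
        (\<forall>x\<in>U. \<exists>V. openin (Top X) V \<and> x \<in> V \<and> V \<subseteq> U \<and> f \<in> Sh X V) \<longrightarrow> f \<in> Sh X U)"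

definition open_subspace :: "'a fspace \<Rightarrow> 'a set \<Rightarrow> 'a fspace" where
  "open_subspace X U = \<lparr>Top = subtopology (Top X) U, Sh = Sh X\<rparr>"

text \<open>
  A subset \<open>A\<close> of complex number space with the functions that locally extend
  holomorphically to the ambient space. For analytic \<open>A\<close> this is the quotient of the ambient
  structure sheaf by the full ideal sheaf of \<open>A\<close>.
\<close>

definition model_space :: "nat \<Rightarrow> (nat \<Rightarrow> complex) set \<Rightarrow> (nat \<Rightarrow> complex) fspace" where
  "model_space m A = \<lparr>Top = subtopology (Cn m) A,
     Sh = (\<lambda>W. {g. \<forall>z\<in>W. \<exists>V G. z \<in> V \<and> holo_on m V G \<and> (\<forall>w\<in>W \<inter> V. g w = G w)})\<rparr>"

definition fspace_iso :: "('a \<Rightarrow> 'b) \<Rightarrow> 'a fspace \<Rightarrow> 'b fspace \<Rightarrow> bool" where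
  "fspace_iso \<phi> X Y \<longleftrightarrow> homeomorphic_map (Top X) (Top Y) \<phi> \<and>
     (\<forall>W g. openin (Top Y) W \<longrightarrow>
        (g \<in> Sh Y W \<longleftrightarrow> g \<circ> \<phi> \<in> Sh X {x \<in> topspace (Top X). \<phi> x \<in> W}))"

definition reduced_complex_space :: "'a fspace \<Rightarrow> bool" where
  "reduced_complex_space X \<longleftrightarrow>
     Hausdorff_space (Top X) \<and> second_countable (Top X) \<and> function_sheaf X \<and>
     (\<forall>x\<in>topspace (Top X). \<exists>U m D A \<phi>. openin (Top X) U \<and> x \<in> U \<and> analytic_subset m D A \<and>
        fspace_iso \<phi> (open_subspace X U) (model_space m A))"

definition hol_functions :: "'a fspace \<Rightarrow> ('a \<Rightarrow> complex) set" where
  "hol_functions X = Sh X (topspace (Top X))"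

definition regular_point :: "'a fspace \<Rightarrow> nat \<Rightarrow> 'a \<Rightarrow> bool" where
  "regular_point X k x \<longleftrightarrow> (\<exists>U D \<phi>. openin (Top X) U \<and> x \<in> U \<and> openin (Cn k) D \<and>
     fspace_iso \<phi> (open_subspace X U) (model_space k D))"

text \<open>
  The complex dimension of a reduced space is the largest dimension at its regular points, which
  form a dense subset. The space need not be pure-dimensional; the empty space has no dimension.
\<close>

definition has_complex_dim :: "'a fspace \<Rightarrow> nat \<Rightarrow> bool" where
  "has_complex_dim X d \<longleftrightarrow> (\<exists>x\<in>topspace (Top X). regular_point X d x) \<and>
     (\<forall>x\<in>topspace (Top X). \<forall>k. regular_point X k x \<longrightarrow> k \<le> d)"

section \<open>Stein spaces\<close>

definition hol_hull :: "'a fspace \<Rightarrow> 'a set \<Rightarrow> 'a set" where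
  "hol_hull X K = {x \<in> topspace (Top X). \<forall>f\<in>hol_functions X. cmod (f x) \<le> (SUP y\<in>K. cmod (f y))}"

definition hol_convex :: "'a fspace \<Rightarrow> bool" where
  "hol_convex X \<longleftrightarrow> (\<forall>K. compactin (Top X) K \<longrightarrow> K \<noteq> {} \<longrightarrow> compactin (Top X) (hol_hull X K))"

definition hol_separable :: "'a fspace \<Rightarrow> bool" where
  "hol_separable X \<longleftrightarrow> (\<forall>x\<in>topspace (Top X). \<forall>y\<in>topspace (Top X). x \<noteq> y \<longrightarrow>
     (\<exists>f\<in>hol_functions X. f x \<noteq> f y))"

definition reduced_stein_space :: "'a fspace \<Rightarrow> bool" where
  "reduced_stein_space X \<longleftrightarrow> reduced_complex_space X \<and> hol_convex X \<and> hol_separable X"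

section \<open>Holomorphic matrices and involutions\<close>

definition hol_matrix :: "'a fspace \<Rightarrow> ('a \<Rightarrow> complex^'n^'n) \<Rightarrow> bool" where
  "hol_matrix X A \<longleftrightarrow> (\<forall>i j. (\<lambda>x. A x $ i $ j) \<in> hol_functions X)"

definition hol_SL :: "'a fspace \<Rightarrow> ('a \<Rightarrow> complex^'n^'n) \<Rightarrow> bool" where
  "hol_SL X A \<longleftrightarrow> hol_matrix X A \<and> (\<forall>x\<in>topspace (Top X). det (A x) = 1)"

definition null_homotopic :: "'a fspace \<Rightarrow> ('a \<Rightarrow> complex^'n^'n) \<Rightarrow> bool" where
  "null_homotopic X A \<longleftrightarrow>
     (\<exists>c. homotopic_with (\<lambda>_. True) (Top X) (top_of_set {M. det M = 1}) A (\<lambda>_. c))"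

text \<open>Such a matrix is its own inverse, hence automatically invertible over the ring of
  holomorphic functions.\<close>

definition hol_involution :: "'a fspace \<Rightarrow> ('a \<Rightarrow> complex^'n^'n) \<Rightarrow> bool" where
  "hol_involution X B \<longleftrightarrow> hol_matrix X B \<and> (\<forall>x\<in>topspace (Top X). B x ** B x = mat 1)"

definition product_of_involutions :: "'a fspace \<Rightarrow> nat \<Rightarrow> ('a \<Rightarrow> complex^'n^'n) \<Rightarrow> bool" where
  "product_of_involutions X N A \<longleftrightarrow>
     (\<exists>Bs. length Bs = N \<and> (\<forall>B\<in>set Bs. hol_involution X B) \<and>
        (\<forall>x\<in>topspace (Top X). A x = foldr (\<lambda>B M. B x ** M) Bs (mat 1)))"

text \<open>
  The matrix size is the cardinality of \<open>'n\<close>. Spaces are taken with points in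
  \<open>nat \<Rightarrow> complex\<close>; this is no restriction up to isomorphism, because a second countable
  complex space has at most the cardinality of the continuum. The number is valued in
  \<open>enat\<close>, so that the infimum is the minimum when some bound exists and \<open>\<infinity>\<close> otherwise.
\<close>

definition I_hol :: "'n::finite itself \<Rightarrow> nat \<Rightarrow> enat" where
  "I_hol _ d = Inf (enat ` {N. \<forall>(X :: (nat \<Rightarrow> complex) fspace) (A :: _ \<Rightarrow> complex^'n^'n).
     reduced_stein_space X \<longrightarrow> has_complex_dim X d \<longrightarrow> hol_SL X A \<longrightarrow> null_homotopic X A \<longrightarrow>
     product_of_involutions X N A})"

end

theory Submission
  imports Defs "HOL-Complex_Analysis.Complex_Analysis"
begin

text \<open>
  A word \<open>A = g\<^sub>1 \<cdots> g\<^sub>m\<close> of invertible matrix functions carries an explicit 2-form. The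
  Cartan 3-form \<open>\<Theta>(g) = (1/3) tr (g\<^sup>-\<^sup>1 dg)\<^sup>3\<close> is additive on products up to an exact form: by the
  Polyakov-Wiegmann identity, \<open>d tr(P\<^sup>-\<^sup>1 dP \<and> dQ Q\<^sup>-\<^sup>1) = \<Theta>(P) + \<Theta>(Q) - \<Theta>(PQ)\<close>. Involutions and the
  matrices \<open>M(a) = [[a, -1], [1, 0]] \<oplus> I\<close> both have \<open>\<Theta> = 0\<close>. A word \<open>w\<close> in such letters therefore has
  a 2-form \<open>\<Omega>(w)\<close>, a sum of Polyakov-Wiegmann terms, with \<open>d \<Omega>(w) = - \<Theta>(A)\<close>
  (\<open>word_form_closed_up_to_cartan3\<close>), and two words with the same product have 2-forms that differ
  by a closed form. The form of a word of \<open>N\<close> involutions of size \<open>n\<close> is a sum of \<open>N n\<^sup>2\<close> products of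
  two 1-forms, whatever the dimension of the space, so its \<open>k\<close>-th power vanishes as soon as
  \<open>k > N n\<^sup>2\<close> (\<open>word_form_low_rank\<close>, \<open>Pf_low_rank\<close>).

  The matrix that needs many involutions is \<open>A = M(x\<^sub>0) \<cdots> M(x\<^bsub>5k-1\<^esub>)\<close> on complex number space of
  dimension \<open>d \<ge> 5k\<close>; it is null-homotopic because the space contracts. If five consecutive
  parameters are the entries of a pentagon frieze, which are Laurent polynomials in two free
  parameters \<open>x, y\<close>, then the product of the five letters is constant, while their 2-form is
  \<open>2 dlog x \<and> dlog y\<close>, the regulator of a Steinberg symbol. With \<open>k\<close> such blocks one obtains a torus
  of dimension \<open>2k\<close> in complex number space on which \<open>A\<close> is constant and \<open>\<Omega>\<close> is the symplectic form
  \<open>2 \<Sum> dlog x\<^sub>l \<and> dlog y\<^sub>l\<close> with constant coefficients (\<open>word_form_frieze_word_std_form\<close>).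

  Suppose that \<open>A\<close> is also a product of \<open>N\<close> involutions. The torus contracts inside complex number
  space by scaling, and the difference of the two word forms is closed on the whole contraction.
  Hence on the torus the 2-form of the involutions is cohomologous to the symplectic form, and the
  integral of its \<open>k\<close>-th power over \<open>(S\<^sup>1)\<^bsup>2k\<^esup>\<close> is the nonzero integral of the \<open>k\<close>-th power of the
  symplectic form (\<open>torus_mean_Pf_stationary\<close>, \<open>Pf_std_form_nonzero\<close>). This forces \<open>k \<le> N n\<^sup>2\<close>
  (\<open>no_involution_word\<close>), so fewer than about \<open>d / (5 n\<^sup>2)\<close> involutions do not suffice.

  The forms are written in coordinates: the variables \<open>u\<^sub>0, \<dots>, u\<^bsub>2k-1\<^esub>\<close> are logarithms of the torus
  coordinates and \<open>u\<^bsub>2k\<^esub>\<close> is the scaling parameter, so all functions are entire and periodic. The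
  top power of a 2-form becomes an antisymmetrised product of coefficients, and the integral over
  the torus an iterated mean over periods.
\<close>

section \<open>Separately holomorphic functions and torus means\<close>

text \<open>
  For functions of finitely many coordinates these are the entire functions, by Osgood's lemma.
  Indexing the coordinates by all of \<^typ>\<open>nat\<close> makes the class closed under coordinatewise
  operations without bookkeeping of dimensions.
\<close>

definition sep_hol :: "((nat \<Rightarrow> complex) \<Rightarrow> complex) \<Rightarrow> bool" where
  "sep_hol g \<longleftrightarrow> continuous_on UNIV g \<and> (\<forall>u i. (\<lambda>z. g (u(i := z))) holomorphic_on UNIV)"

definition pd :: "nat \<Rightarrow> ((nat \<Rightarrow> complex) \<Rightarrow> complex) \<Rightarrow> (nat \<Rightarrow> complex) \<Rightarrow> complex" where
  "pd i g u = deriv (\<lambda>z. g (u(i := z))) (u i)"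

lemma sep_hol_continuous: "sep_hol g \<Longrightarrow> continuous_on UNIV g"
  by (simp add: sep_hol_def)

lemma sep_hol_has_pd:
  assumes "sep_hol g"
  shows "((\<lambda>z. g (u(i := z))) has_field_derivative pd i g (u(i := w))) (at w)"
proof -
  have "(\<lambda>z. g (u(i := z))) field_differentiable at w"
    using assms unfolding sep_hol_def by (simp add: holomorphic_on_def)
  then show ?thesis
    by (simp add: pd_def DERIV_deriv_iff_field_differentiable)
qed

lemma pd_eqI:
  assumes "((\<lambda>z. g (u(i := z))) has_field_derivative D) (at (u i))"
  shows "pd i g u = D"
  using assms by (simp add: pd_def DERIV_imp_deriv)

lemma sep_hol_has_pd':
  assumes "sep_hol g"
  shows "((\<lambda>z. g (u(i := z))) has_field_derivative pd i g u) (at (u i))"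
  using sep_hol_has_pd[OF assms, of u i "u i"] by simp

lemma sep_holI:
  assumes "continuous_on UNIV g"
    and "\<And>u i. \<exists>D. ((\<lambda>z. g (u(i := z))) has_field_derivative D) (at (u i))"
  shows "sep_hol g"
  unfolding sep_hol_def
proof (intro conjI allI assms(1))
  fix u i
  have "(\<lambda>z. g (u(i := z))) field_differentiable at w" for w
    using assms(2)[of "u(i := w)" i] by (auto simp: field_differentiable_def)
  then show "(\<lambda>z. g (u(i := z))) holomorphic_on UNIV"
    by (simp add: holomorphic_on_def)
qed

lemma continuous_coord_comp:
  fixes f :: "'a::topological_space \<Rightarrow> nat \<Rightarrow> complex"
  assumes "continuous_on S f"
  shows "continuous_on S (\<lambda>x. f x i)"
  by (rule continuous_on_product_then_coordinatewise[OF assms])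

lemma sep_hol_const [simp]: "sep_hol (\<lambda>_. c)"
  by (simp add: sep_hol_def)

lemma pd_const [simp]: "pd i (\<lambda>_. c) u = 0"
  by (simp add: pd_def)

lemma sep_hol_coord [simp]: "sep_hol (\<lambda>u. u j)"
proof (rule sep_holI)
  show "\<exists>D. ((\<lambda>z. (u(i := z)) j) has_field_derivative D) (at (u i))" for u and i
    by (cases "i = j") (auto intro: exI[of _ 1] exI[of _ 0])
qed (intro continuous_coord_comp continuous_on_id)

lemma pd_coord: "pd i (\<lambda>u. u j) u = (if i = j then 1 else 0)"
  by (auto simp: pd_def)

lemma sep_hol_add [intro]: "sep_hol f \<Longrightarrow> sep_hol g \<Longrightarrow> sep_hol (\<lambda>u. f u + g u)"
  by (auto simp: sep_hol_def intro!: continuous_intros holomorphic_intros)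

lemma sep_hol_diff [intro]: "sep_hol f \<Longrightarrow> sep_hol g \<Longrightarrow> sep_hol (\<lambda>u. f u - g u)"
  by (auto simp: sep_hol_def intro!: continuous_intros holomorphic_intros)

lemma sep_hol_mult [intro]: "sep_hol f \<Longrightarrow> sep_hol g \<Longrightarrow> sep_hol (\<lambda>u. f u * g u)"
  by (auto simp: sep_hol_def intro!: continuous_intros holomorphic_intros)

lemma sep_hol_minus [intro]: "sep_hol f \<Longrightarrow> sep_hol (\<lambda>u. - f u)"
  by (auto simp: sep_hol_def intro!: continuous_intros holomorphic_intros)

lemma sep_hol_sum [intro]: "(\<And>s. s \<in> S \<Longrightarrow> sep_hol (f s)) \<Longrightarrow> sep_hol (\<lambda>u. \<Sum>s\<in>S. f s u)"
  by (auto simp: sep_hol_def intro!: continuous_intros holomorphic_intros)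

lemma sep_hol_prod [intro]: "(\<And>s. s \<in> S \<Longrightarrow> sep_hol (f s)) \<Longrightarrow> sep_hol (\<lambda>u. \<Prod>s\<in>S. f s u)"
  by (auto simp: sep_hol_def intro!: continuous_intros holomorphic_intros)

lemma sep_hol_exp [intro]: "sep_hol f \<Longrightarrow> sep_hol (\<lambda>u. exp (f u))"
  by (auto simp: sep_hol_def intro!: continuous_intros holomorphic_intros)

lemma pd_add: "sep_hol f \<Longrightarrow> sep_hol g \<Longrightarrow> pd i (\<lambda>u. f u + g u) u = pd i f u + pd i g u"
  by (intro pd_eqI) (auto intro!: derivative_eq_intros sep_hol_has_pd')

lemma pd_diff: "sep_hol f \<Longrightarrow> sep_hol g \<Longrightarrow> pd i (\<lambda>u. f u - g u) u = pd i f u - pd i g u"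
  by (intro pd_eqI) (auto intro!: derivative_eq_intros sep_hol_has_pd')

lemma pd_minus: "sep_hol f \<Longrightarrow> pd i (\<lambda>u. - f u) u = - pd i f u"
  by (intro pd_eqI) (auto intro!: derivative_eq_intros sep_hol_has_pd')

lemma pd_mult:
  "sep_hol f \<Longrightarrow> sep_hol g \<Longrightarrow> pd i (\<lambda>u. f u * g u) u = pd i f u * g u + f u * pd i g u"
  by (intro pd_eqI) (auto intro!: derivative_eq_intros sep_hol_has_pd')

lemma pd_exp: "sep_hol f \<Longrightarrow> pd i (\<lambda>u. exp (f u)) u = exp (f u) * pd i f u"
  by (intro pd_eqI) (auto intro!: derivative_eq_intros sep_hol_has_pd')

lemma pd_sum:
  assumes "\<And>s. s \<in> S \<Longrightarrow> sep_hol (f s)"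
  shows "pd i (\<lambda>u. \<Sum>s\<in>S. f s u) u = (\<Sum>s\<in>S. pd i (f s) u)"
  using assms by (intro pd_eqI) (auto intro!: derivative_eq_intros sep_hol_has_pd')

lemma pd_cong_line:
  assumes "\<And>z. f (u(i := z)) = g (u(i := z))"
  shows "pd i f u = pd i g u"
  by (simp add: pd_def assms)

definition unit_circle :: "real \<Rightarrow> complex" where "unit_circle x = exp (2 * of_real pi * \<i> * of_real x)"

lemma continuous_unit_circle [continuous_intros]:
  "continuous_on S f \<Longrightarrow> continuous_on S (\<lambda>x. unit_circle (f x))"
  unfolding unit_circle_def by (intro continuous_intros)

lemma has_integral_cancel_factor:
  fixes c :: complex
  assumes "((\<lambda>x. f x * c) has_integral c * D) S" "c \<noteq> 0"
  shows "(f has_integral D) S"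
  using has_integral_mult_left[OF assms(1), of "inverse c"] assms(2) by (simp add: field_simps)

text \<open>
  This form of Cauchy's formula integrates over a fixed interval with a kernel that is jointly
  continuous, so that derivatives inherit continuity and holomorphy from the function itself.
\<close>

lemma deriv_eq_circle_integral:
  assumes "f holomorphic_on UNIV"
  shows "deriv f z = integral {0..1} (\<lambda>x. f (z + unit_circle x) / unit_circle x)"
proof -
  have "((\<lambda>u. f u / (u - z) ^ Suc 1) has_contour_integral
      (2 * pi * \<i>) / fact 1 * (deriv ^^ 1) f z) (circlepath z 1)"
    using assms holomorphic_on_imp_continuous_on holomorphic_on_subset
    by (intro Cauchy_has_contour_integral_higher_derivative_circlepath)
      (auto intro: continuous_on_subset)
  then have "((\<lambda>x. f (circlepath z 1 x) / (circlepath z 1 x - z)^2 *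
        vector_derivative (circlepath z 1) (at x)) has_integral 2 * pi * \<i> * deriv f z) {0..1}"
    by (simp add: has_contour_integral numeral_2_eq_2)
  moreover have "circlepath z 1 x = z + unit_circle x" for x
    by (simp add: circlepath unit_circle_def)
  moreover have "vector_derivative (circlepath z 1) (at x) = 2 * pi * \<i> * unit_circle x" for x
    by (simp add: vector_derivative_circlepath unit_circle_def)
  moreover have "unit_circle x \<noteq> 0" for x
    by (simp add: unit_circle_def)
  ultimately have "((\<lambda>x. f (z + unit_circle x) / unit_circle x * (2 * pi * \<i>)) has_integral 2 * pi * \<i> * deriv f z) {0..1}"
    by (simp add: power2_eq_square field_simps)
  then have "((\<lambda>x. f (z + unit_circle x) / unit_circle x) has_integral deriv f z) {0..1}"
    by (rule has_integral_cancel_factor) simp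
  then show ?thesis by (simp add: integral_unique)
qed

lemma pd_eq_circle_integral:
  assumes "sep_hol g"
  shows "pd i g u = integral {0..1} (\<lambda>x. g (u(i := u i + unit_circle x)) / unit_circle x)"
  unfolding pd_def
  by (subst deriv_eq_circle_integral) (use assms in \<open>auto simp: sep_hol_def\<close>)

lemma continuous_fun_upd:
  fixes f :: "'a::topological_space \<Rightarrow> nat \<Rightarrow> complex"
  assumes "continuous_on S f" "continuous_on S h"
  shows "continuous_on S (\<lambda>x. (f x)(i := h x))"
proof (rule continuous_on_coordinatewise_then_product)
  fix j show "continuous_on S (\<lambda>x. ((f x)(i := h x)) j)"
    using assms continuous_on_product_then_coordinatewise[OF assms(1), of j] by (cases "i = j") auto
qed

lemma continuous_shift:
  fixes f :: "'a::topological_space \<Rightarrow> nat \<Rightarrow> complex"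
  assumes "continuous_on S f" "continuous_on S h"
  shows "continuous_on S (\<lambda>x. (f x)(i := f x i + h x))"
  by (intro continuous_fun_upd assms continuous_on_add continuous_coord_comp)

text \<open>
  Two integral operators occur below, Cauchy's formula for a partial derivative and the mean over a
  period. Both integrate kernels of this kind.
\<close>

definition hol_kernel :: "(real \<Rightarrow> (nat \<Rightarrow> complex) \<Rightarrow> complex) \<Rightarrow> bool" where
  "hol_kernel K \<longleftrightarrow> continuous_on UNIV (\<lambda>p. K (snd p) (fst p)) \<and> (\<forall>x. sep_hol (K x))"

lemma hol_kernel_sep_hol: "hol_kernel K \<Longrightarrow> sep_hol (K x)"
  by (simp add: hol_kernel_def)

lemma hol_kernel_continuous:
  assumes "hol_kernel K" "continuous_on S f" "continuous_on S h"
  shows "continuous_on S (\<lambda>p. K (h p) (f p))"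
proof -
  have "continuous_on S (\<lambda>p. (f p, h p))" by (intro continuous_intros assms)
  from continuous_on_compose2[OF _ this, of UNIV "\<lambda>p. K (snd p) (fst p)"] assms(1)
  show ?thesis by (simp add: hol_kernel_def)
qed

lemma unit_circle_nonzero [simp]: "unit_circle x \<noteq> 0" by (simp add: unit_circle_def)

text \<open>
  Joint continuity of the derivative is the hypothesis under which differentiation under the integral
  sign is permitted; it comes from Cauchy's formula applied for each parameter value.
\<close>

lemma hol_kernel_continuous_pd:
  assumes "hol_kernel K"
  shows "continuous_on UNIV (\<lambda>p. pd i (K (snd p)) (fst p))"
proof -
  have "continuous_on UNIV (\<lambda>p::((nat \<Rightarrow> complex) \<times> real). integral (cbox 0 1)
      (\<lambda>y. K (snd p) ((fst p)(i := fst p i + unit_circle y)) / unit_circle y))"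
    by (rule integral_continuous_on_param, unfold case_prod_beta)
      (intro continuous_on_divide hol_kernel_continuous[OF assms] continuous_shift; simp add: continuous_intros)
  then show ?thesis
    by (simp add: pd_eq_circle_integral[OF hol_kernel_sep_hol[OF assms]] box_real)
qed

lemma
  assumes K: "hol_kernel K"
  shows sep_hol_integral: "sep_hol (\<lambda>u. integral {0..1} (\<lambda>x. K x u))"
    and pd_integral: "pd j (\<lambda>u. integral {0..1} (\<lambda>x. K x u)) u = integral {0..1} (\<lambda>x. pd j (K x) u)"
proof -
  have cont: "continuous_on UNIV (\<lambda>u. integral (cbox 0 1) (\<lambda>x. K x u))"
    by (rule integral_continuous_on_param, unfold case_prod_beta)
      (intro continuous_intros hol_kernel_continuous[OF K])
  have D: "((\<lambda>z. integral (cbox 0 1) (\<lambda>x. K x (u(i := z)))) has_field_derivative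
      integral (cbox 0 1) (\<lambda>x. pd i (K x) (u(i := u i)))) (at (u i) within UNIV)" for u i
  proof (rule leibniz_rule_field_derivative)
    show "((\<lambda>z. K t (u(i := z))) has_field_derivative pd i (K t) (u(i := x))) (at x within UNIV)"
      for x t by (rule sep_hol_has_pd[OF hol_kernel_sep_hol[OF K]])
    show "(\<lambda>x. K x (u(i := z))) integrable_on cbox 0 1" for z
      by (intro integrable_continuous hol_kernel_continuous[OF K] continuous_intros)
    have "continuous_on (UNIV \<times> cbox 0 1) (\<lambda>q::complex\<times>real. (u(i := fst q), snd q))"
      by (intro continuous_on_Pair continuous_fun_upd continuous_intros)
    from continuous_on_compose2[OF hol_kernel_continuous_pd[OF K, of i] this]
    show "continuous_on (UNIV \<times> cbox 0 1) (\<lambda>(x, t). pd i (K t) (u(i := x)))"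
      by (simp add: case_prod_beta)
  qed auto
  show "sep_hol (\<lambda>u. integral {0..1} (\<lambda>x. K x u))"
    using cont D by (intro sep_holI) (auto simp: box_real)
  show "pd j (\<lambda>u. integral {0..1} (\<lambda>x. K x u)) u = integral {0..1} (\<lambda>x. pd j (K x) u)"
    using D[of u j] by (intro pd_eqI) (simp add: box_real)
qed

lemma sep_hol_shift:
  assumes "sep_hol g"
  shows "sep_hol (\<lambda>u. g (u(i := u i + c)))"
    and "pd j (\<lambda>u. g (u(i := u i + c))) u = pd j g (u(i := u i + c))"
proof -
  have D: "((\<lambda>z. g ((u(j := z))(i := (u(j := z)) i + c))) has_field_derivative
      pd j g (u(i := u i + c))) (at (u j))" for u j
  proof (cases "i = j")
    case True
    have "((\<lambda>z. g (u(j := z))) has_field_derivative pd j g (u(j := u j + c))) (at (u j + c))"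
      by (rule sep_hol_has_pd[OF assms])
    then have "((\<lambda>z. g (u(j := z + c))) has_field_derivative pd j g (u(j := u j + c))) (at (u j))"
      by (simp add: DERIV_shift)
    with True show ?thesis by simp
  next
    case False
    then show ?thesis
      using sep_hol_has_pd'[OF assms, of "u(i := u i + c)" j] by (simp add: fun_upd_twist)
  qed
  have "continuous_on UNIV (\<lambda>u. u(i := u i + c))" by (intro continuous_shift continuous_intros)
  from continuous_on_compose2[OF sep_hol_continuous[OF assms] this]
  show "sep_hol (\<lambda>u. g (u(i := u i + c)))"
    using D by (intro sep_holI) auto
  show "pd j (\<lambda>u. g (u(i := u i + c))) u = pd j g (u(i := u i + c))"
    using D by (intro pd_eqI)
qed

lemma hol_kernel_shift:
  assumes "sep_hol g" "continuous_on UNIV s" "continuous_on UNIV (c :: real \<Rightarrow> complex)"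
  shows "hol_kernel (\<lambda>x u. g (u(i := u i + s x)) * c x)"
  unfolding hol_kernel_def
proof (intro conjI allI)
  have s: "continuous_on UNIV (\<lambda>p::(nat \<Rightarrow> complex) \<times> real. s (snd p))"
    by (rule continuous_on_compose2[OF assms(2)]) (auto intro: continuous_intros)
  have c: "continuous_on UNIV (\<lambda>p::(nat \<Rightarrow> complex) \<times> real. c (snd p))"
    by (rule continuous_on_compose2[OF assms(3)]) (auto intro: continuous_intros)
  have "continuous_on UNIV (\<lambda>p::(nat \<Rightarrow> complex) \<times> real. (fst p)(i := fst p i + s (snd p)))"
    by (intro continuous_shift s continuous_on_fst continuous_on_id)
  then show "continuous_on UNIV (\<lambda>p. g ((fst p)(i := fst p i + s (snd p))) * c (snd p))"
    using continuous_on_compose2[OF sep_hol_continuous[OF assms(1)]] c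
    by (intro continuous_on_mult) auto
  show "sep_hol (\<lambda>u. g (u(i := u i + s x)) * c x)" for x
    using sep_hol_shift(1)[OF assms(1)] by (rule sep_hol_mult) simp
qed

lemma continuous_unit_circle_inverse: "continuous_on UNIV (\<lambda>x. inverse (unit_circle x))"
  by (intro continuous_intros) simp

lemma sep_hol_pd [intro]:
  assumes "sep_hol g"
  shows "sep_hol (pd i g)"
proof -
  have "hol_kernel (\<lambda>x u. g (u(i := u i + unit_circle x)) * inverse (unit_circle x))"
    by (intro hol_kernel_shift assms continuous_unit_circle_inverse continuous_intros)
  from sep_hol_integral[OF this] show ?thesis
    by (subst ext[OF pd_eq_circle_integral[OF assms]]) (simp add: divide_inverse)
qed

text \<open>
  One derivative is written as a Cauchy integral; the other one then passes under the integral.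
\<close>

lemma pd_commute:
  assumes "sep_hol g"
  shows "pd i (pd j g) u = pd j (pd i g) u"
proof -
  have *: "hol_kernel (\<lambda>x u. g (u(j := u j + unit_circle x)) * inverse (unit_circle x))"
    by (intro hol_kernel_shift assms continuous_unit_circle_inverse continuous_intros)
  have "pd i (pd j g) u = pd i (\<lambda>u. integral {0..1} (\<lambda>x. g (u(j := u j + unit_circle x)) * inverse (unit_circle x))) u"
    by (subst ext[OF pd_eq_circle_integral[OF assms]]) (simp add: divide_inverse)
  also have "\<dots> = integral {0..1} (\<lambda>x. pd i (\<lambda>u. g (u(j := u j + unit_circle x)) * inverse (unit_circle x)) u)"
    by (rule pd_integral[OF *])
  also have "\<dots> = integral {0..1} (\<lambda>x. pd i g (u(j := u j + unit_circle x)) * inverse (unit_circle x))"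
    by (simp add: pd_mult sep_hol_shift[OF assms])
  also have "\<dots> = pd j (pd i g) u"
    by (simp add: pd_eq_circle_integral[OF sep_hol_pd[OF assms]] divide_inverse)
  finally show ?thesis .
qed

definition periodic :: "nat \<Rightarrow> ((nat \<Rightarrow> complex) \<Rightarrow> complex) \<Rightarrow> bool" where
  "periodic i g \<longleftrightarrow> (\<forall>u. g (u(i := u i + 2 * of_real pi * \<i>)) = g u)"

definition avg :: "nat \<Rightarrow> ((nat \<Rightarrow> complex) \<Rightarrow> complex) \<Rightarrow> (nat \<Rightarrow> complex) \<Rightarrow> complex" where
  "avg i g u = integral {0..1} (\<lambda>x. g (u(i := u i + 2 * of_real pi * \<i> * of_real x)))"

lemma hol_kernel_avg:
  assumes "sep_hol g"
  shows "hol_kernel (\<lambda>x u. g (u(i := u i + 2 * of_real pi * \<i> * of_real x)))"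
  using hol_kernel_shift[OF assms, of "\<lambda>x. 2 * of_real pi * \<i> * of_real x" "\<lambda>_. 1" i]
  by (simp add: continuous_intros)

lemma avg_eq_fun: "avg i g = (\<lambda>u. integral {0..1} (\<lambda>x. g (u(i := u i + 2 * of_real pi * \<i> * of_real x))))"
  by (simp add: fun_eq_iff avg_def)

lemma sep_hol_avg [intro]: "sep_hol g \<Longrightarrow> sep_hol (avg i g)"
  unfolding avg_eq_fun by (intro sep_hol_integral hol_kernel_avg)

lemma pd_avg:
  assumes "sep_hol g"
  shows "pd j (avg i g) = avg i (pd j g)"
  by (rule ext)
    (simp add: avg_eq_fun pd_integral[OF hol_kernel_avg[OF assms]] sep_hol_shift[OF assms])

lemma periodic_avg:
  assumes "periodic j g" shows "periodic j (avg i g)"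
  unfolding periodic_def avg_def
proof
  fix u
  have "g ((u(j := u j + 2 * of_real pi * \<i>))(i := (u(j := u j + 2 * of_real pi * \<i>)) i + c)) = g (u(i := u i + c))" for c
  proof (cases "i = j")
    case True
    then show ?thesis using assms[unfolded periodic_def, rule_format, of "u(i := u i + c)"]
      by (simp add: algebra_simps)
  next
    case False
    then show ?thesis using assms[unfolded periodic_def, rule_format, of "u(i := u i + c)"]
      by (simp add: fun_upd_twist)
  qed
  then show "integral {0..1} (\<lambda>x. g ((u(j := u j + 2 * of_real pi * \<i>))(i := (u(j := u j + 2 * of_real pi * \<i>)) i + 2 * of_real pi * \<i> * of_real x))) =
      integral {0..1} (\<lambda>x. g (u(i := u i + 2 * of_real pi * \<i> * of_real x)))"
    by simp
qed

lemma avg_pd_periodic: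
  assumes "sep_hol g" "periodic i g"
  shows "avg i (pd i g) u = 0"
proof -
  let ?c = "2 * of_real pi * \<i>"
  have "((\<lambda>x. ?c * pd i g (u(i := u i + ?c * of_real x))) has_integral
      g (u(i := u i + ?c * of_real 1)) - g (u(i := u i + ?c * of_real 0))) {0..1}"
  proof (rule fundamental_theorem_of_calculus)
    fix x :: real assume "x \<in> {0..1}"
    have 1: "((\<lambda>z. g (u(i := z))) has_field_derivative pd i g (u(i := u i + ?c * of_real x))) (at (u i + ?c * of_real x))"
      by (rule sep_hol_has_pd[OF assms(1)])
    have 2: "((\<lambda>x. u i + ?c * of_real x) has_vector_derivative ?c) (at x within {0..1})"
      by (auto intro!: derivative_eq_intros simp: has_vector_derivative_def scaleR_conv_of_real mult.commute)
    show "((\<lambda>x. g (u(i := u i + ?c * of_real x))) has_vector_derivative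
          ?c * pd i g (u(i := u i + ?c * of_real x))) (at x within {0..1})"
      using field_vector_diff_chain_within[OF 2 has_field_derivative_at_within[OF 1]]
      by (simp add: o_def)
  qed simp
  moreover have "g (u(i := u i + ?c * of_real 1)) = g u"
    using assms(2) by (simp add: periodic_def)
  ultimately have "((\<lambda>x. pd i g (u(i := u i + ?c * of_real x)) * ?c) has_integral ?c * 0) {0..1}"
    by (simp add: mult.commute)
  then have "((\<lambda>x. pd i g (u(i := u i + ?c * of_real x))) has_integral 0) {0..1}"
    by (rule has_integral_cancel_factor) simp
  then show ?thesis by (simp add: avg_def integral_unique)
qed

lemma avg_zero_fun: "avg i (\<lambda>_. 0) = (\<lambda>_. 0)" by (simp add: avg_def fun_eq_iff)

text \<open>
  The integral over the torus \<open>(S\<^sup>1)\<^sup>m\<close> in logarithmic coordinates, normalised to total mass 1.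
\<close>

definition torus_mean :: "nat \<Rightarrow> ((nat \<Rightarrow> complex) \<Rightarrow> complex) \<Rightarrow> (nat \<Rightarrow> complex) \<Rightarrow> complex" where
  "torus_mean m g = foldr avg [0..<m] g"

lemma sep_hol_foldr_avg: "sep_hol g \<Longrightarrow> sep_hol (foldr avg is g)"
  by (induction "is") auto

lemma sep_hol_torus_mean: "sep_hol g \<Longrightarrow> sep_hol (torus_mean m g)"
  by (simp add: torus_mean_def sep_hol_foldr_avg)

lemma pd_foldr_avg: "sep_hol g \<Longrightarrow> pd j (foldr avg is g) = foldr avg is (pd j g)"
  by (induction "is") (auto simp: pd_avg sep_hol_foldr_avg)

lemma pd_torus_mean: "sep_hol g \<Longrightarrow> pd j (torus_mean m g) = torus_mean m (pd j g)"
  by (simp add: torus_mean_def pd_foldr_avg)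

lemma periodic_foldr_avg: "periodic j g \<Longrightarrow> periodic j (foldr avg is g)"
  by (induction "is") (auto simp: periodic_avg)

lemma foldr_avg_zero: "foldr avg is (\<lambda>_. 0) = (\<lambda>_. 0)"
  by (induction "is") (auto simp: avg_zero_fun)

text \<open>
  Stokes' theorem on the torus: exact forms have integral zero.
\<close>

lemma torus_mean_pd:
  assumes "sep_hol g" "periodic i g" "i < m"
  shows "torus_mean m (pd i g) = (\<lambda>_. 0)"
proof -
  obtain xs ys where "[0..<m] = xs @ i # ys"
    using assms(3) by (metis atLeastLessThan_iff set_upt split_list zero_le)
  moreover have "avg i (foldr avg ys (pd i g)) = (\<lambda>_. 0)"
    using assms by (auto simp: pd_foldr_avg[symmetric] fun_eq_iff
        intro!: avg_pd_periodic sep_hol_foldr_avg periodic_foldr_avg)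
  ultimately show ?thesis by (simp add: torus_mean_def foldr_avg_zero)
qed

lemma avg_add:
  assumes "sep_hol f" "sep_hol g"
  shows "avg i (\<lambda>u. f u + g u) = (\<lambda>u. avg i f u + avg i g u)"
proof -
  have "(\<lambda>x. h (u(i := u i + 2 * of_real pi * \<i> * of_real x))) integrable_on {0..1}" if "sep_hol h" for h u
    using hol_kernel_continuous[OF hol_kernel_avg[OF that], of "{0..1}" "\<lambda>_. u" "\<lambda>x. x"]
    by (intro integrable_continuous_interval) (simp add: continuous_intros)
  then show ?thesis using assms by (simp add: avg_def fun_eq_iff integral_add)
qed

lemma torus_mean_add:
  assumes "sep_hol f" "sep_hol g"
  shows "torus_mean m (\<lambda>u. f u + g u) = (\<lambda>u. torus_mean m f u + torus_mean m g u)"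
proof -
  have "foldr avg is (\<lambda>u. f u + g u) = (\<lambda>u. foldr avg is f u + foldr avg is g u)" for "is"
    using assms by (induction "is") (auto simp: avg_add sep_hol_foldr_avg)
  then show ?thesis by (simp add: torus_mean_def)
qed

lemma torus_mean_cmult: "torus_mean m (\<lambda>u. c * g u) = (\<lambda>u. c * torus_mean m g u)"
proof -
  have "foldr avg is (\<lambda>u. c * g u) = (\<lambda>u. c * foldr avg is g u)" for "is"
    by (induction "is") (auto simp: avg_def fun_eq_iff)
  then show ?thesis by (simp add: torus_mean_def)
qed

lemma torus_mean_zero [simp]: "torus_mean m (\<lambda>_. 0) = (\<lambda>_. 0)"
  by (simp add: torus_mean_def foldr_avg_zero)

lemma torus_mean_sum:
  assumes "finite S" "\<And>s. s \<in> S \<Longrightarrow> sep_hol (f s)"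
  shows "torus_mean m (\<lambda>u. \<Sum>s\<in>S. f s u) = (\<lambda>u. \<Sum>s\<in>S. torus_mean m (f s) u)"
  using assms
proof (induction rule: finite_induct)
  case (insert s S)
  then have "torus_mean m (\<lambda>u. f s u + (\<Sum>s\<in>S. f s u)) = (\<lambda>u. torus_mean m (f s) u + (\<Sum>s\<in>S. torus_mean m (f s) u))"
    by (subst torus_mean_add) auto
  with insert show ?case by simp
qed simp

text \<open>
  The mean only moves the coordinates below \<open>m\<close>, hence it stays on each slice \<open>u j = t\<close>.
\<close>

lemma torus_mean_const_on_slice:
  assumes "\<And>u. u j = t \<Longrightarrow> g u = c" "m \<le> j" "u j = t"
  shows "torus_mean m g u = c"
proof -
  have "foldr avg is g u = c" if "u j = t" "\<forall>i\<in>set is. i \<noteq> j" for "is" u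
    using that
  proof (induction "is" arbitrary: u)
    case (Cons i "is")
    then have "avg i (foldr avg is g) u = integral {0..1} (\<lambda>x::real. c)"
      unfolding avg_def by (intro integral_cong) auto
    then show ?case by simp
  qed (simp add: assms)
  then show ?thesis using assms by (auto simp: torus_mean_def)
qed

lemma sep_hol_constant_along:
  assumes "sep_hol g" "\<And>u. pd j g u = 0"
  shows "g (u(j := a)) = g (u(j := b))"
proof -
  have "((\<lambda>z. g (u(j := z))) has_field_derivative 0) (at z)" for z
    using sep_hol_has_pd[OF assms(1), of u j z] assms(2) by simp
  then have "\<exists>c. \<forall>z\<in>UNIV. g (u(j := z)) = c"
    by (intro has_field_derivative_zero_constant) auto
  then show ?thesis by auto
qed

section \<open>Antisymmetrised products of 2-forms\<close>

abbreviation swp :: "nat \<Rightarrow> nat \<Rightarrow> nat \<Rightarrow> nat" where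
  "swp \<equiv> Transposition.transpose"


text \<open>
  The coefficient of the volume form in a product of forms, up to a factorial factor: \<open>\<sigma>\<close> runs over the
  ways to distribute the coordinates over the slots of \<open>F\<close>.
\<close>

definition alternate :: "nat \<Rightarrow> ((nat \<Rightarrow> nat) \<Rightarrow> complex) \<Rightarrow> complex" where
  "alternate m F = (\<Sum>\<sigma> | \<sigma> permutes {..<m}. of_int (sign \<sigma>) * F \<sigma>)"

lemma alternate_cong:
  "(\<And>\<sigma>. \<sigma> permutes {..<m} \<Longrightarrow> F \<sigma> = G \<sigma>) \<Longrightarrow> alternate m F = alternate m G"
  by (auto simp: alternate_def intro!: sum.cong)

lemma alternate_add: "alternate m (\<lambda>\<sigma>. F \<sigma> + G \<sigma>) = alternate m F + alternate m G"
  by (simp add: alternate_def sum.distrib distrib_left)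

lemma alternate_diff: "alternate m (\<lambda>\<sigma>. F \<sigma> - G \<sigma>) = alternate m F - alternate m G"
  by (simp add: alternate_def sum_subtractf right_diff_distrib)

lemma alternate_sum: "alternate m (\<lambda>\<sigma>. \<Sum>s\<in>S. F s \<sigma>) = (\<Sum>s\<in>S. alternate m (F s))"
  unfolding alternate_def by (subst sum.swap) (simp add: sum_distrib_left)

lemma alternate_compose:
  assumes "\<rho> permutes {..<m}"
  shows "alternate m (\<lambda>\<sigma>. F (\<sigma> \<circ> \<rho>)) = of_int (sign \<rho>) * alternate m F"
proof -
  have p: "permutation \<sigma>" if "\<sigma> permutes {..<m}" for \<sigma>
    using that permutes_imp_permutation by blast
  have "alternate m F = (\<Sum>\<sigma> | \<sigma> permutes {..<m}. of_int (sign (\<sigma> \<circ> \<rho>)) * F (\<sigma> \<circ> \<rho>))"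
    unfolding alternate_def by (rule sum_permutations_compose_right[OF assms])
  also have "\<dots> = (\<Sum>\<sigma> | \<sigma> permutes {..<m}. of_int (sign \<rho>) * (of_int (sign \<sigma>) * F (\<sigma> \<circ> \<rho>)))"
    by (intro sum.cong) (auto simp: sign_compose p assms)
  also have "\<dots> = of_int (sign \<rho>) * alternate m (\<lambda>\<sigma>. F (\<sigma> \<circ> \<rho>))"
    by (simp add: alternate_def sum_distrib_left)
  finally have "of_int (sign \<rho>) * alternate m F =
      of_int (sign \<rho> * sign \<rho>) * alternate m (\<lambda>\<sigma>. F (\<sigma> \<circ> \<rho>))"
    by (simp only: of_int_mult mult.assoc)
  then show ?thesis by simp
qed

lemma alternate_swap:
  assumes "p < m" "q < m" "p \<noteq> q"
  shows "alternate m (\<lambda>\<sigma>. F (\<sigma> \<circ> swp p q)) = - alternate m F"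
  using assms by (subst alternate_compose) (auto simp: sign_swap_id intro!: permutes_swap_id)

lemma alternate_symmetric_zero:
  assumes "p < m" "q < m" "p \<noteq> q" "\<And>\<sigma>. F (\<sigma> \<circ> swp p q) = F \<sigma>"
  shows "alternate m F = 0"
  using alternate_swap[OF assms(1-3), of F] assms(4) by simp

text \<open>
  The two 3-cycles on \<open>p, q, r\<close> are even, so antisymmetrising \<open>F\<close> or its cyclic sum gives the same
  value up to a factor of 3. The closedness of a 2-form enters through this lemma.
\<close>

lemma alternate_cyclic_zero:
  assumes "p < m" "q < m" "r < m" "p \<noteq> q" "q \<noteq> r" "p \<noteq> r"
    and c: "\<And>\<sigma>. \<sigma> permutes {..<m} \<Longrightarrow>
      F \<sigma> + F (\<sigma> \<circ> (swp p q \<circ> swp q r)) + F (\<sigma> \<circ> (swp q r \<circ> swp p q)) = 0"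
  shows "alternate m F = 0"
proof -
  have 1: "alternate m (\<lambda>\<sigma>. F (\<sigma> \<circ> (swp p q \<circ> swp q r))) = alternate m F"
    using alternate_swap[of q m r "\<lambda>\<sigma>. F (\<sigma> \<circ> swp p q)"] alternate_swap[of p m q F]
      alternate_swap[of p m q "\<lambda>\<sigma>. F (\<sigma> \<circ> swp q r)"] alternate_swap[of q m r F] assms
    by (subst alternate_compose)
      (auto simp: sign_compose permutation_swap_id sign_swap_id intro!: permutes_compose permutes_swap_id)
  have 2: "alternate m (\<lambda>\<sigma>. F (\<sigma> \<circ> (swp q r \<circ> swp p q))) = alternate m F"
    using assms
    by (subst alternate_compose)
      (auto simp: sign_compose permutation_swap_id sign_swap_id intro!: permutes_compose permutes_swap_id)
  have "alternate m (\<lambda>\<sigma>. F \<sigma> + F (\<sigma> \<circ> (swp p q \<circ> swp q r)) +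
      F (\<sigma> \<circ> (swp q r \<circ> swp p q))) = alternate m (\<lambda>_. 0)"
    by (rule alternate_cong) (rule c)
  then have "3 * alternate m F = 0"
    unfolding alternate_add 1 2 by (simp add: alternate_def)
  then show ?thesis by simp
qed

text \<open>
  Up to a factor of \<open>2\<^sup>k k!\<close> the Pfaffian of an antisymmetric \<open>Q\<close>, hence a multiple of the
  coefficient of the top power of the 2-form \<open>Q\<close>.
\<close>

definition Pf :: "nat \<Rightarrow> (nat \<Rightarrow> nat \<Rightarrow> complex) \<Rightarrow> complex" where
  "Pf k Q = alternate (2*k) (\<lambda>\<sigma>. \<Prod>l<k. Q (\<sigma> (2*l)) (\<sigma> (2*l+1)))"

lemma Pf_cong:
  assumes "\<And>i j. i < 2*k \<Longrightarrow> j < 2*k \<Longrightarrow> Q i j = R i j"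
  shows "Pf k Q = Pf k R"
  unfolding Pf_def
proof (intro alternate_cong prod.cong refl assms)
  fix \<sigma> l assume "\<sigma> permutes {..<2*k}" "l \<in> {..<k}"
  then show "\<sigma> (2*l) < 2*k" "\<sigma> (2*l+1) < 2*k"
    using permutes_in_image[of \<sigma> "{..<2*k}" "2*l"] permutes_in_image[of \<sigma> "{..<2*k}" "2*l+1"] by auto
qed

lemma transpose_even_odd:
  "l \<noteq> a \<Longrightarrow> l \<noteq> b \<Longrightarrow> p \<in> {2*a, 2*a+1} \<Longrightarrow> q \<in> {2*b, 2*b+1} \<Longrightarrow>
    swp p q (2*l) = 2*l \<and> swp p q (2*l+1) = (2*l+1 :: nat)"
  by (auto simp: Transposition.transpose_def; presburger)

lemma prod_remove2:
  fixes F :: "nat \<Rightarrow> complex"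
  assumes "a < k" "b < k" "a \<noteq> b"
  shows "(\<Prod>l<k. F l) = F a * F b * (\<Prod>l\<in>{..<k}-{a}-{b}. F l)"
  using assms prod.remove[of "{..<k}" a F] prod.remove[of "{..<k}-{a}" b F] by (simp add: mult.assoc)

text \<open>
  The form \<open>f \<and> g\<close> has square zero. After expansion of both slots every summand is symmetric under a
  transposition that exchanges the two arguments of \<open>f\<close>.
\<close>

lemma alternate_repeated_wedge:
  fixes f g :: "nat \<Rightarrow> complex"
  assumes "a < k" "b < k" "a \<noteq> b"
    and W: "\<And>l i j. l \<in> {a, b} \<Longrightarrow> W l i j = f i * g j - f j * g i"
  shows "alternate (2*k) (\<lambda>\<sigma>. \<Prod>l<k. W l (\<sigma> (2*l)) (\<sigma> (2*l+1))) = 0"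
proof -
  let ?R = "\<lambda>\<sigma>. \<Prod>l\<in>{..<k}-{a}-{b}. W l (\<sigma> (2*l)) (\<sigma> (2*l+1))"
  have R: "?R (\<sigma> \<circ> swp p q) = ?R \<sigma>" if "p \<in> {2*a, 2*a+1}" "q \<in> {2*b, 2*b+1}" for \<sigma> p q
    using that transpose_even_odd[of _ a b p q] by (intro prod.cong) auto
  have z: "alternate (2*k) (\<lambda>\<sigma>. f (\<sigma> p) * f (\<sigma> q) * (g (\<sigma> p') * g (\<sigma> q')) * ?R \<sigma>) = 0"
    if "p \<in> {2*a, 2*a+1}" "q \<in> {2*b, 2*b+1}" "p' \<in> {2*a, 2*a+1} - {p}" "q' \<in> {2*b, 2*b+1} - {q}"
    for p q p' q'
  proof (rule alternate_symmetric_zero)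
    show "p < 2*k" "q < 2*k" using that assms by auto
    show "p \<noteq> q" using that assms(3) by (auto; presburger)
    have ne: "p' \<noteq> p" "p' \<noteq> q" "q' \<noteq> p" "q' \<noteq> q"
      using that assms(3) by (auto; presburger)+
    show "f ((\<sigma> \<circ> swp p q) p) * f ((\<sigma> \<circ> swp p q) q) *
        (g ((\<sigma> \<circ> swp p q) p') * g ((\<sigma> \<circ> swp p q) q')) * ?R (\<sigma> \<circ> swp p q) =
        f (\<sigma> p) * f (\<sigma> q) * (g (\<sigma> p') * g (\<sigma> q')) * ?R \<sigma>" for \<sigma>
      unfolding R[OF that(1,2)] using ne by (simp add: Transposition.transpose_def)
  qed
  have "alternate (2*k) (\<lambda>\<sigma>. \<Prod>l<k. W l (\<sigma> (2*l)) (\<sigma> (2*l+1))) =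
    alternate (2*k) (\<lambda>\<sigma>.
      f (\<sigma> (2*a)) * f (\<sigma> (2*b)) * (g (\<sigma> (2*a+1)) * g (\<sigma> (2*b+1))) * ?R \<sigma>
    - f (\<sigma> (2*a)) * f (\<sigma> (2*b+1)) * (g (\<sigma> (2*a+1)) * g (\<sigma> (2*b))) * ?R \<sigma>
    - f (\<sigma> (2*a+1)) * f (\<sigma> (2*b)) * (g (\<sigma> (2*a)) * g (\<sigma> (2*b+1))) * ?R \<sigma>
    + f (\<sigma> (2*a+1)) * f (\<sigma> (2*b+1)) * (g (\<sigma> (2*a)) * g (\<sigma> (2*b))) * ?R \<sigma>)"
    by (intro alternate_cong, subst prod_remove2[OF assms(1-3)]) (simp add: W algebra_simps)
  also have "\<dots> = 0"
    unfolding alternate_add alternate_diff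
    using z[of "2*a" "2*b" "2*a+1" "2*b+1"] z[of "2*a" "2*b+1" "2*a+1" "2*b"]
      z[of "2*a+1" "2*b" "2*a" "2*b+1"] z[of "2*a+1" "2*b+1" "2*a" "2*b"] by simp
  finally show ?thesis .
qed

text \<open>
  Expanding the \<open>k\<close>-th power, every summand uses some decomposable form twice, by the pigeonhole
  principle.
\<close>

lemma Pf_low_rank:
  fixes f g :: "'s \<Rightarrow> nat \<Rightarrow> complex"
  assumes "finite S" "card S < k"
    and Q: "\<And>i j. i < 2*k \<Longrightarrow> j < 2*k \<Longrightarrow> Q i j = (\<Sum>s\<in>S. f s i * g s j - f s j * g s i)"
  shows "Pf k Q = 0"
proof -
  have "Pf k Q = Pf k (\<lambda>i j. \<Sum>s\<in>S. f s i * g s j - f s j * g s i)"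
    by (intro Pf_cong Q)
  also have "\<dots> = (\<Sum>c\<in>PiE {..<k} (\<lambda>_. S). alternate (2*k)
      (\<lambda>\<sigma>. \<Prod>l<k. f (c l) (\<sigma> (2*l)) * g (c l) (\<sigma> (2*l+1)) - f (c l) (\<sigma> (2*l+1)) * g (c l) (\<sigma> (2*l))))"
    unfolding Pf_def by (subst prod_sum_PiE) (auto simp: assms alternate_sum)
  also have "\<dots> = 0"
  proof (rule sum.neutral, rule ballI)
    fix c assume c: "c \<in> PiE {..<k} (\<lambda>_. S)"
    have "\<not> inj_on c {..<k}"
    proof
      assume "inj_on c {..<k}"
      then have "card {..<k} \<le> card S"
        using c assms(1) by (intro card_inj_on_le) auto
      with assms(2) show False by simp
    qed
    then obtain a b where "a < k" "b < k" "a \<noteq> b" "c a = c b"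
      by (auto simp: inj_on_def)
    then show "alternate (2*k) (\<lambda>\<sigma>. \<Prod>l<k. f (c l) (\<sigma> (2*l)) * g (c l) (\<sigma> (2*l+1)) -
        f (c l) (\<sigma> (2*l+1)) * g (c l) (\<sigma> (2*l))) = 0"
      by (intro alternate_repeated_wedge[where f = "f (c a)" and g = "g (c a)" and a = a and b = b]) auto
  qed
  finally show ?thesis .
qed

text \<open>
  The coefficients of \<open>c \<Sum> du\<^bsub>2l\<^esub> \<and> du\<^bsub>2l+1\<^esub>\<close>.
\<close>

definition std_form :: "complex \<Rightarrow> nat \<Rightarrow> nat \<Rightarrow> complex" where
  "std_form c i j = (if even i \<and> j = i + 1 then c else if even j \<and> i = j + 1 then - c else 0)"

lemma std_form_eq_div_mod:
  "std_form c i j = (if i div 2 = j div 2 \<and> i mod 2 \<noteq> j mod 2 then if even i then c else - c else 0)"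
  by (cases "even i"; cases "even j") (auto simp: std_form_def double_not_eq_Suc_double Suc_double_not_eq_double elim!: evenE oddE)

text \<open>
  The permutation exchanges the blocks \<open>{2a, 2a+1}\<close> and \<open>{2k, 2k+1}\<close> without reversing them.
\<close>

lemma swap_blocks:
  fixes a k i :: nat
  shows "swp (2*a) (2*k) (swp (2*a+1) (2*k+1) i) div 2 = swp a k (i div 2)"
    and "swp (2*a) (2*k) (swp (2*a+1) (2*k+1) i) mod 2 = i mod 2"
  by (cases "even i"; auto simp: Transposition.transpose_def double_not_eq_Suc_double
      Suc_double_not_eq_double elim!: evenE oddE)+

lemma std_form_swap_blocks:
  "std_form c (swp (2*a) (2*k) (swp (2*a+1) (2*k+1) i)) (swp (2*a) (2*k) (swp (2*a+1) (2*k+1) j)) = std_form c i j"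
proof -
  have "even (swp (2*a) (2*k) (swp (2*a+1) (2*k+1) i)) = even i"
    using swap_blocks(2)[of a k i] by (simp add: even_iff_mod_2_eq_zero)
  moreover have "swp a k x = swp a k y \<longleftrightarrow> x = y" for x y
    by (metis transpose_involutory)
  ultimately show ?thesis
    unfolding std_form_eq_div_mod swap_blocks by simp
qed

text \<open>
  A nonzero term comes from a permutation that maps blocks \<open>{2l, 2l+1}\<close> to blocks. The image of the last
  block can be moved to the last place by a double transposition, which is even; reversing a block
  changes the sign of the permutation and that of one coefficient. Hence no cancellation occurs.
\<close>

lemma std_form_term:
  assumes "\<sigma> permutes {..<2*k}"
  shows "of_int (sign \<sigma>) * (\<Prod>l<k. std_form c (\<sigma> (2*l)) (\<sigma> (2*l+1))) \<in> {0, c ^ k}"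
  using assms
proof (induction k arbitrary: \<sigma>)
  case 0
  then show ?case by simp
next
  case (Suc k)
  let ?P = "\<lambda>\<sigma> k. \<Prod>l<k. std_form c (\<sigma> (2*l)) (\<sigma> (2*l+1))"
  have fixed: "of_int (sign \<sigma>) * ?P \<sigma> (Suc k) \<in> {0, c ^ Suc k}"
    if "\<sigma> permutes {..<2 * Suc k}" "\<sigma> (2*k) = 2*k" "\<sigma> (2*k+1) = 2*k+1" for \<sigma>
  proof -
    have "\<sigma> permutes {..<2*k}"
    proof (rule permutes_superset[OF that(1)])
      fix x assume "x \<in> {..<2 * Suc k} - {..<2*k}"
      then have "x = 2*k \<or> x = 2*k+1" by auto
      with that show "\<sigma> x = x" by auto
    qed
    have "std_form c (\<sigma> (2*k)) (\<sigma> (2*k+1)) = c" using that(2,3) by (simp add: std_form_def)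
    with Suc.IH[OF \<open>\<sigma> permutes {..<2*k}\<close>] show ?thesis by (auto simp: mult.assoc[symmetric])
  qed
  have compose: "of_int (sign (swp p q \<circ> \<sigma>)) = - (of_int (sign \<sigma>) :: complex)"
    "swp p q \<circ> \<sigma> permutes {..<2 * Suc k}"
    if "\<sigma> permutes {..<2 * Suc k}" "p < 2 * Suc k" "q < 2 * Suc k" "p \<noteq> q" for \<sigma> p q
  proof -
    have "permutation \<sigma>" using that(1) permutes_imp_permutation by blast
    with that show "of_int (sign (swp p q \<circ> \<sigma>)) = - (of_int (sign \<sigma>) :: complex)"
      by (simp add: sign_compose permutation_swap_id sign_swap_id)
    show "swp p q \<circ> \<sigma> permutes {..<2 * Suc k}"
      using that by (intro permutes_compose permutes_swap_id) auto
  qed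
  have last: "of_int (sign \<sigma>) * ?P \<sigma> (Suc k) \<in> {0, c ^ Suc k}"
    if \<sigma>: "\<sigma> permutes {..<2 * Suc k}" and im: "{\<sigma> (2*k), \<sigma> (2*k+1)} = {2*k, 2*k+1}" for \<sigma>
  proof (cases "\<sigma> (2*k) = 2*k")
    case True
    with im have "\<sigma> (2*k+1) = 2*k+1" by (auto simp: doubleton_eq_iff)
    with fixed[OF \<sigma> True] show ?thesis by blast
  next
    case False
    with im have f: "\<sigma> (2*k) = 2*k+1" "\<sigma> (2*k+1) = 2*k" by (auto simp: doubleton_eq_iff)
    let ?\<tau> = "swp (2*k) (2*k+1) \<circ> \<sigma>"
    have lo: "swp (2*k) (2*k+1) (\<sigma> x) = \<sigma> x" if "x < 2*k" for x
    proof -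
      have "inj \<sigma>" using \<sigma> by (rule permutes_inj)
      then have "\<sigma> x \<noteq> \<sigma> (2*k)" "\<sigma> x \<noteq> \<sigma> (2*k+1)" using that by (simp_all add: inj_eq)
      with f show ?thesis by (simp add: Transposition.transpose_def)
    qed
    have "?P ?\<tau> k = ?P \<sigma> k" by (intro prod.cong) (auto simp: lo[simplified])
    moreover have "std_form c (?\<tau> (2*k)) (?\<tau> (2*k+1)) = - std_form c (\<sigma> (2*k)) (\<sigma> (2*k+1))"
      using f by (simp add: std_form_def)
    ultimately have "?P ?\<tau> (Suc k) = - ?P \<sigma> (Suc k)" by simp
    moreover have "of_int (sign ?\<tau>) * ?P ?\<tau> (Suc k) \<in> {0, c ^ Suc k}"
      using f by (intro fixed compose \<sigma>) auto
    ultimately show ?thesis using compose(1)[OF \<sigma>, of "2*k" "2*k+1"] by simp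
  qed
  show ?case
  proof (cases "?P \<sigma> (Suc k) = 0")
    case True
    then show ?thesis by simp
  next
    case False
    then have "std_form c (\<sigma> (2*k)) (\<sigma> (2*k+1)) \<noteq> 0" by simp
    then obtain a where a: "{\<sigma> (2*k), \<sigma> (2*k+1)} = {2*a, 2*a+1}"
      by (auto simp: std_form_def insert_commute split: if_splits elim!: evenE)
    have "2*k \<in> {..<2 * Suc k}" "2*k+1 \<in> {..<2 * Suc k}" by auto
    then have "\<sigma> (2*k) < 2 * Suc k" "\<sigma> (2*k+1) < 2 * Suc k"
      using permutes_in_image[OF Suc.prems] by blast+
    with a have "2*a+1 < 2 * Suc k" by (metis insertI1 insertI2 insertE singletonD)
    show ?thesis
    proof (cases "a = k")
      case True
      with last[OF Suc.prems] a show ?thesis by simp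
    next
      case False
      define \<tau> where "\<tau> = swp (2*a) (2*k) \<circ> (swp (2*a+1) (2*k+1) \<circ> \<sigma>)"
      have "\<tau> permutes {..<2 * Suc k}"
        unfolding \<tau>_def using \<open>2*a+1 < 2 * Suc k\<close> False by (intro compose Suc.prems) auto
      moreover have "{\<tau> (2*k), \<tau> (2*k+1)} = {2*k, 2*k+1}"
        using a False by (auto simp: \<tau>_def Transposition.transpose_def doubleton_eq_iff)
      ultimately have "of_int (sign \<tau>) * ?P \<tau> (Suc k) \<in> {0, c ^ Suc k}" by (rule last)
      moreover have "of_int (sign \<tau>) = (of_int (sign \<sigma>) :: complex)"
        unfolding \<tau>_def using \<open>2*a+1 < 2 * Suc k\<close> False
        by (subst compose(1), intro compose Suc.prems) (auto simp: compose(1)[OF Suc.prems])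
      moreover have "?P \<tau> (Suc k) = ?P \<sigma> (Suc k)"
        by (simp only: \<tau>_def o_apply std_form_swap_blocks)
      ultimately show ?thesis by (simp only:)
    qed
  qed
qed

lemma Pf_std_form_nonzero:
  assumes "c \<noteq> 0"
  shows "Pf k (std_form c) \<noteq> 0"
proof -
  let ?S = "{\<sigma>. \<sigma> permutes {..<2*k}}"
  let ?T = "\<lambda>\<sigma>. of_int (sign \<sigma>) * (\<Prod>l<k. std_form c (\<sigma> (2*l)) (\<sigma> (2*l+1)))"
  have fin: "finite ?S" by (simp add: finite_permutations)
  have "Pf k (std_form c) = (\<Sum>\<sigma>\<in>?S. ?T \<sigma>)" by (simp add: Pf_def alternate_def)
  also have "\<dots> = (\<Sum>\<sigma>\<in>?S. if ?T \<sigma> = 0 then 0 else c ^ k)"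
    using std_form_term by (intro sum.cong) auto
  also have "\<dots> = of_nat (card {\<sigma>\<in>?S. ?T \<sigma> \<noteq> 0}) * c ^ k"
    using fin by (simp add: sum.If_cases Int_def Collect_neg_eq[symmetric])
  finally have eq: "Pf k (std_form c) = of_nat (card {\<sigma>\<in>?S. ?T \<sigma> \<noteq> 0}) * c ^ k" .
  have "id \<in> {\<sigma>\<in>?S. ?T \<sigma> \<noteq> 0}"
    using assms by (simp add: permutes_id std_form_def)
  moreover have "finite {\<sigma>\<in>?S. ?T \<sigma> \<noteq> 0}" using fin by (rule finite_subset[rotated]) blast
  ultimately have "card {\<sigma>\<in>?S. ?T \<sigma> \<noteq> 0} \<noteq> 0" by (subst card_eq_0_iff) blast
  with assms eq show ?thesis by simp
qed

lemma sep_hol_alternate: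
  assumes "\<And>\<sigma>. sep_hol (F \<sigma>)"
  shows "sep_hol (\<lambda>u. alternate m (\<lambda>\<sigma>. F \<sigma> u))"
  unfolding alternate_def by (intro sep_hol_sum sep_hol_mult assms sep_hol_const)

lemma pd_alternate:
  assumes "\<And>\<sigma>. sep_hol (F \<sigma>)"
  shows "pd i (\<lambda>u. alternate m (\<lambda>\<sigma>. F \<sigma> u)) u = alternate m (\<lambda>\<sigma>. pd i (F \<sigma>) u)"
  unfolding alternate_def
  by (subst pd_sum) (auto intro!: sum.cong simp: pd_mult assms)

lemma pd_prod:
  assumes "\<And>s. s \<in> S \<Longrightarrow> sep_hol (f s)"
  shows "pd i (\<lambda>u. \<Prod>s\<in>S. f s u) u = (\<Sum>s\<in>S. pd i (f s) u * (\<Prod>r\<in>S-{s}. f r u))"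
  using assms by (intro pd_eqI has_field_derivative_prod[THEN DERIV_cong])
    (auto intro!: sep_hol_has_pd')

text \<open>
  Leibniz' rule for \<open>d (\<mu> \<and> Q\<^sup>k\<^sup>-\<^sup>1)\<close>: the terms in which the derivative hits a factor \<open>Q\<close> cancel because
  \<open>Q\<close> is closed.
\<close>

lemma alternate_exact:
  assumes Q: "\<And>i j. sep_hol (Q i j)" and \<mu>: "\<And>i. sep_hol (\<mu> i)"
    and closed: "\<And>i j l u. i < 2*k \<Longrightarrow> j < 2*k \<Longrightarrow> l < 2*k \<Longrightarrow>
      pd i (Q j l) u + pd j (Q l i) u + pd l (Q i j) u = 0"
    and a: "a < k"
  shows "alternate (2*k) (\<lambda>\<sigma>. pd (\<sigma> (2*a)) (\<mu> (\<sigma> (2*a+1))) u *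
        (\<Prod>l\<in>{..<k}-{a}. Q (\<sigma> (2*l)) (\<sigma> (2*l+1)) u)) =
    alternate (2*k) (\<lambda>\<sigma>. pd (\<sigma> (2*a)) (\<lambda>u. \<mu> (\<sigma> (2*a+1)) u *
        (\<Prod>l\<in>{..<k}-{a}. Q (\<sigma> (2*l)) (\<sigma> (2*l+1)) u)) u)"
proof -
  let ?G = "\<lambda>b \<sigma>. \<mu> (\<sigma> (2*a+1)) u * (pd (\<sigma> (2*a)) (Q (\<sigma> (2*b)) (\<sigma> (2*b+1))) u *
      (\<Prod>l\<in>{..<k}-{a}-{b}. Q (\<sigma> (2*l)) (\<sigma> (2*l+1)) u))"
  have zero: "alternate (2*k) (?G b) = 0" if b: "b \<in> {..<k}-{a}" for b
  proof (rule alternate_cyclic_zero[of "2*a" _ "2*b" "2*b+1"])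
    fix \<sigma> assume \<sigma>: "\<sigma> permutes {..<2*k}"
    have lt: "\<sigma> x < 2*k" if "x < 2*k" for x using permutes_in_image[OF \<sigma>, of x] that by simp
    let ?r1 = "swp (2*a) (2*b) \<circ> swp (2*b) (2*b+1)"
    let ?r2 = "swp (2*b) (2*b+1) \<circ> swp (2*a) (2*b)"
    have fix': "?r1 (2*l) = 2*l" "?r1 (2*l+1) = 2*l+1" "?r2 (2*l) = 2*l" "?r2 (2*l+1) = 2*l+1"
      if "l \<noteq> a" "l \<noteq> b" for l
      using that transpose_even_odd[of l a b "2*a" "2*b"] transpose_even_odd[of l b b "2*b" "2*b+1"]
      by simp_all
    have p: "(\<Prod>l\<in>{..<k}-{a}-{b}. Q ((\<sigma> \<circ> r) (2*l)) ((\<sigma> \<circ> r) (2*l+1)) u) =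
        (\<Prod>l\<in>{..<k}-{a}-{b}. Q (\<sigma> (2*l)) (\<sigma> (2*l+1)) u)" if "r \<in> {?r1, ?r2}" for r
      using that fix' by (intro prod.cong) auto
    have ab: "2*a+1 \<noteq> 2*b" "2*b+1 \<noteq> 2*a" "a \<noteq> b" using b by (presburger, presburger, simp)
    have v: "?r1 (2*a) = 2*b" "?r1 (2*b) = 2*b+1" "?r1 (2*b+1) = 2*a" "?r1 (2*a+1) = 2*a+1"
      "?r2 (2*a) = 2*b+1" "?r2 (2*b) = 2*a" "?r2 (2*b+1) = 2*b" "?r2 (2*a+1) = 2*a+1"
      using ab by (simp_all add: Transposition.transpose_def)
    have "pd (\<sigma> (2*a)) (Q (\<sigma> (2*b)) (\<sigma> (2*b+1))) u + pd (\<sigma> (2*b)) (Q (\<sigma> (2*b+1)) (\<sigma> (2*a))) u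
        + pd (\<sigma> (2*b+1)) (Q (\<sigma> (2*a)) (\<sigma> (2*b))) u = 0"
      using a b by (intro closed lt) auto
    then have "\<mu> (\<sigma> (2*a+1)) u * ((pd (\<sigma> (2*a)) (Q (\<sigma> (2*b)) (\<sigma> (2*b+1))) u
        + pd (\<sigma> (2*b)) (Q (\<sigma> (2*b+1)) (\<sigma> (2*a))) u
        + pd (\<sigma> (2*b+1)) (Q (\<sigma> (2*a)) (\<sigma> (2*b))) u) *
        (\<Prod>l\<in>{..<k}-{a}-{b}. Q (\<sigma> (2*l)) (\<sigma> (2*l+1)) u)) = 0"
      by simp
    then show "?G b \<sigma> + ?G b (\<sigma> \<circ> ?r1) + ?G b (\<sigma> \<circ> ?r2) = 0"
      unfolding p[of ?r1, simplified] p[of ?r2, simplified] p[of ?r1, OF insertI1] p[of ?r2, OF insertI2[OF insertI1]]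
      unfolding comp_apply[of \<sigma>] v by (simp add: algebra_simps)
  next
    show "2*a < 2*k" "2*b < 2*k" "2*b+1 < 2*k" "2*a \<noteq> 2*b" "2*b \<noteq> 2*b+1" using a b by auto
    show "2*a \<noteq> 2*b+1" by presburger
  qed
  have "alternate (2*k) (\<lambda>\<sigma>. pd (\<sigma> (2*a)) (\<lambda>u. \<mu> (\<sigma> (2*a+1)) u *
        (\<Prod>l\<in>{..<k}-{a}. Q (\<sigma> (2*l)) (\<sigma> (2*l+1)) u)) u) =
    alternate (2*k) (\<lambda>\<sigma>. pd (\<sigma> (2*a)) (\<mu> (\<sigma> (2*a+1))) u *
        (\<Prod>l\<in>{..<k}-{a}. Q (\<sigma> (2*l)) (\<sigma> (2*l+1)) u) + (\<Sum>b\<in>{..<k}-{a}. ?G b \<sigma>))"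
    by (intro alternate_cong, subst pd_mult, rule \<mu>, intro sep_hol_prod Q, subst pd_prod, rule Q)
      (simp add: sum_distrib_left)
  also have "\<dots> = alternate (2*k) (\<lambda>\<sigma>. pd (\<sigma> (2*a)) (\<mu> (\<sigma> (2*a+1))) u *
        (\<Prod>l\<in>{..<k}-{a}. Q (\<sigma> (2*l)) (\<sigma> (2*l+1)) u))"
    unfolding alternate_add alternate_sum using zero by simp
  finally show ?thesis by simp
qed

lemma torus_mean_alternate:
  assumes "\<And>\<sigma>. sep_hol (F \<sigma>)"
  shows "torus_mean n (\<lambda>u. alternate m (\<lambda>\<sigma>. F \<sigma> u)) = (\<lambda>u. alternate m (\<lambda>\<sigma>. torus_mean n (F \<sigma>) u))"
  unfolding alternate_def
  by (subst torus_mean_sum) (auto simp: finite_permutations torus_mean_cmult assms)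

text \<open>
  A deformation of closed 2-forms on the torus whose velocity is exact does not change the integral of
  the top power. Here \<open>t\<close> is the deformation parameter and \<open>\<mu>\<close> a primitive of the velocity.
\<close>

lemma torus_mean_Pf_stationary:
  assumes Q: "\<And>i j. sep_hol (Q i j)" and \<mu>: "\<And>i. sep_hol (\<mu> i)"
    and per: "\<And>i j l. l < 2*k \<Longrightarrow> periodic l (Q i j)" "\<And>i l. l < 2*k \<Longrightarrow> periodic l (\<mu> i)"
    and closed: "\<And>i j l u. i < 2*k \<Longrightarrow> j < 2*k \<Longrightarrow> l < 2*k \<Longrightarrow>
      pd i (Q j l) u + pd j (Q l i) u + pd l (Q i j) u = 0"
    and exact: "\<And>i j u. i < 2*k \<Longrightarrow> j < 2*k \<Longrightarrow> pd t (Q i j) u = pd i (\<mu> j) u - pd j (\<mu> i) u"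
  shows "torus_mean (2*k) (pd t (\<lambda>u. Pf k (\<lambda>i j. Q i j u))) = (\<lambda>_. 0)"
proof -
  let ?R = "\<lambda>a \<sigma> u. \<Prod>l\<in>{..<k}-{a}. Q (\<sigma> (2*l)) (\<sigma> (2*l+1)) u"
  let ?D = "\<lambda>a \<sigma>. pd (\<sigma> (2*a)) (\<lambda>u. \<mu> (\<sigma> (2*a+1)) u * ?R a \<sigma> u)"
  have sR: "sep_hol (\<lambda>u. \<mu> (\<sigma> (2*a+1)) u * ?R a \<sigma> u)" for a \<sigma>
    by (intro sep_hol_mult \<mu> sep_hol_prod Q)
  have "pd t (\<lambda>u. Pf k (\<lambda>i j. Q i j u)) u = (\<Sum>a<k. 2 * alternate (2*k) (\<lambda>\<sigma>. ?D a \<sigma> u))" for u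
  proof -
    have lt: "\<sigma> x < 2*k" if "x < 2*k" "\<sigma> permutes {..<2*k}" for x \<sigma>
      using permutes_in_image[OF that(2), of x] that by simp
    have "pd t (\<lambda>u. Pf k (\<lambda>i j. Q i j u)) u =
        alternate (2*k) (\<lambda>\<sigma>. \<Sum>a<k. pd t (Q (\<sigma> (2*a)) (\<sigma> (2*a+1))) u * ?R a \<sigma> u)"
      unfolding Pf_def by (subst pd_alternate, intro sep_hol_prod Q, subst pd_prod, rule Q) simp
    also have "\<dots> = (\<Sum>a<k. alternate (2*k) (\<lambda>\<sigma>. pd t (Q (\<sigma> (2*a)) (\<sigma> (2*a+1))) u * ?R a \<sigma> u))"
      by (rule alternate_sum)
    also have "\<dots> = (\<Sum>a<k. 2 * alternate (2*k) (\<lambda>\<sigma>. ?D a \<sigma> u))"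
    proof (rule sum.cong[OF refl])
      fix a assume "a \<in> {..<k}" then have a: "a < k" by simp
      let ?F = "\<lambda>\<sigma>. pd (\<sigma> (2*a)) (\<mu> (\<sigma> (2*a+1))) u * ?R a \<sigma> u"
      have "?R a (\<sigma> \<circ> swp (2*a) (2*a+1)) u = ?R a \<sigma> u" for \<sigma>
        using transpose_even_odd[of _ a a "2*a" "2*a+1"] by (intro prod.cong) auto
      then have sw: "?F (\<sigma> \<circ> swp (2*a) (2*a+1)) = pd (\<sigma> (2*a+1)) (\<mu> (\<sigma> (2*a))) u * ?R a \<sigma> u" for \<sigma>
        by simp
      have "alternate (2*k) (\<lambda>\<sigma>. pd t (Q (\<sigma> (2*a)) (\<sigma> (2*a+1))) u * ?R a \<sigma> u) =
          alternate (2*k) (\<lambda>\<sigma>. ?F \<sigma> - ?F (\<sigma> \<circ> swp (2*a) (2*a+1)))"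
        unfolding sw using a by (intro alternate_cong) (simp add: exact lt left_diff_distrib)
      also have "\<dots> = 2 * alternate (2*k) ?F"
        unfolding alternate_diff using a by (subst alternate_swap) auto
      also have "alternate (2*k) ?F = alternate (2*k) (\<lambda>\<sigma>. ?D a \<sigma> u)"
        by (rule alternate_exact[OF Q \<mu> closed a])
      finally show "alternate (2*k) (\<lambda>\<sigma>. pd t (Q (\<sigma> (2*a)) (\<sigma> (2*a+1))) u * ?R a \<sigma> u) =
        2 * alternate (2*k) (\<lambda>\<sigma>. ?D a \<sigma> u)" .
    qed
    finally show ?thesis .
  qed
  then have "torus_mean (2*k) (pd t (\<lambda>u. Pf k (\<lambda>i j. Q i j u))) =
      torus_mean (2*k) (\<lambda>u. \<Sum>a<k. 2 * alternate (2*k) (\<lambda>\<sigma>. ?D a \<sigma> u))"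
    by presburger
  also have "\<dots> = (\<lambda>u. \<Sum>a<k. 2 * alternate (2*k) (\<lambda>\<sigma>. torus_mean (2*k) (?D a \<sigma>) u))"
  proof -
    have "sep_hol (?D a \<sigma>)" for a \<sigma> by (rule sep_hol_pd[OF sR])
    then show ?thesis
      by (subst torus_mean_sum)
        (simp_all only: finite_lessThan sep_hol_mult sep_hol_const sep_hol_alternate
          torus_mean_cmult torus_mean_alternate)
  qed
  also have "\<dots> = (\<lambda>u. 0)"
  proof (intro ext sum.neutral ballI)
    fix u a assume a: "a \<in> {..<k}"
    have "torus_mean (2*k) (?D a \<sigma>) u = 0" if "\<sigma> permutes {..<2*k}" for \<sigma>
    proof -
      have "\<sigma> (2*a) < 2*k" using permutes_in_image[OF that, of "2*a"] a by simp
      moreover from this have "periodic (\<sigma> (2*a)) (\<lambda>u. \<mu> (\<sigma> (2*a+1)) u * ?R a \<sigma> u)"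
        using per by (simp add: periodic_def)
      ultimately show ?thesis by (simp only: torus_mean_pd[OF sR])
    qed
    then have "alternate (2*k) (\<lambda>\<sigma>. torus_mean (2*k) (?D a \<sigma>) u) = alternate (2*k) (\<lambda>_. 0)"
      by (rule alternate_cong)
    then show "2 * alternate (2*k) (\<lambda>\<sigma>. torus_mean (2*k) (?D a \<sigma>) u) = 0"
      by (simp add: alternate_def)
  qed
  finally show ?thesis .
qed

section \<open>Matrix words and their Polyakov-Wiegmann 2-forms\<close>

lemma matrix_add_rdistrib': "(B + C) ** (A :: complex^'n^'n) = B ** A + C ** A"
  by (vector matrix_matrix_mult_def sum.distrib[symmetric] field_simps)

lemma matrix_diff_ldistrib: "(A :: complex^'n^'n) ** (B - C) = A ** B - A ** C"
  by (vector matrix_matrix_mult_def sum_subtractf[symmetric] field_simps)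

lemma matrix_diff_rdistrib: "(B - C) ** (A :: complex^'n^'n) = B ** A - C ** A"
  by (vector matrix_matrix_mult_def sum_subtractf[symmetric] field_simps)

lemma matrix_minus_left: "(- B) ** (A :: complex^'n^'n) = - (B ** A)"
  by (vector matrix_matrix_mult_def sum_negf[symmetric] field_simps)

lemma matrix_minus_right: "(B :: complex^'n^'n) ** (- A) = - (B ** A)"
  by (vector matrix_matrix_mult_def sum_negf[symmetric] field_simps)

lemmas matrix_distribs = matrix_add_ldistrib matrix_add_rdistrib' matrix_diff_ldistrib
  matrix_diff_rdistrib matrix_minus_left matrix_minus_right

lemma trace_minus: "trace (- (A :: complex^'n^'n)) = - trace A"
  by (simp add: trace_def sum_negf)

definition msep :: "((nat \<Rightarrow> complex) \<Rightarrow> complex^'n^'n) \<Rightarrow> bool" where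
  "msep F \<longleftrightarrow> (\<forall>a b. sep_hol (\<lambda>u. F u $ a $ b))"

definition mpd :: "nat \<Rightarrow> ((nat \<Rightarrow> complex) \<Rightarrow> complex^'n^'n) \<Rightarrow> (nat \<Rightarrow> complex) \<Rightarrow> complex^'n^'n" where
  "mpd i F u = (\<chi> a b. pd i (\<lambda>u. F u $ a $ b) u)"

lemma msep_const [simp]: "msep (\<lambda>_. C)"
  by (simp add: msep_def)

lemma mpd_const [simp]: "mpd i (\<lambda>_. C) u = 0"
  by (simp add: mpd_def vec_eq_iff)

lemma msep_entry: "msep F \<Longrightarrow> sep_hol (\<lambda>u. F u $ a $ b)"
  by (simp add: msep_def)

lemma msep_mult: "msep F \<Longrightarrow> msep G \<Longrightarrow> msep (\<lambda>u. F u ** G u)"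
  by (auto simp: msep_def matrix_matrix_mult_def intro!: sep_hol_sum sep_hol_mult)

lemma mpd_mult:
  "msep F \<Longrightarrow> msep G \<Longrightarrow> mpd i (\<lambda>u. F u ** G u) u = mpd i F u ** G u + F u ** mpd i G u"
  by (simp add: mpd_def vec_eq_iff matrix_matrix_mult_def pd_sum pd_mult msep_entry sep_hol_mult
      sum.distrib)

lemma msep_mpd: "msep F \<Longrightarrow> msep (mpd i F)"
  by (auto simp: msep_def mpd_def intro: sep_hol_pd)

lemma mpd_commute: "msep F \<Longrightarrow> mpd i (mpd j F) u = mpd j (mpd i F) u"
  by (simp add: mpd_def msep_entry pd_commute)

lemma msep_trace: "msep F \<Longrightarrow> sep_hol (\<lambda>u. trace (F u))"
  by (auto simp: trace_def msep_entry intro!: sep_hol_sum)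

lemma pd_trace: "msep F \<Longrightarrow> pd i (\<lambda>u. trace (F u)) u = trace (mpd i F u)"
  by (simp add: trace_def pd_sum msep_entry mpd_def)

type_synonym 'n mfun = "(nat \<Rightarrow> complex) \<Rightarrow> complex^'n^'n"

text \<open>
  Inverses are carried along explicitly, since holomorphy of the inverse is then part of the data.
\<close>

definition munit :: "'n::finite mfun \<times> 'n mfun \<Rightarrow> bool" where
  "munit P \<longleftrightarrow> msep (fst P) \<and> msep (snd P) \<and>
    (\<forall>u. fst P u ** snd P u = mat 1 \<and> snd P u ** fst P u = mat 1)"

text \<open>
  Coefficients of the left-invariant form \<open>P\<^sup>-\<^sup>1 dP\<close>.
\<close>

definition lform :: "'n::finite mfun \<times> 'n mfun \<Rightarrow> nat \<Rightarrow> 'n mfun" where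
  "lform P i u = snd P u ** mpd i (fst P) u"

text \<open>
  Coefficients of the right-invariant form \<open>dP P\<^sup>-\<^sup>1\<close>.
\<close>

definition rform :: "'n::finite mfun \<times> 'n mfun \<Rightarrow> nat \<Rightarrow> 'n mfun" where
  "rform P i u = mpd i (fst P) u ** snd P u"

lemma munitD:
  assumes "munit P"
  shows "msep (fst P)" "msep (snd P)" "fst P u ** snd P u = mat 1" "snd P u ** fst P u = mat 1"
  using assms by (auto simp: munit_def)

lemma msep_lform: "munit P \<Longrightarrow> msep (lform P i)"
  unfolding lform_def by (intro msep_mult msep_mpd munitD)

lemma msep_rform: "munit P \<Longrightarrow> msep (rform P i)"
  unfolding rform_def by (intro msep_mult msep_mpd munitD)

lemma mpd_inverse:
  assumes "munit P"
  shows "mpd i (snd P) u = - (snd P u ** mpd i (fst P) u ** snd P u)"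
proof -
  have "mpd i (\<lambda>u. fst P u ** snd P u) u = 0"
    by (simp add: munitD[OF assms])
  then have "mpd i (fst P) u ** snd P u + fst P u ** mpd i (snd P) u = 0"
    unfolding mpd_mult[OF munitD(1,2)[OF assms]] .
  then have "snd P u ** (mpd i (fst P) u ** snd P u + fst P u ** mpd i (snd P) u) = 0"
    by simp
  then show ?thesis
    by (simp add: matrix_distribs matrix_mul_assoc munitD[OF assms] eq_neg_iff_add_eq_0 add.commute)
qed

text \<open>
  The Maurer-Cartan equation; the second derivatives cancel because partial derivatives commute.
\<close>

lemma lform_structure:
  assumes "munit P"
  shows "mpd k (lform P i) u - mpd i (lform P k) u
    = lform P i u ** lform P k u - lform P k u ** lform P i u"
proof -
  note P = munitD[OF assms]
  have "mpd k (lform P i) u = snd P u ** mpd k (mpd i (fst P)) u - lform P k u ** lform P i u" for k i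
    unfolding lform_def
    by (simp add: mpd_mult msep_mpd P mpd_inverse[OF assms] matrix_distribs matrix_mul_assoc)
  then show ?thesis by (simp add: mpd_commute[OF P(1), of k i])
qed

lemma rform_structure:
  assumes "munit P"
  shows "mpd k (rform P i) u - mpd i (rform P k) u
    = rform P k u ** rform P i u - rform P i u ** rform P k u"
proof -
  note P = munitD[OF assms]
  have "mpd k (rform P i) u = mpd k (mpd i (fst P)) u ** snd P u - rform P i u ** rform P k u" for k i
    unfolding rform_def
    by (simp add: mpd_mult msep_mpd P mpd_inverse[OF assms] matrix_distribs matrix_mul_assoc)
  then show ?thesis by (simp add: mpd_commute[OF P(1), of k i])
qed

text \<open>
  The coefficients of \<open>(1/3) tr a\<^sup>3\<close>, antisymmetrised by means of the cyclic invariance of the trace.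
\<close>

definition cartan3 :: "(nat \<Rightarrow> complex^'n^'n) \<Rightarrow> nat \<Rightarrow> nat \<Rightarrow> nat \<Rightarrow> complex" where
  "cartan3 a i j k = trace (a i ** a j ** a k) - trace (a i ** a k ** a j)"

lemma trace_rotate: "trace (A ** B ** C) = trace (B ** C ** (A :: complex^'n^'n))"
  by (metis matrix_mul_assoc trace_mul_sym)

lemma cartan3_conj:
  fixes Q :: "complex^'n^'n"
  assumes "Q ** Q' = mat 1"
  shows "cartan3 (\<lambda>i. Q' ** a i ** Q) i j k = cartan3 a i j k"
proof -
  have "trace ((Q' ** X ** Q) ** (Q' ** Y ** Q) ** (Q' ** Z ** Q)) = trace (X ** Y ** Z)" for X Y Z
  proof -
    have "(Q' ** X ** Q) ** (Q' ** Y ** Q) ** (Q' ** Z ** Q) =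
        Q' ** (X ** (Q ** Q') ** Y ** (Q ** Q') ** Z) ** Q"
      by (simp only: matrix_mul_assoc)
    also have "\<dots> = Q' ** (X ** Y ** Z) ** Q" by (simp add: assms)
    also have "trace \<dots> = trace ((X ** Y ** Z) ** Q ** Q')" by (rule trace_rotate)
    also have "\<dots> = trace ((X ** Y ** Z) ** (Q ** Q'))" by (simp only: matrix_mul_assoc)
    finally show ?thesis by (simp add: assms)
  qed
  then show ?thesis by (simp add: cartan3_def)
qed

definition pw_form :: "(nat \<Rightarrow> 'n mfun) \<Rightarrow> (nat \<Rightarrow> 'n::finite mfun) \<Rightarrow> nat \<Rightarrow> nat \<Rightarrow> (nat \<Rightarrow> complex) \<Rightarrow> complex" where
  "pw_form a b i j u = trace (a i u ** b j u) - trace (a j u ** b i u)"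

definition pair_prod :: "'n::finite mfun \<times> 'n mfun \<Rightarrow> 'n mfun \<times> 'n mfun \<Rightarrow> 'n mfun \<times> 'n mfun" where
  "pair_prod P Q = (\<lambda>u. fst P u ** fst Q u, \<lambda>u. snd Q u ** snd P u)"

lemma munit_pair_prod: "munit P \<Longrightarrow> munit Q \<Longrightarrow> munit (pair_prod P Q)"
proof -
  assume P: "munit P" and Q: "munit Q"
  have 1: "fst P u ** fst Q u ** (snd Q u ** snd P u) = fst P u ** (fst Q u ** snd Q u) ** snd P u"
    "snd Q u ** snd P u ** (fst P u ** fst Q u) = snd Q u ** (snd P u ** fst P u) ** fst Q u" for u
    by (simp_all only: matrix_mul_assoc)
  show ?thesis
    unfolding munit_def pair_prod_def fst_conv snd_conv 1
    by (intro conjI msep_mult allI munitD(1,2) P Q) (simp_all add: munitD[OF P] munitD[OF Q])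
qed

lemma lform_pair_prod:
  assumes P: "munit P" and Q: "munit Q"
  shows "lform (pair_prod P Q) i u = snd Q u ** (lform P i u + rform Q i u) ** fst Q u"
proof -
  have "rform Q i u ** fst Q u = mpd i (fst Q) u ** (snd Q u ** fst Q u)"
    by (simp only: rform_def matrix_mul_assoc)
  then have 1: "rform Q i u ** fst Q u = mpd i (fst Q) u" by (simp add: munitD[OF Q])
  have "lform (pair_prod P Q) i u = snd Q u ** lform P i u ** fst Q u
      + snd Q u ** (snd P u ** fst P u) ** mpd i (fst Q) u"
    by (simp add: lform_def pair_prod_def mpd_mult munitD(1,2)[OF P] munitD(1,2)[OF Q] matrix_distribs matrix_mul_assoc)
  also have "\<dots> = snd Q u ** lform P i u ** fst Q u + snd Q u ** (rform Q i u ** fst Q u)"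
    by (simp add: munitD[OF P] 1)
  finally show ?thesis by (simp add: matrix_distribs matrix_mul_assoc)
qed

lemma cartan3_pair_prod:
  assumes P: "munit P" and Q: "munit Q"
  shows "cartan3 (\<lambda>i. lform (pair_prod P Q) i u) i j k = cartan3 (\<lambda>i. lform P i u + rform Q i u) i j k"
  unfolding lform_pair_prod[OF P Q] by (rule cartan3_conj) (simp add: munitD[OF Q])

lemma cartan3_rform:
  assumes Q: "munit Q"
  shows "cartan3 (\<lambda>i. rform Q i u) i j k = cartan3 (\<lambda>i. lform Q i u) i j k"
proof -
  have "lform Q i u = snd Q u ** rform Q i u ** fst Q u" for i
  proof -
    have "snd Q u ** rform Q i u ** fst Q u = snd Q u ** mpd i (fst Q) u ** (snd Q u ** fst Q u)"
      by (simp only: rform_def matrix_mul_assoc)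
    then show ?thesis by (simp add: munitD[OF Q] lform_def)
  qed
  then show ?thesis by (simp add: cartan3_conj munitD[OF Q])
qed

lemma cartan3_add:
  "cartan3 (\<lambda>i. a i + b i) i j k = cartan3 a i j k + cartan3 b i j k
    + trace (a i ** a j ** b k) - trace (a j ** a i ** b k)
    + trace (a j ** a k ** b i) - trace (a k ** a j ** b i)
    + trace (a k ** a i ** b j) - trace (a i ** a k ** b j)
    + trace (a i ** b j ** b k) - trace (a i ** b k ** b j)
    + trace (a j ** b k ** b i) - trace (a j ** b i ** b k)
    + trace (a k ** b i ** b j) - trace (a k ** b j ** b i)"
proof -
  have r: "trace (b p ** a q ** a r) = trace (a q ** a r ** b p)"
    "trace (a q ** b p ** a r) = trace (a r ** a q ** b p)"
    "trace (b p ** b q ** a r) = trace (a r ** b p ** b q)"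
    "trace (b p ** a q ** b r) = trace (a q ** b r ** b p)" for p q r
    by (metis trace_rotate)+
  show ?thesis
    by (simp add: cartan3_def matrix_distribs trace_add r)
qed

text \<open>
  The Polyakov-Wiegmann identity. Since \<open>(PQ)\<^sup>-\<^sup>1 d(PQ)\<close> is conjugate to \<open>a + b\<close> with \<open>a = P\<^sup>-\<^sup>1 dP\<close> and
  \<open>b = dQ Q\<^sup>-\<^sup>1\<close>, its Cartan form is \<open>(1/3) tr (a + b)\<^sup>3\<close>. The mixed terms of this cube are the exterior
  derivative of \<open>tr (a \<and> b)\<close> by the Maurer-Cartan equations, up to sign.
\<close>

lemma pw_form_closed_up_to_cartan3:
  assumes P: "munit P" and Q: "munit Q"
  defines "w \<equiv> pw_form (lform P) (rform Q)"
  shows "pd i (w j k) u + pd j (w k i) u + pd k (w i j) u =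
    cartan3 (\<lambda>i. lform P i u) i j k + cartan3 (\<lambda>i. lform Q i u) i j k
    - cartan3 (\<lambda>i. lform (pair_prod P Q) i u) i j k"
proof -
  note mP = msep_lform[OF P] and mQ = msep_rform[OF Q]
  have pdw: "pd k (w i j) u = trace (mpd k (lform P i) u ** rform Q j u) + trace (lform P i u ** mpd k (rform Q j) u)
     - trace (mpd k (lform P j) u ** rform Q i u) - trace (lform P j u ** mpd k (rform Q i) u)" for i j k
    unfolding w_def pw_form_def
    by (simp add: pd_diff pd_trace msep_trace msep_mult mP mQ mpd_mult trace_add)
  have A: "trace (mpd k (lform P i) u ** X) - trace (mpd i (lform P k) u ** X)
      = trace (lform P i u ** lform P k u ** X) - trace (lform P k u ** lform P i u ** X)" for i k X
    using arg_cong[OF lform_structure[OF P, of k i u], of "\<lambda>M. trace (M ** X)"]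
    by (simp add: matrix_distribs trace_sub)
  have B: "trace (X ** mpd k (rform Q i) u) - trace (X ** mpd i (rform Q k) u)
      = trace (X ** rform Q k u ** rform Q i u) - trace (X ** rform Q i u ** rform Q k u)" for i k X
    using arg_cong[OF rform_structure[OF Q, of k i u], of "\<lambda>M. trace (X ** M)"]
    by (simp add: matrix_distribs trace_sub matrix_mul_assoc)
  have "pd i (w j k) u + pd j (w k i) u + pd k (w i j) u =
     (trace (mpd k (lform P i) u ** rform Q j u) - trace (mpd i (lform P k) u ** rform Q j u))
   + (trace (mpd i (lform P j) u ** rform Q k u) - trace (mpd j (lform P i) u ** rform Q k u))
   + (trace (mpd j (lform P k) u ** rform Q i u) - trace (mpd k (lform P j) u ** rform Q i u))
   + (trace (lform P i u ** mpd k (rform Q j) u) - trace (lform P i u ** mpd j (rform Q k) u))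
   + (trace (lform P j u ** mpd i (rform Q k) u) - trace (lform P j u ** mpd k (rform Q i) u))
   + (trace (lform P k u ** mpd j (rform Q i) u) - trace (lform P k u ** mpd i (rform Q j) u))"
    unfolding pdw by simp
  then show ?thesis
    unfolding A B cartan3_pair_prod[OF P Q] cartan3_add cartan3_rform[OF Q] by simp
qed

type_synonym 'n word = "('n mfun \<times> 'n mfun) list"

primrec word_prod :: "'n::finite word \<Rightarrow> 'n mfun \<times> 'n mfun" where
  "word_prod [] = (\<lambda>_. mat 1, \<lambda>_. mat 1)"
| "word_prod (p # ws) = pair_prod p (word_prod ws)"

primrec word_form :: "'n::finite word \<Rightarrow> nat \<Rightarrow> nat \<Rightarrow> (nat \<Rightarrow> complex) \<Rightarrow> complex" where
  "word_form [] i j = (\<lambda>u. 0)"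
| "word_form (p # ws) i j = (\<lambda>u. pw_form (lform p) (rform (word_prod ws)) i j u + word_form ws i j u)"

text \<open>
  The letters whose Cartan 3-form vanishes identically, not merely up to an exact form.
\<close>

definition flat :: "'n::finite mfun \<times> 'n mfun \<Rightarrow> bool" where
  "flat p \<longleftrightarrow> munit p \<and> (\<forall>u i j k. cartan3 (\<lambda>i. lform p i u) i j k = 0)"

lemma flat_munit: "flat p \<Longrightarrow> munit p" by (simp add: flat_def)

lemma munit_word_prod: "\<forall>p\<in>set ws. munit p \<Longrightarrow> munit (word_prod ws)"
  by (induction ws) (auto simp: munit_pair_prod, simp add: munit_def)

lemma sep_hol_pw_form:
  assumes "munit P" "munit Q" shows "sep_hol (pw_form (lform P) (rform Q) i j)"
  unfolding pw_form_def by (intro sep_hol_diff msep_trace msep_mult msep_lform msep_rform assms)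

lemma sep_hol_word_form: "\<forall>p\<in>set ws. munit p \<Longrightarrow> sep_hol (word_form ws i j)"
  by (induction ws) (auto intro!: sep_hol_add sep_hol_pw_form munit_word_prod)

lemma word_form_closed_up_to_cartan3:
  assumes "\<forall>p\<in>set ws. flat p"
  shows "pd i (word_form ws j k) u + pd j (word_form ws k i) u + pd k (word_form ws i j) u =
    - cartan3 (\<lambda>i. lform (word_prod ws) i u) i j k"
  using assms
proof (induction ws)
  case Nil
  then show ?case by (simp add: cartan3_def lform_def trace_def matrix_matrix_mult_def)
next
  case (Cons p ws)
  then have "munit p" "\<forall>p\<in>set ws. munit p" by (auto intro: flat_munit)
  then have m: "munit p" "munit (word_prod ws)" "\<forall>p\<in>set ws. munit p"
    by (simp_all add: munit_word_prod)
  have "pd i (word_form (p # ws) j k) u = pd i (pw_form (lform p) (rform (word_prod ws)) j k) u + pd i (word_form ws j k) u" for i j k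
    by (simp add: pd_add sep_hol_pw_form m sep_hol_word_form)
  then have "pd i (word_form (p # ws) j k) u + pd j (word_form (p # ws) k i) u + pd k (word_form (p # ws) i j) u =
      (pd i (pw_form (lform p) (rform (word_prod ws)) j k) u + pd j (pw_form (lform p) (rform (word_prod ws)) k i) u
        + pd k (pw_form (lform p) (rform (word_prod ws)) i j) u)
      + (pd i (word_form ws j k) u + pd j (word_form ws k i) u + pd k (word_form ws i j) u)"
    by (simp only: ac_simps)
  also have "pd i (word_form ws j k) u + pd j (word_form ws k i) u + pd k (word_form ws i j) u =
      - cartan3 (\<lambda>i. lform (word_prod ws) i u) i j k"
    using Cons by simp
  also have "cartan3 (\<lambda>i. lform p i u) i j k = 0"
    using Cons.prems by (simp add: flat_def)
  ultimately show ?case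
    unfolding pw_form_closed_up_to_cartan3[OF m(1,2)] by simp
qed

lemma word_form_antisym: "word_form ws j i u = - word_form ws i j u"
  by (induction ws) (simp_all add: pw_form_def)

lemma word_form_eq_sum:
  "word_form ws i j u = (\<Sum>l<length ws. pw_form (lform (ws ! l)) (rform (word_prod (drop (Suc l) ws))) i j u)"
  by (induction ws) (simp_all add: sum.lessThan_Suc_shift del: sum.lessThan_Suc)

text \<open>
  Each letter contributes one trace \<open>tr (a \<and> b)\<close>, which is a sum of \<open>n\<^sup>2\<close> products of entries. The number
  of summands does not depend on the number of variables.
\<close>

lemma word_form_low_rank:
  fixes ws :: "'n::finite word"
  obtains f g :: "nat \<times> 'n \<times> 'n \<Rightarrow> nat \<Rightarrow> complex"
  where "\<And>i j. word_form ws i j u = (\<Sum>s\<in>{..<length ws} \<times> UNIV. f s i * g s j - f s j * g s i)"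
proof
  fix i j
  show "word_form ws i j u = (\<Sum>s\<in>{..<length ws} \<times> UNIV.
      (\<lambda>(l, a, b) i. lform (ws ! l) i u $ a $ b) s i *
      (\<lambda>(l, a, b) j. rform (word_prod (drop (Suc l) ws)) j u $ b $ a) s j -
      (\<lambda>(l, a, b) i. lform (ws ! l) i u $ a $ b) s j *
      (\<lambda>(l, a, b) j. rform (word_prod (drop (Suc l) ws)) j u $ b $ a) s i)"
    unfolding word_form_eq_sum pw_form_def trace_def matrix_matrix_mult_def
    by (simp add: sum.cartesian_product' UNIV_Times_UNIV[symmetric] sum_subtractf del: UNIV_Times_UNIV)
qed

lemma word_prod_append: "word_prod (ws @ vs) = pair_prod (word_prod ws) (word_prod vs)"
  by (induction ws) (simp_all add: pair_prod_def matrix_mul_assoc)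

text \<open>
  Splitting a word produces one cross term, which involves the derivative of the product of the second
  part. It disappears in directions along which that product is stationary.
\<close>

lemma word_form_append:
  assumes "\<forall>p\<in>set ws. munit p" "\<forall>p\<in>set vs. munit p"
    and "mpd i (fst (word_prod vs)) u = 0" "mpd j (fst (word_prod vs)) u = 0"
  shows "word_form (ws @ vs) i j u = word_form ws i j u + word_form vs i j u"
  using assms(1)
proof (induction ws)
  case (Cons p ws)
  have m: "munit (word_prod ws)" "munit (word_prod vs)" using Cons assms by (auto intro!: munit_word_prod)
  have "rform (word_prod (ws @ vs)) i u = rform (word_prod ws) i u" if "mpd i (fst (word_prod vs)) u = 0" for i
  proof -
    have "rform (word_prod (ws @ vs)) i u =
      mpd i (fst (word_prod ws)) u ** (fst (word_prod vs) u ** snd (word_prod vs) u) ** snd (word_prod ws) u"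
      unfolding word_prod_append rform_def pair_prod_def
      by (simp add: mpd_mult munitD(1)[OF m(1)] munitD(1)[OF m(2)] that matrix_mul_assoc)
    then show ?thesis by (simp add: munitD[OF m(2)] rform_def)
  qed
  then show ?case using Cons assms by (simp add: pw_form_def)
qed simp

text \<open>
  Differentiating \<open>B\<^sup>2 = 1\<close> shows that \<open>B\<close> anticommutes with its derivatives. Moving \<open>B\<close> around the
  trace of three derivatives and itself changes the sign three times, so the trace is zero.
\<close>

lemma flat_involution:
  assumes m: "msep B" and B: "\<And>u. B u ** B u = mat 1"
  shows "flat (B, B)"
proof -
  have mu: "munit (B, B)" using assms by (simp add: munit_def)
  have "trace (lform (B, B) i u ** lform (B, B) j u ** lform (B, B) k u) = 0" for i j k u
  proof -
    have anti: "B u ** mpd i B u = - (mpd i B u ** B u)" for i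
    proof -
      have "mpd i (\<lambda>u. B u ** B u) u = 0" by (simp add: B)
      then show ?thesis by (simp add: mpd_mult m eq_neg_iff_add_eq_0 add.commute)
    qed
    let ?i = "mpd i B u" and ?j = "mpd j B u" and ?k = "mpd k B u" and ?B = "B u"
    have comm: "?B ** (?i ** ?j) = ?i ** ?j ** ?B"
    proof -
      have "?B ** (?i ** ?j) = (?B ** ?i) ** ?j" by (simp only: matrix_mul_assoc)
      also have "\<dots> = - (?i ** (?B ** ?j))" by (simp add: anti[of i] matrix_minus_left matrix_mul_assoc)
      also have "\<dots> = ?i ** ?j ** ?B" by (simp add: anti[of j] matrix_minus_right matrix_mul_assoc)
      finally show ?thesis .
    qed
    have "trace (?B ** (?i ** ?j) ** ?k) = trace (?i ** ?j ** (?B ** ?k))"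
      unfolding comm by (simp only: matrix_mul_assoc)
    also have "\<dots> = - trace (?i ** ?j ** ?k ** ?B)"
      by (simp add: anti[of k] matrix_minus_right trace_minus matrix_mul_assoc)
    also have "trace (?i ** ?j ** ?k ** ?B) = trace (?B ** (?i ** ?j ** ?k))" by (rule trace_mul_sym)
    also have "?B ** (?i ** ?j ** ?k) = ?B ** (?i ** ?j) ** ?k" by (simp only: matrix_mul_assoc)
    finally have z: "trace (?B ** (?i ** ?j) ** ?k) = 0" by simp
    have "lform (B, B) i u ** lform (B, B) j u ** lform (B, B) k u
        = (?B ** ?i) ** ?B ** ?j ** (?B ** ?k)"
      by (simp only: lform_def fst_conv snd_conv matrix_mul_assoc)
    also have "\<dots> = - (?i ** (?B ** ?B) ** ?j ** (?B ** ?k))"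
      by (simp only: anti[of i] matrix_minus_left matrix_mul_assoc)
    also have "\<dots> = - (?i ** ?j ** (?B ** ?k))"
      by (simp add: B)
    also have "\<dots> = - (?B ** (?i ** ?j) ** ?k)" unfolding comm by (simp only: matrix_mul_assoc)
    finally show ?thesis by (simp add: trace_minus z)
  qed
  then show ?thesis using mu by (simp add: flat_def cartan3_def)
qed

section \<open>The pentagon frieze\<close>

text \<open>
  A 2 by 2 matrix placed in the rows and columns \<open>r\<close> and \<open>s\<close>, with \<open>e\<close> on the rest of the diagonal. The
  value \<open>e = 1\<close> gives group elements and \<open>e = 0\<close> their derivatives.
\<close>

definition embed2 :: "complex \<Rightarrow> 'n \<Rightarrow> 'n \<Rightarrow> complex \<Rightarrow> complex \<Rightarrow> complex \<Rightarrow> complex \<Rightarrow> complex^'n^'n" where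
  "embed2 e r s p q x y = (\<chi> a b. if a = r \<and> b = r then p else if a = r \<and> b = s then q
     else if a = s \<and> b = r then x else if a = s \<and> b = s then y else if a = b then e else 0)"

lemma embed2_mult:
  fixes r s :: "'n::finite"
  assumes "r \<noteq> s"
  shows "embed2 e r s p q x y ** embed2 e' r s p' q' x' y' =
    embed2 (e*e') r s (p*p'+q*x') (p*q'+q*y') (x*p'+y*x') (x*q'+y*y')"
proof -
  have row: "(\<Sum>k\<in>UNIV. embed2 e r s p q x y $ a $ k * B k) =
      (if a = r then p * B r + q * B s else if a = s then x * B r + y * B s else e * B a)" for a B
  proof -
    have "(\<Sum>k\<in>UNIV. embed2 e r s p q x y $ a $ k * B k) = (\<Sum>k\<in>UNIV.
      (if k = r then (if a = r then p * B r else if a = s then x * B r else 0) else 0) +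
      (if k = s then (if a = r then q * B s else if a = s then y * B s else 0) else 0) +
      (if k = a then (if a = r \<or> a = s then 0 else e * B a) else 0))"
      using assms by (intro sum.cong) (auto simp: embed2_def)
    then show ?thesis by (simp add: sum.distrib)
  qed
  show ?thesis
    unfolding matrix_matrix_mult_def row vec_eq_iff using assms by (intro allI) (simp add: embed2_def)
qed

lemma embed2_one:
  fixes r s :: "'n::finite"
  shows "r \<noteq> s \<Longrightarrow> embed2 1 r s 1 0 0 1 = mat 1"
proof -
  assume "r \<noteq> s"
  then have "embed2 1 r s 1 0 0 1 $ a $ b = (mat 1 :: complex^'n^'n) $ a $ b" for a b
    by (cases "a = r"; cases "a = s"; cases "b = r"; cases "b = s") (simp_all add: embed2_def mat_def)
  then show ?thesis by (simp add: vec_eq_iff)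
qed

lemma trace_emb0:
  fixes r s :: "'n::finite"
  assumes "r \<noteq> s" shows "trace (embed2 0 r s p q x y) = p + y"
proof -
  have "trace (embed2 0 r s p q x y) = (\<Sum>a\<in>UNIV. (if a = r then p else 0) + (if a = s then y else 0))"
    unfolding trace_def using assms by (intro sum.cong) (auto simp: embed2_def)
  then show ?thesis by (simp add: sum.distrib)
qed

text \<open>
  Only the identity and the transposition of \<open>r\<close> and \<open>s\<close> contribute to the Leibniz expansion.
\<close>

lemma det_embed2:
  fixes r s :: "'n::finite"
  assumes "r \<noteq> s"
  shows "det (embed2 1 r s p q x y) = p * y - q * x"
proof -
  let ?A = "embed2 1 r s p q x y"
  let ?t = "Transposition.transpose r s"
  let ?f = "\<lambda>\<sigma>. of_int (sign \<sigma>) * (\<Prod>i\<in>UNIV. ?A $ i $ \<sigma> i)"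
  have split: "(\<Prod>i\<in>UNIV. ?A $ i $ \<sigma> i) = ?A $ r $ \<sigma> r * ?A $ s $ \<sigma> s"
    if "\<And>i. i \<noteq> r \<Longrightarrow> i \<noteq> s \<Longrightarrow> \<sigma> i = i" for \<sigma>
  proof -
    have "(\<Prod>i\<in>UNIV. ?A $ i $ \<sigma> i) = (\<Prod>i\<in>{r, s}. ?A $ i $ \<sigma> i)"
      using that by (intro prod.mono_neutral_right) (auto simp: embed2_def)
    then show ?thesis using assms by simp
  qed
  have "id \<noteq> ?t" using assms by (metis id_apply transpose_apply_first)
  have "det ?A = (\<Sum>\<sigma>\<in>{\<sigma>. \<sigma> permutes UNIV}. ?f \<sigma>)" by (simp add: det_def)
  also have "\<dots> = (\<Sum>\<sigma>\<in>{id, ?t}. ?f \<sigma>)"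
  proof (rule sum.mono_neutral_right)
    show "{id, ?t} \<subseteq> {\<sigma>. \<sigma> permutes UNIV}"
      by (auto intro: permutes_id permutes_swap_id)
    show "\<forall>\<sigma>\<in>{\<sigma>. \<sigma> permutes UNIV} - {id, ?t}. ?f \<sigma> = 0"
    proof
      fix \<sigma> assume \<sigma>: "\<sigma> \<in> {\<sigma>. \<sigma> permutes UNIV} - {id, ?t}"
      then have inj: "\<sigma> i = \<sigma> j \<longleftrightarrow> i = j" for i j using permutes_inj by (auto dest: injD)
      show "?f \<sigma> = 0"
      proof (cases "\<forall>i. i \<noteq> r \<longrightarrow> i \<noteq> s \<longrightarrow> \<sigma> i = i")
        case True
        then have "\<sigma> r \<in> {r, s}" "\<sigma> s \<in> {r, s}" using inj assms by (metis insertCI)+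
        have "\<sigma> = id \<or> \<sigma> = ?t"
        proof (cases "\<sigma> r = r")
          case rr: True
          with \<open>\<sigma> s \<in> {r, s}\<close> inj assms have "\<sigma> s = s" by (metis insertE singletonD)
          with rr True have "\<sigma> i = i" for i by (cases "i = r"; cases "i = s") auto
          then show ?thesis by auto
        next
          case False
          with \<open>\<sigma> r \<in> {r, s}\<close> have "\<sigma> r = s" by simp
          with \<open>\<sigma> s \<in> {r, s}\<close> inj assms have "\<sigma> s = r" by (metis insertE singletonD)
          with \<open>\<sigma> r = s\<close> True have "\<sigma> i = ?t i" for i
            by (cases "i = r"; cases "i = s") (auto simp: Transposition.transpose_def)
          then show ?thesis by auto
        qed
        with \<sigma> show ?thesis by auto
      next
        case False
        then obtain i where "i \<noteq> r" "i \<noteq> s" "\<sigma> i \<noteq> i" by auto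
        then have "?A $ i $ \<sigma> i = 0" by (simp add: embed2_def)
        then have "(\<Prod>i\<in>UNIV. ?A $ i $ \<sigma> i) = 0" by (intro prod_zero) auto
        then show ?thesis by simp
      qed
    qed
  qed (simp add: finite_permutations)
  also have "\<dots> = ?A $ r $ r * ?A $ s $ s - ?A $ r $ s * ?A $ s $ r"
    using assms \<open>id \<noteq> ?t\<close> split[of id] split[of ?t]
    by (simp add: sign_swap_id)
  also have "\<dots> = p * y - q * x"
    using assms by (auto simp: embed2_def)
  finally show ?thesis .
qed

lemma embed2_entry:
  "(\<lambda>u. embed2 e r s (p u) (q u) (x u) (y u) $ a $ b) =
    (if a = r \<and> b = r then p else if a = r \<and> b = s then q
     else if a = s \<and> b = r then x else if a = s \<and> b = s then y
     else (\<lambda>_. if a = b then e else 0))"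
  by (cases "a = r"; cases "a = s"; cases "b = r"; cases "b = s") (simp_all add: embed2_def)

lemma msep_embed2:
  assumes "sep_hol p" "sep_hol q" "sep_hol x" "sep_hol y"
  shows "msep (\<lambda>u. embed2 e r s (p u) (q u) (x u) (y u))"
  unfolding msep_def embed2_entry using assms by simp

lemma mpd_embed2:
  "mpd i (\<lambda>u. embed2 e r s (p u) (q u) (x u) (y u)) u = embed2 0 r s (pd i p u) (pd i q u) (pd i x u) (pd i y u)"
proof -
  have "mpd i (\<lambda>u. embed2 e r s (p u) (q u) (x u) (y u)) u $ a $ b =
      embed2 0 r s (pd i p u) (pd i q u) (pd i x u) (pd i y u) $ a $ b" for a b
    unfolding mpd_def embed2_entry
    by (cases "a = r"; cases "a = s"; cases "b = r"; cases "b = s") (simp_all add: embed2_def)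
  then show ?thesis by (simp add: vec_eq_iff)
qed

text \<open>
  The second component is the adjugate, hence the inverse when the determinant is 1.
\<close>

definition upair :: "'n::finite \<Rightarrow> 'n \<Rightarrow> ((nat \<Rightarrow> complex) \<Rightarrow> complex) \<Rightarrow> ((nat \<Rightarrow> complex) \<Rightarrow> complex) \<Rightarrow>
    ((nat \<Rightarrow> complex) \<Rightarrow> complex) \<Rightarrow> ((nat \<Rightarrow> complex) \<Rightarrow> complex) \<Rightarrow> 'n mfun \<times> 'n mfun" where
  "upair r s p q x y = (\<lambda>u. embed2 1 r s (p u) (q u) (x u) (y u),
     \<lambda>u. embed2 1 r s (y u) (- q u) (- x u) (p u))"

text \<open>
  The letter \<open>M(a)\<close>. Products of such letters have continuants as entries.
\<close>

definition cont_mat :: "'n::finite \<Rightarrow> 'n \<Rightarrow> complex \<Rightarrow> complex^'n^'n" where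
  "cont_mat r s a = embed2 1 r s a (-1) 1 0"

definition cpair :: "'n::finite \<Rightarrow> 'n \<Rightarrow> ((nat \<Rightarrow> complex) \<Rightarrow> complex) \<Rightarrow> 'n mfun \<times> 'n mfun" where
  "cpair r s f = upair r s f (\<lambda>_. -1) (\<lambda>_. 1) (\<lambda>_. 0)"

lemma fst_cpair: "fst (cpair r s f) u = cont_mat r s (f u)"
  by (simp add: cpair_def upair_def cont_mat_def)

lemma lform_cpair:
  assumes "r \<noteq> s"
  shows "lform (cpair r s f) i u = embed2 0 r s 0 0 (- pd i f u) 0"
  by (simp add: cpair_def upair_def lform_def mpd_embed2 embed2_mult assms)

lemma flat_cpair:
  assumes "r \<noteq> s" "sep_hol f"
  shows "flat (cpair r s f)"
  unfolding flat_def
proof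
  show "munit (cpair r s f)"
    using assms by (simp add: munit_def cpair_def upair_def msep_embed2 embed2_mult embed2_one sep_hol_minus)
  show "\<forall>u i j k. cartan3 (\<lambda>i. lform (cpair r s f) i u) i j k = 0"
    using assms by (simp add: lform_cpair cartan3_def embed2_mult)
qed

lemma pair_prod_cpair_upair:
  assumes "r \<noteq> s"
  shows "pair_prod (cpair r s f) (upair r s p q x y) =
    upair r s (\<lambda>u. f u * p u - x u) (\<lambda>u. f u * q u - y u) p q"
  using assms by (simp add: pair_prod_def cpair_def upair_def embed2_mult fun_eq_iff algebra_simps)

lemma word_prod_Nil_upair: "r \<noteq> s \<Longrightarrow> word_prod [] = upair r s (\<lambda>_. 1) (\<lambda>_. 0) (\<lambda>_. 0) (\<lambda>_. 1)"
  by (simp add: upair_def embed2_one)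

lemma pw_form_cpair_upair:
  assumes "r \<noteq> s"
  shows "pw_form (lform (cpair r s f)) (rform (upair r s p q x y)) i j u =
     - pd i f u * (p u * pd j q u - q u * pd j p u) + pd j f u * (p u * pd i q u - q u * pd i p u)"
  unfolding pw_form_def lform_cpair[OF assms] rform_def upair_def fst_conv snd_conv mpd_embed2
  by (simp add: embed2_mult trace_emb0 assms algebra_simps)

text \<open>
  With \<open>x = exp v\<close> and \<open>y = exp w\<close> the five entries are \<open>y, (1 + x + y)/(x y), x, (1 + y)/x, (1 + x)/y\<close>. Up
  to order this is the 5-periodic sequence with \<open>f\<^bsub>i-1\<^esub> f\<^bsub>i+1\<^esub> = 1 + f\<^sub>i\<close>, read with step 2. All denominators
  are monomials, so the entries are entire in \<open>v\<close> and \<open>w\<close>.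
\<close>

definition frieze :: "nat \<Rightarrow> complex \<Rightarrow> complex \<Rightarrow> complex" where
  "frieze q v w =
    (if q = 0 then exp w
     else if q = 1 then exp (- v) * exp (- w) + exp (- w) + exp (- v)
     else if q = 2 then exp v
     else if q = 3 then exp (- v) * (1 + exp w)
     else exp (- w) * (1 + exp v))"

text \<open>
  The point of the contracted torus: block \<open>l div 5\<close> uses its own pair of logarithmic coordinates, and the
  coordinate with index \<open>m\<close> scales the whole point.
\<close>

definition frieze_par :: "nat \<Rightarrow> nat \<Rightarrow> (nat \<Rightarrow> complex) \<Rightarrow> complex" where
  "frieze_par m l u = u m * frieze (l mod 5) (u (2 * (l div 5))) (u (2 * (l div 5) + 1))"

lemma sep_hol_frieze_par: "sep_hol (frieze_par m l)"
  unfolding frieze_par_def frieze_def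
  by (cases "l mod 5 = 0"; cases "l mod 5 = 1"; cases "l mod 5 = 2"; cases "l mod 5 = 3")
    (auto intro!: sep_hol_mult sep_hol_add sep_hol_exp sep_hol_minus)

definition block_par :: "nat \<Rightarrow> nat \<Rightarrow> nat \<Rightarrow> (nat \<Rightarrow> complex) \<Rightarrow> complex" where
  "block_par m b q = frieze_par m (5 * b + q)"

lemma sep_hol_block_par: "sep_hol (block_par m b q)"
  by (simp add: block_par_def sep_hol_frieze_par)

lemma frieze_par_block:
  "q < 5 \<Longrightarrow> block_par m b q u = u m * frieze q (u (2*b)) (u (2*b+1))"
  by (simp add: block_par_def frieze_par_def)

context
  fixes r s :: "'n::finite" and m b :: nat
begin

abbreviation (input) "pr q \<equiv> block_par m b q"

definition block :: "'n word" where
  "block = map (\<lambda>q. cpair r s (pr q)) [0..<5]"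

text \<open>
  The products of the last letters of a block, from one letter up to all five. Their first rows
  determine the 2-form of the block, and their second rows are the first rows of the shorter tails.
\<close>

definition "tail4 = upair r s (pr 4) (\<lambda>_. -1) (\<lambda>_. 1) (\<lambda>_. 0)"
definition "tail3 = upair r s (\<lambda>u. pr 3 u * pr 4 u - 1) (\<lambda>u. - pr 3 u) (pr 4) (\<lambda>_. -1)"
definition "row_p2 = (\<lambda>u. pr 2 u * (pr 3 u * pr 4 u - 1) - pr 4 u)"
definition "row_q2 = (\<lambda>u. 1 - pr 2 u * pr 3 u)"
definition "tail2 = upair r s row_p2 row_q2 (\<lambda>u. pr 3 u * pr 4 u - 1) (\<lambda>u. - pr 3 u)"
definition "row_p1 = (\<lambda>u. pr 1 u * row_p2 u - (pr 3 u * pr 4 u - 1))"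
definition "row_q1 = (\<lambda>u. pr 1 u * row_q2 u + pr 3 u)"
definition "tail1 = upair r s row_p1 row_q1 row_p2 row_q2"
definition "tail0 = upair r s (\<lambda>u. pr 0 u * row_p1 u - row_p2 u) (\<lambda>u. pr 0 u * row_q1 u - row_q2 u) row_p1 row_q1"

context
  assumes rs: "r \<noteq> s"
begin

lemma block_eq: "block = [cpair r s (pr 0), cpair r s (pr 1), cpair r s (pr 2), cpair r s (pr 3), cpair r s (pr 4)]"
proof -
  have "[0..<5] = [0, 1, 2, 3, 4 :: nat]" by (simp add: upt_rec)
  then show ?thesis unfolding block_def by (simp only: list.map)
qed

lemma word_prod_tails:
  "word_prod [cpair r s (pr 4)] = tail4"
  "word_prod [cpair r s (pr 3), cpair r s (pr 4)] = tail3"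
  "word_prod [cpair r s (pr 2), cpair r s (pr 3), cpair r s (pr 4)] = tail2"
  "word_prod [cpair r s (pr 1), cpair r s (pr 2), cpair r s (pr 3), cpair r s (pr 4)] = tail1"
  "word_prod block = tail0"
proof -
  show 4: "word_prod [cpair r s (pr 4)] = tail4"
    using pair_prod_cpair_upair[OF rs] word_prod_Nil_upair[OF rs] by (simp add: tail4_def)
  show 3: "word_prod [cpair r s (pr 3), cpair r s (pr 4)] = tail3"
    using 4 pair_prod_cpair_upair[OF rs] by (simp add: tail4_def tail3_def)
  show 2: "word_prod [cpair r s (pr 2), cpair r s (pr 3), cpair r s (pr 4)] = tail2"
    using 3 pair_prod_cpair_upair[OF rs] by (simp add: tail3_def tail2_def row_p2_def row_q2_def algebra_simps)
  show 1: "word_prod [cpair r s (pr 1), cpair r s (pr 2), cpair r s (pr 3), cpair r s (pr 4)] = tail1"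
    using 2 pair_prod_cpair_upair[OF rs] by (simp add: tail2_def tail1_def row_p1_def row_q1_def)
  show "word_prod block = tail0"
    using 1 pair_prod_cpair_upair[OF rs] by (simp add: block_eq tail1_def tail0_def)
qed

text \<open>
  The frieze relations. On the undeformed torus \<open>u m = 1\<close> they collapse the continuants of high degree, so
  that the block multiplies to \<open>-1\<close> on the two coordinates.
\<close>

lemma slice:
  assumes "u m = 1"
  shows "pr 3 u * pr 4 u - 1 = pr 1 u" "row_p2 u = 1" "row_q2 u = - pr 0 u" "row_p1 u = 0" "row_q1 u = -1"
proof -
  have X: "exp (u (2*b)) * exp (- u (2*b)) = 1" "exp (u (2*b+1)) * exp (- u (2*b+1)) = 1"
    by (simp_all add: exp_minus_inverse)
  show 34: "pr 3 u * pr 4 u - 1 = pr 1 u"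
    using X assms by (simp add: frieze_par_block frieze_def) algebra
  show row_p2: "row_p2 u = 1"
    unfolding row_p2_def 34 using X assms by (simp add: frieze_par_block frieze_def) algebra
  show row_q2: "row_q2 u = - pr 0 u"
    unfolding row_q2_def using X assms by (simp add: frieze_par_block frieze_def) algebra
  show "row_p1 u = 0" by (simp add: row_p1_def row_p2 34)
  show "row_q1 u = -1"
    unfolding row_q1_def row_q2 using X assms by (simp add: frieze_par_block frieze_def) algebra
qed

lemma word_prod_block_slice:
  assumes "i \<noteq> m" "u m = 1"
  shows "mpd i (fst (word_prod block)) u = 0"
proof -
  have "fst tail0 (u(i := z)) = embed2 1 r s (-1) 0 0 (-1)" for z
    using slice[of "u(i := z)"] assms by (simp add: tail0_def upair_def)
  then have "pd i (\<lambda>u. fst tail0 u $ a $ c) u = pd i (\<lambda>u. embed2 1 r s (-1) 0 0 (-1) $ a $ c) u" for a c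
    by (intro pd_cong_line) simp
  then show ?thesis by (simp add: word_prod_tails(5) mpd_def vec_eq_iff)
qed

lemma pd_slice:
  assumes "i \<noteq> m" "u m = 1"
  defines "e \<equiv> (if i = 2*b then 1 else 0 :: complex)" and "e' \<equiv> (if i = 2*b+1 then 1 else 0 :: complex)"
  defines "X \<equiv> exp (u (2*b))" and "Y \<equiv> exp (u (2*b+1))"
    and "X' \<equiv> exp (- u (2*b))" and "Y' \<equiv> exp (- u (2*b+1))"
  shows "pd i (pr 0) u = Y * e'"
    and "pd i (pr 1) u = - (X' * Y' + X') * e - (X' * Y' + Y') * e'"
    and "pd i (pr 2) u = X * e"
    and "pd i (pr 3) u = - X' * (1 + Y) * e + X' * Y * e'"
    and "pd i (pr 4) u = Y' * X * e - Y' * (1 + X) * e'"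
proof -
  have pr: "pr q = (\<lambda>u. u m * frieze q (u (2*b)) (u (2*b+1)))" if "q < 5" for q
    using frieze_par_block[OF that] by auto
  have five: "(0::nat) < 5" "(1::nat) < 5" "(2::nat) < 5" "(3::nat) < 5" "(4::nat) < 5" by simp_all
  note S = pd_mult pd_add pd_exp pd_minus pd_coord sep_hol_mult sep_hol_add sep_hol_exp sep_hol_minus
  show "pd i (pr 0) u = Y * e'"
    unfolding pr[OF five(1)] using assms by (simp add: frieze_def S)
  show "pd i (pr 1) u = - (X' * Y' + X') * e - (X' * Y' + Y') * e'"
    unfolding pr[OF five(2)] using assms by (simp add: frieze_def S algebra_simps)
  show "pd i (pr 2) u = X * e"
    unfolding pr[OF five(3)] using assms by (simp add: frieze_def S)
  show "pd i (pr 3) u = - X' * (1 + Y) * e + X' * Y * e'"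
    unfolding pr[OF five(4)] using assms by (simp add: frieze_def S algebra_simps)
  show "pd i (pr 4) u = Y' * X * e - Y' * (1 + X) * e'"
    unfolding pr[OF five(5)] using assms by (simp add: frieze_def S algebra_simps)
qed

text \<open>
  On the slice the tails have constant or linear first rows, which leaves
  \<open>da\<^sub>1 \<and> da\<^sub>0 + a\<^sub>1 da\<^sub>2 \<and> da\<^sub>3 - a\<^sub>3 da\<^sub>2 \<and> da\<^sub>1 - da\<^sub>3 \<and> da\<^sub>4\<close>; this equals
  \<open>2 dlog x \<and> dlog y\<close> on the frieze.
\<close>

lemma word_form_block:
  assumes "i \<noteq> m" "j \<noteq> m" "u m = 1"
  shows "word_form block i j u =
    2 * ((if i = 2*b then 1 else 0) * (if j = 2*b+1 then 1 else 0)
       - (if j = 2*b then 1 else 0) * (if i = 2*b+1 then 1 else 0))"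
proof -
  have line: "pd l f u = pd l g u" if "l \<noteq> m" "\<And>u. u m = 1 \<Longrightarrow> f u = g u" for l f g
    using that assms(3) by (intro pd_cong_line) auto
  have P: "pd l row_p1 u = 0" "pd l row_q1 u = 0" "pd l row_p2 u = 0" "pd l row_q2 u = - pd l (pr 0) u"
    "pd l (\<lambda>u. pr 3 u * pr 4 u - 1) u = pd l (pr 1) u" if "l \<noteq> m" for l
    using line[OF that, of row_p1 "\<lambda>_. 0"] line[OF that, of row_q1 "\<lambda>_. -1"] line[OF that, of row_p2 "\<lambda>_. 1"]
      line[OF that, of row_q2 "\<lambda>u. - pr 0 u"] line[OF that, of "\<lambda>u. pr 3 u * pr 4 u - 1" "pr 1"]
    by (simp_all add: slice pd_minus sep_hol_block_par)
  let ?d = "\<lambda>q l. pd l (pr q) u"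
  have "word_form block i j u =
      pw_form (lform (cpair r s (pr 0))) (rform tail1) i j u + (pw_form (lform (cpair r s (pr 1))) (rform tail2) i j u
      + (pw_form (lform (cpair r s (pr 2))) (rform tail3) i j u + (pw_form (lform (cpair r s (pr 3))) (rform tail4) i j u
      + pw_form (lform (cpair r s (pr 4))) (rform (word_prod [])) i j u)))"
    unfolding block_eq word_form.simps word_prod_tails by simp
  also have "pw_form (lform (cpair r s (pr 0))) (rform tail1) i j u = 0"
    unfolding tail1_def pw_form_cpair_upair[OF rs] by (simp add: P assms)
  also have "pw_form (lform (cpair r s (pr 1))) (rform tail2) i j u = ?d 1 i * ?d 0 j - ?d 1 j * ?d 0 i"
    unfolding tail2_def pw_form_cpair_upair[OF rs] by (simp add: P assms slice)
  also have "pw_form (lform (cpair r s (pr 2))) (rform tail3) i j u =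
      - ?d 2 i * (pr 3 u * ?d 1 j - pr 1 u * ?d 3 j) + ?d 2 j * (pr 3 u * ?d 1 i - pr 1 u * ?d 3 i)"
    unfolding tail3_def pw_form_cpair_upair[OF rs] P(5)[OF assms(1)] P(5)[OF assms(2)]
      slice(1)[of u, OF assms(3)] pd_minus[OF sep_hol_block_par]
    by (simp add: algebra_simps)
  also have "pw_form (lform (cpair r s (pr 3))) (rform tail4) i j u = - ?d 3 i * ?d 4 j + ?d 3 j * ?d 4 i"
    unfolding tail4_def pw_form_cpair_upair[OF rs] by simp
  also have "pw_form (lform (cpair r s (pr 4))) (rform (word_prod [])) i j u = 0"
    unfolding word_prod_Nil_upair[OF rs] pw_form_cpair_upair[OF rs] by simp
  finally have word_form: "word_form block i j u = ?d 1 i * ?d 0 j - ?d 1 j * ?d 0 i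
     - ?d 2 i * (pr 3 u * ?d 1 j - pr 1 u * ?d 3 j) + ?d 2 j * (pr 3 u * ?d 1 i - pr 1 u * ?d 3 i)
     - ?d 3 i * ?d 4 j + ?d 3 j * ?d 4 i" by simp
  define e where "e l = (if l = 2*b then 1 else 0 :: complex)" for l
  define e' where "e' l = (if l = 2*b+1 then 1 else 0 :: complex)" for l
  define X Y X' Y' where XY: "X = exp (u (2*b))" "Y = exp (u (2*b+1))"
    "X' = exp (- u (2*b))" "Y' = exp (- u (2*b+1))"
  have inv: "X * X' = 1" "Y * Y' = 1" by (simp_all add: XY exp_minus_inverse)
  have v: "pr 1 u = X' * Y' + Y' + X'" "pr 3 u = X' * (1 + Y)"
    using assms(3) by (simp_all add: frieze_par_block frieze_def XY)
  have "word_form block i j u = 2 * (e i * e' j - e j * e' i)"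
    unfolding word_form pd_slice[of i u, OF assms(1,3)] pd_slice[of j u, OF assms(2,3)] v XY[symmetric]
      e_def[symmetric] e'_def[symmetric]
    using inv by algebra
  then show ?thesis by (simp add: e_def e'_def)
qed

end

end

definition frieze_word :: "'n::finite \<Rightarrow> 'n \<Rightarrow> nat \<Rightarrow> nat \<Rightarrow> 'n word" where
  "frieze_word r s m k = map (\<lambda>l. cpair r s (frieze_par m l)) [0..<5*k]"

lemma frieze_word_Suc: "frieze_word r s m (Suc k) = frieze_word r s m k @ block r s m k"
proof -
  have "[0..<5 * Suc k] = [0..<5*k] @ map (\<lambda>q. 5*k+q) [0..<5]"
    using upt_add_eq_append[of 0 "5*k" 5] by (simp add: map_add_upt add.commute)
  then show ?thesis
    by (simp add: frieze_word_def block_def block_par_def o_def)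
qed

lemma flat_frieze_word: "r \<noteq> s \<Longrightarrow> p \<in> set (frieze_word r s m k) \<Longrightarrow> flat p"
  by (auto simp: frieze_word_def intro!: flat_cpair sep_hol_frieze_par)

lemma word_form_frieze_word:
  assumes "r \<noteq> s" "i \<noteq> m" "j \<noteq> m" "u m = 1"
  shows "word_form (frieze_word r s m k) i j u = (\<Sum>b<k. 2 * ((if i = 2*b then 1 else 0) * (if j = 2*b+1 then 1 else 0)
       - (if j = 2*b then 1 else 0) * (if i = 2*b+1 then 1 else 0)))"
proof (induction k)
  case 0
  then show ?case by (simp add: frieze_word_def)
next
  case (Suc k)
  have "\<forall>p\<in>set (frieze_word r s m (Suc k)). munit p"
    using flat_frieze_word[OF assms(1)] flat_munit by blast
  then have "word_form (frieze_word r s m (Suc k)) i j u = word_form (frieze_word r s m k) i j u + word_form (block r s m k) i j u"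
    unfolding frieze_word_Suc using assms by (intro word_form_append word_prod_block_slice) auto
  then show ?case
    using Suc word_form_block[of r s i m j u k] assms by simp
qed

text \<open>
  The blocks multiply to constants on the slice, so no cross terms arise between them.
\<close>

lemma word_form_frieze_word_std_form:
  assumes "r \<noteq> s" "i < 2*k" "j < 2*k" "u (2*k) = 1"
  shows "word_form (frieze_word r s (2*k) k) i j u = std_form 2 i j"
proof -
  have "(\<Sum>b<k. (if i = 2*b then 1 else 0) * (if j = 2*b+1 then 1 else 0)) = (if even i \<and> j = i+1 then 1 else 0 :: complex)"
    if "i < 2*k" for i j :: nat
  proof (cases "even i \<and> j = i + 1")
    case True
    then obtain b where b: "i = 2*b" "j = 2*b+1" by (auto elim: evenE)
    then have "(\<Sum>b'<k. (if i = 2*b' then 1 else 0) * (if j = 2*b'+1 then 1 else 0)) = (\<Sum>b'<k. if b' = b then 1 else 0 :: complex)"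
      by (intro sum.cong) auto
    with b that show ?thesis by simp
  next
    case False
    then have "(\<Sum>b<k. (if i = 2*b then 1 else 0) * (if j = 2*b+1 then 1 else 0)) = (\<Sum>b<k. 0 :: complex)"
      by (intro sum.cong) auto
    with False show ?thesis by auto
  qed
  from this[OF assms(2), of j] this[OF assms(3), of i] show ?thesis
    using assms by (subst word_form_frieze_word)
      (auto simp: sum_distrib_left[symmetric] sum_subtractf std_form_def)
qed

section \<open>Words of involutions\<close>

definition shift :: "nat \<Rightarrow> (nat \<Rightarrow> complex) \<Rightarrow> nat \<Rightarrow> complex" where
  "shift l u = u(l := u l + 2 * of_real pi * \<i>)"

lemma periodic_shift: "periodic l g \<longleftrightarrow> (\<forall>u. g (shift l u) = g u)"
  by (simp add: periodic_def shift_def)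

lemma pd_shift:
  assumes "sep_hol g" "\<And>u. g (shift l u) = g u"
  shows "pd i g (shift l u) = pd i g u"
  using sep_hol_shift(2)[OF assms(1), where i = l and c = "2 * of_real pi * \<i>" and j = i and u = u] assms(2)
  by (simp add: shift_def)

lemma mpd_shift:
  assumes "msep F" "\<And>u. F (shift l u) = F u"
  shows "mpd i F (shift l u) = mpd i F u"
  unfolding mpd_def using assms by (subst pd_shift) (auto simp: msep_def)

definition pair_periodic :: "nat \<Rightarrow> 'n::finite mfun \<times> 'n mfun \<Rightarrow> bool" where
  "pair_periodic l P \<longleftrightarrow> (\<forall>u. fst P (shift l u) = fst P u \<and> snd P (shift l u) = snd P u)"

lemma pair_periodic_word_prod: "\<forall>p\<in>set ws. pair_periodic l p \<Longrightarrow> pair_periodic l (word_prod ws)"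
  by (induction ws) (auto simp: pair_periodic_def pair_prod_def)

lemma periodic_word_form:
  fixes ws :: "'n::finite word"
  assumes "\<forall>p\<in>set ws. munit p" "\<forall>p\<in>set ws. pair_periodic l p"
  shows "word_form ws i j (shift l u) = word_form ws i j u"
proof -
  have l: "lform P i (shift l u) = lform P i u" "rform P i (shift l u) = rform P i u"
    if "munit P" "pair_periodic l P" for P :: "'n mfun \<times> 'n mfun" and i
    using that by (simp_all add: lform_def rform_def mpd_shift munitD pair_periodic_def)
  show ?thesis
    using assms
    by (induction ws) (simp_all add: pw_form_def l munit_word_prod pair_periodic_word_prod)
qed

lemma word_form_zero:
  assumes "\<forall>p\<in>set ws. mpd i (fst p) u = 0 \<and> mpd j (fst p) u = 0"
  shows "word_form ws i j u = 0"
  using assms by (induction ws) (simp_all add: pw_form_def lform_def)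

lemma mpd_zero_on_slice:
  assumes "\<And>v. v m = u m \<Longrightarrow> F v = F u" "i \<noteq> m"
  shows "mpd i F u = 0"
proof -
  have "F (u(i := z)) = F u" for z
    by (rule assms(1)) (use assms(2) in simp)
  then have "pd i (\<lambda>u. F u $ a $ b) u = pd i (\<lambda>_. F u $ a $ b) u" for a b
    by (intro pd_cong_line) (simp only:)
  then show ?thesis by (simp add: mpd_def vec_eq_iff)
qed

lemma fst_word_prod: "fst (word_prod ws) u = foldr (\<lambda>p M. fst p u ** M) ws (mat 1)"
  by (induction ws) (simp_all add: pair_prod_def)

lemma munit_unique:
  assumes "munit P" "munit Q" "fst P = fst Q"
  shows "P = Q"
proof -
  have "snd P u = snd Q u" for u
  proof -
    have "snd P u = (snd Q u ** fst Q u) ** snd P u" by (simp add: munitD[OF assms(2)])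
    also have "\<dots> = snd Q u ** (fst P u ** snd P u)" by (simp only: assms(3) matrix_mul_assoc)
    finally show ?thesis by (simp add: munitD[OF assms(1)])
  qed
  with assms(3) show ?thesis by (simp add: prod_eq_iff fun_eq_iff)
qed

lemma frieze_par_shift:
  assumes "i < 2*k"
  shows "frieze_par (2*k) l (shift i u) = frieze_par (2*k) l u"
proof -
  have e: "exp (shift i u j) = exp (u j)" "exp (- shift i u j) = exp (- u j)" for j
  proof -
    have "exp (2 * of_real pi * \<i>) = 1" "exp (- (2 * of_real pi * \<i>)) = 1"
      using exp_two_pi_i by (simp_all add: exp_minus)
    then show "exp (shift i u j) = exp (u j)" "exp (- shift i u j) = exp (- u j)"
      by (simp_all add: shift_def exp_add exp_diff)
  qed
  have "shift i u (2*k) = u (2*k)" using assms by (simp add: shift_def)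
  then show ?thesis by (simp add: frieze_par_def frieze_def e)
qed

text \<open>
  The hypotheses describe the pull-back of a factorisation along the contracted torus: the letters are
  periodic in the torus coordinates and constant where the scaling parameter vanishes. The family
  \<open>Q = \<Omega>(involutions) - \<Omega>(frieze) + \<Omega>(torus)\<close> is closed for each value of the scaling parameter. It is
  the symplectic form at 0 and the 2-form of the involutions at 1, and its top power has the same
  mean at both ends.
\<close>

lemma no_involution_word:
  fixes Bs :: "'n::finite mfun list"
  assumes rs: "r \<noteq> s" and small: "length Bs * CARD('n \<times> 'n) < k"
    and sep: "\<And>B. B \<in> set Bs \<Longrightarrow> msep B"
    and inv: "\<And>B u. B \<in> set Bs \<Longrightarrow> B u ** B u = mat 1"
    and per: "\<And>B u i. B \<in> set Bs \<Longrightarrow> i < 2*k \<Longrightarrow> B (shift i u) = B u"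
    and const: "\<And>B u v. B \<in> set Bs \<Longrightarrow> u (2*k) = 0 \<Longrightarrow> v (2*k) = 0 \<Longrightarrow> B u = B v"
    and prod: "\<And>u. foldr (\<lambda>B M. B u ** M) Bs (mat 1) =
      foldr (\<lambda>l M. cont_mat r s (frieze_par (2*k) l u) ** M) [0..<5*k] (mat 1)"
  shows False
proof -
  let ?m = "2*k"
  define E where "E = frieze_word r s ?m k"
  define W where "W = map (\<lambda>B. (B, B)) Bs"
  have flat: "\<forall>p\<in>set E. flat p" "\<forall>p\<in>set W. flat p"
    using flat_frieze_word[OF rs] flat_involution[OF sep inv] by (auto simp: E_def W_def)
  then have mu: "\<forall>p\<in>set E. munit p" "\<forall>p\<in>set W. munit p" by (auto intro: flat_munit)
  have "fst (word_prod W) u = fst (word_prod E) u" for u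
    using prod[of u] by (simp add: fst_word_prod W_def E_def frieze_word_def foldr_map o_def fst_cpair)
  then have eq: "word_prod W = word_prod E"
    using mu by (intro munit_unique munit_word_prod) auto
  have perW: "\<forall>p\<in>set W. pair_periodic l p" and perE: "\<forall>p\<in>set E. pair_periodic l p" if "l < ?m" for l
    using per that
    by (auto simp: W_def E_def frieze_word_def pair_periodic_def cpair_def upair_def frieze_par_shift)
  define M where "M i j u = word_form W i j u - word_form E i j u" for i j u
  have sM: "sep_hol (M i j)" for i j
    unfolding M_def[abs_def] by (intro sep_hol_diff sep_hol_word_form mu)
  have pdM: "pd l (M i j) u = pd l (word_form W i j) u - pd l (word_form E i j) u" for i j l u
    unfolding M_def[abs_def] by (intro pd_diff sep_hol_word_form mu)
  have closedM: "pd i (M j l) u + pd j (M l i) u + pd l (M i j) u = 0" for i j l u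
    using word_form_closed_up_to_cartan3[OF flat(1), of i j l u] word_form_closed_up_to_cartan3[OF flat(2), of i j l u]
    by (simp add: pdM eq algebra_simps)
  have perM: "periodic l (M i j)" if "l < ?m" for i j l
    by (simp add: periodic_shift M_def periodic_word_form mu perW[OF that] perE[OF that])
  \<comment> \<open>the standard form is the value of \<open>\<Omega>(E)\<close> on the undeformed torus, extended to be independent of
    the scaling parameter\<close>
  define Q where "Q i j u = M i j u + std_form 2 i j" for i j u
  have sQ: "sep_hol (Q i j)" for i j
    unfolding Q_def[abs_def] by (intro sep_hol_add sM sep_hol_const)
  have perQ: "periodic l (Q i j)" if "l < ?m" for i j l
    using perM[OF that, of i j] by (simp add: Q_def periodic_def)
  have pdQ: "pd l (Q i j) u = pd l (M i j) u" for i j l u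
    unfolding Q_def[abs_def] by (simp add: pd_add sM)
  have "M j i = (\<lambda>u. - M i j u)" for i j
    using word_form_antisym[of W j i] word_form_antisym[of E j i] by (simp add: M_def fun_eq_iff)
  then have anti: "pd l (M j i) u = - pd l (M i j) u" for i j l u
    by (metis pd_minus sM)
  define G where "G = torus_mean ?m (\<lambda>u. Pf k (\<lambda>i j. Q i j u))"
  have sP: "sep_hol (\<lambda>u. Pf k (\<lambda>i j. Q i j u))"
    unfolding Pf_def by (intro sep_hol_alternate sep_hol_prod sQ)
  have "torus_mean ?m (pd ?m (\<lambda>u. Pf k (\<lambda>i j. Q i j u))) = (\<lambda>_. 0)"
  \<comment> \<open>contracting the closed form \<open>M\<close> with the scaling direction gives the primitive (Cartan's formula)\<close>
  proof (rule torus_mean_Pf_stationary[where \<mu> = "M ?m"])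
    show "pd i (Q j l) u + pd j (Q l i) u + pd l (Q i j) u = 0" for i j l u
      unfolding pdQ by (rule closedM)
    show "pd ?m (Q i j) u = pd i (M ?m j) u - pd j (M ?m i) u" for i j u
      using closedM[of ?m i j u] unfolding pdQ anti[of i ?m j u]
      by (metis (no_types) add_diff_cancel_left' add_uminus_conv_diff diff_minus_eq_add minus_diff_eq diff_0 add.commute)
  qed (simp_all add: sQ sM perM perQ)
  then have "pd ?m G u = 0" for u
    unfolding G_def by (simp add: pd_torus_mean[OF sP])
  moreover have "sep_hol G" unfolding G_def by (rule sep_hol_torus_mean[OF sP])
  ultimately have "G ((\<lambda>_. 0)(?m := 1)) = G ((\<lambda>_. 0)(?m := 0))"
    by (intro sep_hol_constant_along)
  moreover have "G ((\<lambda>_. 0)(?m := 1)) = 0"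
    unfolding G_def
  proof (rule torus_mean_const_on_slice[where j = ?m and t = 1])
    fix u :: "nat \<Rightarrow> complex" assume u: "u ?m = 1"
    obtain f g :: "nat \<times> 'n \<times> 'n \<Rightarrow> nat \<Rightarrow> complex"
      where fg: "\<And>i j. word_form W i j u = (\<Sum>s\<in>{..<length W} \<times> UNIV. f s i * g s j - f s j * g s i)"
      using word_form_low_rank[of W u] by blast
    show "Pf k (\<lambda>i j. Q i j u) = 0"
    proof (rule Pf_low_rank)
      show "card ({..<length W} \<times> (UNIV :: ('n \<times> 'n) set)) < k"
        using small by (simp add: W_def card_cartesian_product)
      show "Q i j u = (\<Sum>s\<in>{..<length W} \<times> UNIV. f s i * g s j - f s j * g s i)"
        if "i < 2*k" "j < 2*k" for i j
        using word_form_frieze_word_std_form[of r s i k j u, OF rs that u] by (simp add: Q_def M_def E_def fg)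
    qed simp
  qed auto
  moreover have "G ((\<lambda>_. 0)(?m := 0)) = Pf k (std_form 2)"
    unfolding G_def
  proof (rule torus_mean_const_on_slice[where j = ?m and t = 0])
    fix u :: "nat \<Rightarrow> complex" assume u: "u ?m = 0"
    show "Pf k (\<lambda>i j. Q i j u) = Pf k (std_form 2)"
    proof (rule Pf_cong)
      fix i j assume "i < 2*k" "j < 2*k"
      have "mpd l (fst p) u = 0" if "p \<in> set W \<union> set E" "l < 2*k" for p l
      proof (rule mpd_zero_on_slice[where m = ?m])
        show "fst p v = fst p u" if "v ?m = u ?m" for v
          using \<open>p \<in> set W \<union> set E\<close> that u const
          by (auto simp: W_def E_def frieze_word_def fst_cpair frieze_par_def)
      qed (use that in auto)
      then have "word_form W i j u = 0" "word_form E i j u = 0"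
        using \<open>i < 2*k\<close> \<open>j < 2*k\<close> by (auto intro!: word_form_zero)
      then show "Q i j u = std_form 2 i j" by (simp add: Q_def M_def)
    qed
  qed auto
  ultimately show False using Pf_std_form_nonzero[of 2 k] by simp
qed

section \<open>Complex number space as a function space\<close>

abbreviation Ext :: "nat \<Rightarrow> (nat \<Rightarrow> complex) set" where
  "Ext m \<equiv> PiE {..<m} (\<lambda>_. UNIV)"

lemma continuous_coord: "continuous_on S (\<lambda>x::nat \<Rightarrow> complex. x i)"
  by (rule continuous_coord_comp) (rule continuous_on_id)

text \<open>
  Points of complex number space are extensional functions, so coordinates outside the index set are
  constant and the product topology agrees with the one of the full function type.
\<close>

lemma Cn_eq: "Cn m = top_of_set (Ext m)"
proof -
  have t: "topspace (Cn m) = Ext m" by (simp add: Cn_def)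
  have 1: "continuous_map (Cn m) (top_of_set (Ext m)) (\<lambda>x. x)"
    unfolding continuous_map_in_subtopology
  proof
    have "continuous_map (Cn m) euclidean (\<lambda>x. x i)" for i
    proof (cases "i < m")
      case True
      then show ?thesis unfolding Cn_def by (intro continuous_map_product_projection) simp
    next
      case False
      show ?thesis
        by (rule continuous_map_eq[where f = "\<lambda>_. undefined"])
          (use False in \<open>auto simp: t PiE_def extensional_def\<close>)
    qed
    then show "continuous_map (Cn m) euclidean (\<lambda>x. x)"
      by (subst euclidean_product_topology[symmetric]) (simp add: continuous_map_componentwise_UNIV)
    show "(\<lambda>x. x) \<in> topspace (Cn m) \<rightarrow> Ext m" by (simp add: t)
  qed
  have 2: "continuous_map (top_of_set (Ext m)) (Cn m) (\<lambda>x. x)"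
    unfolding Cn_def continuous_map_componentwise
  proof (intro conjI ballI)
    show "continuous_map (top_of_set (Ext m)) euclidean (\<lambda>x. x k)" for k
      by (simp add: continuous_coord)
  qed (simp_all add: PiE_def)
  show ?thesis
    unfolding topology_eq
  proof (intro allI iffI)
    fix S assume S: "openin (Cn m) S"
    then have "openin (top_of_set (Ext m)) {x \<in> topspace (top_of_set (Ext m)). x \<in> S}"
      using 2 openin_continuous_map_preimage by blast
    moreover have "{x \<in> topspace (top_of_set (Ext m)). x \<in> S} = S"
      using openin_subset[OF S] t by auto
    ultimately show "openin (top_of_set (Ext m)) S" by simp
  next
    fix S assume S: "openin (top_of_set (Ext m)) S"
    then have "openin (Cn m) {x \<in> topspace (Cn m). x \<in> S}"
      using 1 openin_continuous_map_preimage by blast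
    moreover have "{x \<in> topspace (Cn m). x \<in> S} = S"
      using openin_subset[OF S] t by auto
    ultimately show "openin (Cn m) S" by simp
  qed
qed

lemma topspace_Cn: "topspace (Cn m) = Ext m"
  by (simp add: Cn_eq)

lemma atin_Cn: "z \<in> Ext m \<Longrightarrow> atin (Cn m) z = at z within Ext m"
proof -
  assume z: "z \<in> Ext m"
  have "atin (Cn m) z = atin_within euclidean z (Ext m)"
    unfolding Cn_eq by (rule atin_subtopology_within[OF z])
  also have "\<dots> = at z within Ext m"
    by (simp add: atin_within_def at_within_def nhdsin_def nhds_def)
  finally show ?thesis .
qed

text \<open>
  The error quotient in the definition of total differentiability. At \<open>w = z\<close> it is \<open>0 / 0 = 0\<close>, so it is
  continuous there as soon as it tends to 0.
\<close>

definition dquot :: "nat \<Rightarrow> ((nat \<Rightarrow> complex) \<Rightarrow> complex) \<Rightarrow> (nat \<Rightarrow> complex) \<Rightarrow> (nat \<Rightarrow> complex) \<Rightarrow> (nat \<Rightarrow> complex) \<Rightarrow> complex" where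
  "dquot m f z c w = (f w - f z - (\<Sum>i<m. c i * (w i - z i))) / complex_of_real (\<Sum>i<m. cmod (w i - z i))"

lemma holo_on_iff:
  "holo_on m D f \<longleftrightarrow> openin (Cn m) D \<and> (\<forall>z\<in>D. \<exists>c. (dquot m f z c \<longlongrightarrow> 0) (at z within Ext m))"
proof -
  have "z \<in> Ext m" if "openin (Cn m) D" "z \<in> D" for z
    using openin_subset[OF that(1)] that(2) topspace_Cn by blast
  then show ?thesis
    unfolding holo_on_def dquot_def[abs_def] by (auto simp: atin_Cn)
qed

lemma dquot_expand:
  assumes "w \<in> Ext m" "z \<in> Ext m"
  shows "f w = f z + (\<Sum>i<m. c i * (w i - z i)) + dquot m f z c w * complex_of_real (\<Sum>i<m. cmod (w i - z i))"
proof (cases "(\<Sum>i<m. cmod (w i - z i)) = 0")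
  case True
  then have "\<forall>i<m. w i = z i" by (simp add: sum_nonneg_eq_0_iff)
  then have "w = z" using assms by (intro PiE_ext[of w "{..<m}" _ z]) auto
  then show ?thesis by simp
next
  case False
  then show ?thesis by (simp add: dquot_def del: of_real_sum)
qed

lemma tendsto_coordinatewise:
  fixes f :: "'a \<Rightarrow> nat \<Rightarrow> complex"
  assumes "\<And>i. ((\<lambda>x. f x i) \<longlongrightarrow> l i) F"
  shows "(f \<longlongrightarrow> l) F"
proof -
  have "limitin (product_topology (\<lambda>_. euclidean) UNIV) f l F"
    using assms by (simp add: limitin_componentwise)
  then show ?thesis by (simp add: euclidean_product_topology)
qed

lemma dquot_continuous:
  assumes "(dquot m f z c \<longlongrightarrow> 0) (at z within Ext m)"
  shows "continuous (at z within Ext m) (dquot m f z c)"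
  using assms by (simp add: continuous_within dquot_def)

lemma holo_chain:
  assumes q: "(dquot m f z c \<longlongrightarrow> 0) (at z within Ext m)" and z: "z \<in> Ext m"
    and \<gamma>: "\<gamma> s0 = z" "\<And>s. \<gamma> s \<in> Ext m"
    and d: "\<And>i. i < m \<Longrightarrow> ((\<lambda>s. \<gamma> s i) has_field_derivative g i) (at (s0::complex))"
  shows "((\<lambda>s. f (\<gamma> s)) has_field_derivative (\<Sum>i<m. c i * g i)) (at s0)"
proof -
  have lim: "((\<lambda>s. (\<gamma> s i - z i) / (s - s0)) \<longlongrightarrow> g i) (at s0)" if "i < m" for i
    using d[OF that] \<gamma>(1) by (simp add: has_field_derivative_iff)
  have coord: "((\<lambda>s. \<gamma> s i) \<longlongrightarrow> z i) (at s0)" for i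
  proof (cases "i < m")
    case True
    from DERIV_isCont[OF d[OF True]] \<gamma>(1) show ?thesis by (simp add: isCont_def)
  next
    case False
    then have "\<gamma> s i = z i" for s
      using \<gamma>(2)[of s] z by (simp add: PiE_def extensional_def)
    then show ?thesis by simp
  qed
  then have "(\<gamma> \<longlongrightarrow> z) (at s0)" by (rule tendsto_coordinatewise)
  then have "((\<lambda>s. dquot m f z c (\<gamma> s)) \<longlongrightarrow> dquot m f z c z) (at s0)"
    using \<gamma>(2) by (intro continuous_within_tendsto_compose'[OF dquot_continuous[OF q]])
  then have q0: "((\<lambda>s. dquot m f z c (\<gamma> s)) \<longlongrightarrow> 0) (at s0)" by (simp add: dquot_def)
  have "((\<lambda>s. cmod (dquot m f z c (\<gamma> s)) * (\<Sum>i<m. cmod ((\<gamma> s i - z i) / (s - s0)))) \<longlongrightarrow>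
      0 * (\<Sum>i<m. cmod (g i))) (at s0)"
    using q0 lim by (intro tendsto_mult tendsto_sum tendsto_norm tendsto_norm_zero) auto
  moreover have "cmod (dquot m f z c (\<gamma> s) * (complex_of_real (\<Sum>i<m. cmod (\<gamma> s i - z i)) / (s - s0))) =
      cmod (dquot m f z c (\<gamma> s)) * (\<Sum>i<m. cmod ((\<gamma> s i - z i) / (s - s0)))" for s
  proof -
    have "(\<Sum>i<m. cmod ((\<gamma> s i - z i) / (s - s0))) = (\<Sum>i<m. cmod (\<gamma> s i - z i)) / cmod (s - s0)"
      unfolding norm_divide sum_divide_distrib ..
    moreover have "\<bar>\<Sum>i<m. cmod (\<gamma> s i - z i)\<bar> = (\<Sum>i<m. cmod (\<gamma> s i - z i))"
      by (rule abs_of_nonneg) (rule sum_nonneg, rule norm_ge_zero)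
    ultimately show ?thesis unfolding norm_mult norm_divide norm_of_real by simp
  qed
  ultimately have "((\<lambda>s. cmod (dquot m f z c (\<gamma> s) *
      (complex_of_real (\<Sum>i<m. cmod (\<gamma> s i - z i)) / (s - s0)))) \<longlongrightarrow> 0) (at s0)"
    by (simp only: mult_zero_left)
  then have "((\<lambda>s. dquot m f z c (\<gamma> s) * (complex_of_real (\<Sum>i<m. cmod (\<gamma> s i - z i)) / (s - s0))) \<longlongrightarrow> 0) (at s0)"
    by (rule tendsto_norm_zero_cancel)
  moreover have "((\<lambda>s. \<Sum>i<m. c i * ((\<gamma> s i - z i) / (s - s0))) \<longlongrightarrow> (\<Sum>i<m. c i * g i)) (at s0)"
    using lim by (intro tendsto_sum tendsto_mult tendsto_const) auto
  ultimately have "((\<lambda>s. (\<Sum>i<m. c i * ((\<gamma> s i - z i) / (s - s0))) +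
      dquot m f z c (\<gamma> s) * (complex_of_real (\<Sum>i<m. cmod (\<gamma> s i - z i)) / (s - s0))) \<longlongrightarrow> (\<Sum>i<m. c i * g i) + 0) (at s0)"
    by (intro tendsto_add)
  moreover have "(\<Sum>i<m. c i * ((\<gamma> s i - z i) / (s - s0))) +
      dquot m f z c (\<gamma> s) * (complex_of_real (\<Sum>i<m. cmod (\<gamma> s i - z i)) / (s - s0)) = (f (\<gamma> s) - f (\<gamma> s0)) / (s - s0)" for s
    unfolding \<gamma>(1) dquot_expand[OF \<gamma>(2) z, of f s c]
    by (simp add: add_divide_distrib sum_divide_distrib del: of_real_sum)
  ultimately show ?thesis by (simp add: has_field_derivative_iff)
qed

lemma holo_continuous_within:
  assumes q: "(dquot m f z c \<longlongrightarrow> 0) (at z within Ext m)" and z: "z \<in> Ext m"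
  shows "continuous (at z within Ext m) f"
proof -
  have c: "((\<lambda>w. w i) \<longlongrightarrow> z i) (at z within Ext m)" for i
    using continuous_coord[of UNIV i]
    by (auto simp: continuous_on_def intro: tendsto_within_subset)
  have "((\<lambda>w. f z + (\<Sum>i<m. c i * (w i - z i)) + dquot m f z c w * complex_of_real (\<Sum>i<m. cmod (w i - z i)))
      \<longlongrightarrow> f z + (\<Sum>i<m. c i * (z i - z i)) + 0 * complex_of_real (\<Sum>i<m. cmod (z i - z i))) (at z within Ext m)"
    by (intro tendsto_intros c q)
  then have "((\<lambda>w. f z + (\<Sum>i<m. c i * (w i - z i)) + dquot m f z c w * complex_of_real (\<Sum>i<m. cmod (w i - z i)))
      \<longlongrightarrow> f z) (at z within Ext m)" by simp
  moreover have "eventually (\<lambda>w. f z + (\<Sum>i<m. c i * (w i - z i)) + dquot m f z c w *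
      complex_of_real (\<Sum>i<m. cmod (w i - z i)) = f w) (at z within Ext m)"
    unfolding eventually_at_filter
    by (intro always_eventually allI impI) (rule dquot_expand[OF _ z, symmetric])
  ultimately have "(f \<longlongrightarrow> f z) (at z within Ext m)" by (rule Lim_transform_eventually)
  then show ?thesis by (simp add: continuous_within)
qed

lemma holo_on_continuous: "holo_on m (Ext m) f \<Longrightarrow> continuous_on (Ext m) f"
  by (auto simp: continuous_on_eq_continuous_within holo_on_iff intro: holo_continuous_within)

text \<open>
  Total differentiability is a condition on the germ, so holomorphy may be checked with local extensions.
\<close>

lemma holo_on_local:
  assumes "openin (Cn m) D" "\<And>z. z \<in> D \<Longrightarrow> \<exists>V G. z \<in> V \<and> holo_on m V G \<and> (\<forall>w\<in>D \<inter> V. f w = G w)"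
  shows "holo_on m D f"
  unfolding holo_on_iff
proof (intro conjI ballI assms(1))
  fix z assume z: "z \<in> D"
  then obtain V G where V: "z \<in> V" "holo_on m V G" "\<forall>w\<in>D \<inter> V. f w = G w" using assms(2) by blast
  then obtain c where c: "(dquot m G z c \<longlongrightarrow> 0) (at z within Ext m)" and o: "openin (Cn m) V"
    by (auto simp: holo_on_iff)
  have "openin (top_of_set (Ext m)) (D \<inter> V)" using assms(1) o by (simp add: Cn_eq openin_Int)
  then obtain T where T: "open T" "D \<inter> V = Ext m \<inter> T" by (auto simp: openin_open)
  have "eventually (\<lambda>w. w \<in> T) (at z within Ext m)"
    using T z V(1) by (intro eventually_at_topological[THEN iffD2]) blast
  moreover have "eventually (\<lambda>w. w \<in> Ext m) (at z within Ext m)"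
    by (auto simp: eventually_at_filter)
  ultimately have "eventually (\<lambda>w. dquot m G z c w = dquot m f z c w) (at z within Ext m)"
  proof eventually_elim
    case (elim w)
    then have "w \<in> D \<inter> V" using T by blast
    with V z show ?case by (simp add: dquot_def)
  qed
  with c have "(dquot m f z c \<longlongrightarrow> 0) (at z within Ext m)" by (rule Lim_transform_eventually)
  then show "\<exists>c. (dquot m f z c \<longlongrightarrow> 0) (at z within Ext m)" by blast
qed

lemma holo_on_subset: "holo_on m D f \<Longrightarrow> openin (Cn m) D' \<Longrightarrow> D' \<subseteq> D \<Longrightarrow> holo_on m D' f"
  by (auto simp: holo_on_iff)

text \<open>
  Caratheodory's form of differentiability, with slopes \<open>\<phi> i\<close> that are continuous everywhere. Products are
  immediate in this form, and all polynomials in the first \<open>m\<close> coordinates have it.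
\<close>

definition caratheodory :: "nat \<Rightarrow> ((nat \<Rightarrow> complex) \<Rightarrow> complex) \<Rightarrow> bool" where
  "caratheodory m f \<longleftrightarrow> continuous_on UNIV f \<and> (\<forall>z. \<exists>\<phi>. (\<forall>i<m. continuous_on UNIV (\<phi> i)) \<and>
     (\<forall>w. f w - f z = (\<Sum>i<m. \<phi> i w * (w i - z i))))"

lemma smoothE:
  assumes "caratheodory m f"
  obtains \<phi> where "\<And>i. i < m \<Longrightarrow> continuous_on UNIV (\<phi> i)"
    "\<And>w. f w - f z = (\<Sum>i<m. \<phi> i w * (w i - z i))"
proof -
  from assms have "\<exists>\<phi>. (\<forall>i<m. continuous_on UNIV (\<phi> i)) \<and> (\<forall>w. f w - f z = (\<Sum>i<m. \<phi> i w * (w i - z i)))"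
    unfolding caratheodory_def by (elim conjE allE)
  then obtain \<phi> where \<phi>: "\<forall>i<m. continuous_on UNIV (\<phi> i)"
    "\<forall>w. f w - f z = (\<Sum>i<m. \<phi> i w * (w i - z i))" by (elim exE conjE)
  show thesis by (rule that[OF \<phi>(1)[rule_format] \<phi>(2)[rule_format]])
qed

lemma caratheodory_const: "caratheodory m (\<lambda>_. c)"
  unfolding caratheodory_def by (auto intro!: exI[of _ "\<lambda>_ _. 0"])

lemma caratheodory_coord:
  assumes "i < m" shows "caratheodory m (\<lambda>w. w i)"
  unfolding caratheodory_def
proof (intro conjI allI)
  show "continuous_on UNIV (\<lambda>w::nat \<Rightarrow> complex. w i)" by (intro continuous_coord_comp continuous_on_id)
  fix z :: "nat \<Rightarrow> complex"
  have "w i - z i = (\<Sum>j<m. (if j = i then 1 else 0) * (w j - z j))" for w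
  proof -
    have "(\<Sum>j<m. (if j = i then 1 else 0) * (w j - z j)) = (\<Sum>j<m. if j = i then w j - z j else 0)"
      by (intro sum.cong) auto
    then show ?thesis using assms by simp
  qed
  then show "\<exists>\<phi>. (\<forall>j<m. continuous_on UNIV (\<phi> j)) \<and> (\<forall>w. w i - z i = (\<Sum>j<m. \<phi> j w * (w j - z j)))"
    by (intro exI[of _ "\<lambda>j _. if j = i then 1 else 0"]) auto
qed

lemma caratheodory_add:
  assumes "caratheodory m f" "caratheodory m g" shows "caratheodory m (\<lambda>w. f w + g w)"
  unfolding caratheodory_def
proof (intro conjI allI)
  show "continuous_on UNIV (\<lambda>w. f w + g w)"
    using assms by (auto simp: caratheodory_def intro!: continuous_intros)
  fix z
  from assms(1) obtain \<phi> where f: "\<And>i. i < m \<Longrightarrow> continuous_on UNIV (\<phi> i)"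
    "\<And>w. f w - f z = (\<Sum>i<m. \<phi> i w * (w i - z i))" by (rule smoothE[where z = z]) (rule that)
  from assms(2) obtain \<psi> where g: "\<And>i. i < m \<Longrightarrow> continuous_on UNIV (\<psi> i)"
    "\<And>w. g w - g z = (\<Sum>i<m. \<psi> i w * (w i - z i))" by (rule smoothE[where z = z]) (rule that)
  have "f w + g w - (f z + g z) = (f w - f z) + (g w - g z)" for w by simp
  then have "f w + g w - (f z + g z) = (\<Sum>i<m. (\<phi> i w + \<psi> i w) * (w i - z i))" for w
    unfolding f(2) g(2) by (simp add: distrib_right sum.distrib)
  with f(1) g(1) show "\<exists>\<phi>. (\<forall>i<m. continuous_on UNIV (\<phi> i)) \<and> (\<forall>w. f w + g w - (f z + g z) = (\<Sum>i<m. \<phi> i w * (w i - z i)))"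
    by (intro exI[of _ "\<lambda>i w. \<phi> i w + \<psi> i w"])
      (simp add: continuous_on_add)
qed

lemma caratheodory_mult:
  assumes "caratheodory m f" "caratheodory m g" shows "caratheodory m (\<lambda>w. f w * g w)"
  unfolding caratheodory_def
proof (intro conjI allI)
  have g: "continuous_on UNIV g" using assms by (simp add: caratheodory_def)
  show "continuous_on UNIV (\<lambda>w. f w * g w)"
    using assms by (auto simp: caratheodory_def intro!: continuous_intros)
  fix z
  from assms(1) obtain \<phi> where *: "\<And>i. i < m \<Longrightarrow> continuous_on UNIV (\<phi> i)"
    "\<And>w. f w - f z = (\<Sum>i<m. \<phi> i w * (w i - z i))" by (rule smoothE[where z = z]) (rule that)
  from assms(2) obtain \<psi> where **: "\<And>i. i < m \<Longrightarrow> continuous_on UNIV (\<psi> i)"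
    "\<And>w. g w - g z = (\<Sum>i<m. \<psi> i w * (w i - z i))" by (rule smoothE[where z = z]) (rule that)
  have eq: "f w * g w - f z * g z = (f w - f z) * g w + f z * (g w - g z)" for w
    by (simp add: algebra_simps)
  have "f w * g w - f z * g z = (\<Sum>i<m. (\<phi> i w * g w + f z * \<psi> i w) * (w i - z i))" for w
    unfolding eq *(2) **(2) sum_distrib_right sum_distrib_left sum.distrib[symmetric]
    by (intro sum.cong refl) algebra
  with *(1) **(1) g show "\<exists>\<phi>. (\<forall>i<m. continuous_on UNIV (\<phi> i)) \<and> (\<forall>w. f w * g w - f z * g z = (\<Sum>i<m. \<phi> i w * (w i - z i)))"
    by (intro exI[of _ "\<lambda>i w. \<phi> i w * g w + f z * \<psi> i w"]) (simp add: continuous_on_add continuous_on_mult)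
qed

lemma caratheodory_sum: "finite S \<Longrightarrow> (\<And>s. s \<in> S \<Longrightarrow> caratheodory m (f s)) \<Longrightarrow> caratheodory m (\<lambda>w. \<Sum>s\<in>S. f s w)"
  by (induction rule: finite_induct) (auto intro: caratheodory_const caratheodory_add)

lemma caratheodory_holo_on:
  assumes "caratheodory m f" "openin (Cn m) D"
  shows "holo_on m D f"
  unfolding holo_on_iff
proof (intro conjI ballI assms(2))
  fix z
  from assms(1) obtain \<phi> where \<phi>: "\<And>i. i < m \<Longrightarrow> continuous_on UNIV (\<phi> i)"
    "\<And>w. f w - f z = (\<Sum>i<m. \<phi> i w * (w i - z i))" by (rule smoothE[where z = z]) (rule that)
  have le: "cmod (dquot m f z (\<lambda>i. \<phi> i z) w) \<le> (\<Sum>i<m. cmod (\<phi> i w - \<phi> i z))" for w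
  proof -
    let ?n = "\<Sum>i<m. cmod (w i - z i)"
    have n: "?n \<ge> 0" by (simp add: sum_nonneg)
    have "f w - f z - (\<Sum>i<m. \<phi> i z * (w i - z i)) = (\<Sum>i<m. (\<phi> i w - \<phi> i z) * (w i - z i))"
      by (simp add: \<phi>(2) left_diff_distrib sum_subtractf)
    also have "cmod \<dots> \<le> (\<Sum>i<m. cmod (\<phi> i w - \<phi> i z) * ?n)"
    proof (rule sum_norm_le)
      fix i assume "i \<in> {..<m}"
      then have "cmod (w i - z i) \<le> ?n" by (intro member_le_sum) auto
      then show "cmod ((\<phi> i w - \<phi> i z) * (w i - z i)) \<le> cmod (\<phi> i w - \<phi> i z) * ?n"
        by (simp add: norm_mult mult_left_mono)
    qed
    finally have "cmod (f w - f z - (\<Sum>i<m. \<phi> i z * (w i - z i))) \<le> (\<Sum>i<m. cmod (\<phi> i w - \<phi> i z)) * ?n"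
      by (simp add: sum_distrib_right)
    then show ?thesis
      unfolding dquot_def norm_divide norm_of_real abs_of_nonneg[OF n]
      using n by (cases "?n = 0") (simp_all only: divide_le_eq less_le, simp_all add: sum_nonneg)
  qed
  have "((\<lambda>w. \<Sum>i<m. cmod (\<phi> i w - \<phi> i z)) \<longlongrightarrow> (\<Sum>i<m. cmod (\<phi> i z - \<phi> i z))) (at z within Ext m)"
    using \<phi>(1) by (intro tendsto_intros) (auto simp: continuous_on_def intro: tendsto_within_subset)
  then have "(dquot m f z (\<lambda>i. \<phi> i z) \<longlongrightarrow> 0) (at z within Ext m)"
    by (intro Lim_null_comparison[OF always_eventually[OF allI[OF le]]]) simp
  then show "\<exists>c. (dquot m f z c \<longlongrightarrow> 0) (at z within Ext m)" by blast
qed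

definition Cspace :: "nat \<Rightarrow> (nat \<Rightarrow> complex) fspace" where
  "Cspace d = model_space d (Ext d)"

lemma Top_Cspace: "Top (Cspace d) = Cn d"
  by (simp add: Cspace_def model_space_def Cn_eq subtopology_subtopology)

lemma hol_functions_Cspace: "hol_functions (Cspace d) = {f. holo_on d (Ext d) f}"
proof -
  have o: "openin (Cn d) (Ext d)" using openin_topspace[of "Cn d"] by (simp add: topspace_Cn)
  show ?thesis
  proof (intro set_eqI iffI)
    fix f assume "f \<in> hol_functions (Cspace d)"
    then have "\<forall>z\<in>Ext d. \<exists>V G. z \<in> V \<and> holo_on d V G \<and> (\<forall>w\<in>Ext d \<inter> V. f w = G w)"
      by (simp add: hol_functions_def Top_Cspace topspace_Cn) (simp add: Cspace_def model_space_def)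
    then show "f \<in> {f. holo_on d (Ext d) f}" using holo_on_local[OF o, of f] by auto
  next
    fix f assume "f \<in> {f. holo_on d (Ext d) f}"
    then have "\<forall>z\<in>Ext d. \<exists>V G. z \<in> V \<and> holo_on d V G \<and> (\<forall>w\<in>Ext d \<inter> V. f w = G w)" by blast
    then show "f \<in> hol_functions (Cspace d)"
      by (simp add: hol_functions_def Top_Cspace topspace_Cn) (simp add: Cspace_def model_space_def)
  qed
qed

lemma fspace_iso_id: "fspace_iso id (open_subspace (Cspace d) (Ext d)) (model_space d (Ext d))"
proof -
  have t: "subtopology (Cn d) (Ext d) = Cn d" by (simp add: Cn_eq subtopology_subtopology)
  have "{x \<in> Ext d. x \<in> W} = W" if "openin (Cn d) W" for W
    using openin_subset[OF that] topspace_Cn by auto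
  then show ?thesis
    by (auto simp: fspace_iso_def open_subspace_def Top_Cspace t topspace_Cn)
      (simp_all add: Cspace_def model_space_def t topspace_Cn homeomorphic_map_id)
qed

lemma model_section_iff:
  "f \<in> Sh (model_space m A) W \<longleftrightarrow>
    (\<forall>z\<in>W. \<exists>V G. z \<in> V \<and> holo_on m V G \<and> (\<forall>w\<in>W \<inter> V. f w = G w))"
  by (simp add: model_space_def)

lemma function_sheaf_model: "function_sheaf (model_space m A)"
  unfolding function_sheaf_def
proof (intro conjI allI impI)
  fix U f g assume f: "f \<in> Sh (model_space m A) U" and g: "\<forall>x\<in>U. f x = g x"
  show "g \<in> Sh (model_space m A) U"
    unfolding model_section_iff
  proof
    fix z assume "z \<in> U"
    then obtain V G where "z \<in> V" "holo_on m V G" "\<forall>w\<in>U \<inter> V. f w = G w"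
      using f unfolding model_section_iff by blast
    with g show "\<exists>V G. z \<in> V \<and> holo_on m V G \<and> (\<forall>w\<in>U \<inter> V. g w = G w)"
      by (intro exI[of _ V] exI[of _ G]) simp
  qed
next
  fix U V f assume VU: "V \<subseteq> U" and f: "f \<in> Sh (model_space m A) U"
  show "f \<in> Sh (model_space m A) V"
    unfolding model_section_iff
  proof
    fix z assume "z \<in> V"
    then obtain W G where "z \<in> W" "holo_on m W G" "\<forall>w\<in>U \<inter> W. f w = G w"
      using f VU unfolding model_section_iff by blast
    with VU show "\<exists>W G. z \<in> W \<and> holo_on m W G \<and> (\<forall>w\<in>V \<inter> W. f w = G w)"
      by (intro exI[of _ W] exI[of _ G]) auto
  qed
next
  fix U f assume o: "openin (Top (model_space m A)) U" and U: "\<forall>x\<in>U. \<exists>V. openin (Top (model_space m A)) V \<and> x \<in> V \<and> V \<subseteq> U \<and> f \<in> Sh (model_space m A) V"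
  have "\<exists>V G. z \<in> V \<and> holo_on m V G \<and> (\<forall>w\<in>U \<inter> V. f w = G w)" if "z \<in> U" for z
  proof -
    obtain V where V: "openin (subtopology (Cn m) A) V" "z \<in> V" "V \<subseteq> U" "f \<in> Sh (model_space m A) V"
      using U \<open>z \<in> U\<close> unfolding model_space_def by auto
    then obtain V' G where G: "z \<in> V'" "holo_on m V' G" "\<forall>w\<in>V \<inter> V'. f w = G w"
      unfolding model_section_iff by blast
    obtain T where T: "openin (Cn m) T" "V = T \<inter> A" using V(1) by (auto simp: openin_subtopology)
    have "U \<subseteq> A" using openin_subset[OF o] by (simp add: model_space_def)
    then have "f w = G w" if "w \<in> U \<inter> (V' \<inter> T)" for w using that T(2) G(3) by blast
    moreover have "holo_on m (V' \<inter> T) G"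
      using G(2) T(1) by (intro holo_on_subset[OF G(2)]) (auto simp: holo_on_iff)
    ultimately show ?thesis using V(2) T(2) G(1) by blast
  qed
  then show "f \<in> Sh (model_space m A) U" by (simp only: model_section_iff) blast
qed

section \<open>Complex number space is Stein of the expected dimension\<close>

text \<open>
  Fewer equations than unknowns, by Gaussian elimination: the pivot \<open>p\<close> of the last equation is moved to
  the last place and eliminated.
\<close>

lemma homogeneous_system:
  fixes b :: "nat \<Rightarrow> nat \<Rightarrow> complex"
  assumes "d < k"
  shows "\<exists>v. (\<exists>l<k. v l \<noteq> 0) \<and> (\<forall>i<d. (\<Sum>l<k. b i l * v l) = 0)"
  using assms
proof (induction d arbitrary: k b)
  case 0
  then show ?case by (intro exI[of _ "\<lambda>_. 1"]) auto
next
  case (Suc d)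
  show ?case
  proof (cases "\<forall>l<k. b d l = 0")
    case True
    obtain v where v: "\<exists>l<k. v l \<noteq> 0" "\<forall>i<d. (\<Sum>l<k. b i l * v l) = 0"
      using Suc.IH[of k b] Suc.prems by auto
    moreover have "(\<Sum>l<k. b d l * v l) = 0" using True by simp
    ultimately show ?thesis by (intro exI[of _ v]) (auto simp: less_Suc_eq)
  next
    case False
    then obtain p where p: "p < k" "b d p \<noteq> 0" by blast
    define \<pi> where "\<pi> = Transposition.transpose p (k - 1)"
    define c where "c i l = b i (\<pi> l) - b i p * b d (\<pi> l) / b d p" for i l
    have "d < k - 1" using Suc.prems by simp
    from Suc.IH[OF this, of c]
    obtain v where v: "\<exists>l<k-1. v l \<noteq> 0" "\<forall>i<d. (\<Sum>l<k-1. c i l * v l) = 0"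
      by blast
    define t where "t = - (\<Sum>l<k-1. b d (\<pi> l) * v l) / b d p"
    define w where "w l = (if \<pi> l = k - 1 then t else v (\<pi> l))" for l
    have k: "k = Suc (k - 1)" using p by simp
    have inv: "\<pi> (\<pi> l) = l" for l by (simp add: \<pi>_def)
    have bij: "bij_betw \<pi> {..<k} {..<k}"
      unfolding \<pi>_def using p by (intro permutes_imp_bij permutes_swap_id) auto
    have sum: "(\<Sum>l<k. b i l * w l) = (\<Sum>l<k-1. b i (\<pi> l) * v l) + b i p * t" for i
    proof -
      have "(\<Sum>l<k. b i l * w l) = (\<Sum>l<k. b i (\<pi> l) * w (\<pi> l))"
        by (rule sum.reindex_bij_betw[OF bij, symmetric])
      also have "\<dots> = (\<Sum>l<k-1. b i (\<pi> l) * w (\<pi> l)) + b i (\<pi> (k-1)) * w (\<pi> (k-1))"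
        by (subst k) (simp only: sum.lessThan_Suc)
      also have "\<dots> = (\<Sum>l<k-1. b i (\<pi> l) * v l) + b i p * t"
        by (simp add: w_def inv) (simp add: \<pi>_def)
      finally show ?thesis .
    qed
    have "(\<Sum>l<k. b d l * w l) = 0"
      unfolding sum t_def using p by simp
    moreover have "(\<Sum>l<k. b i l * w l) = 0" if "i < d" for i
    proof -
      have "0 = (\<Sum>l<k-1. c i l * v l)" using v(2) that by simp
      also have "\<dots> = (\<Sum>l<k-1. b i (\<pi> l) * v l) - b i p * ((\<Sum>l<k-1. b d (\<pi> l) * v l) / b d p)"
        by (simp add: c_def left_diff_distrib sum_subtractf sum_distrib_left sum_divide_distrib mult.assoc)
      finally show ?thesis unfolding sum t_def by (simp add: mult.assoc)
    qed
    moreover obtain l where "l < k - 1" "v l \<noteq> 0" using v(1) by blast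
    then have "\<pi> l < k" "w (\<pi> l) \<noteq> 0"
      using bij_betw_apply[OF bij, of l] by (auto simp: w_def inv)
    ultimately show ?thesis by (intro exI[of _ w]) (auto simp: less_Suc_eq)
  qed
qed

lemma curve_line:
  fixes v :: "nat \<Rightarrow> complex"
  assumes "y \<in> Ext k"
  defines "\<gamma> \<equiv> \<lambda>s::complex. restrict (\<lambda>l. y l + s * v l) {..<k}"
  shows "\<gamma> 0 = y" "\<gamma> s \<in> Ext k" "continuous_on UNIV \<gamma>"
    "l < k \<Longrightarrow> ((\<lambda>s. \<gamma> s l) has_field_derivative v l) (at 0)"
proof -
  show "\<gamma> 0 = y" using assms by (auto simp: PiE_def extensional_def restrict_def)
  show "\<gamma> s \<in> Ext k" by (simp add: \<gamma>_def)
  show "continuous_on UNIV \<gamma>"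
  proof (rule continuous_on_coordinatewise_then_product)
    show "continuous_on UNIV (\<lambda>s. \<gamma> s i)" for i
      by (cases "i < k") (auto simp: \<gamma>_def intro!: continuous_intros)
  qed
  show "((\<lambda>s. \<gamma> s l) has_field_derivative v l) (at 0)" if "l < k"
    using that by (auto simp: \<gamma>_def intro!: derivative_eq_intros)
qed

lemma holo_chain_ev:
  assumes q: "(dquot m f z c \<longlongrightarrow> 0) (at z within Ext m)" and z: "z \<in> Ext m"
    and \<gamma>: "\<gamma> s0 = z" "eventually (\<lambda>s. \<gamma> s \<in> Ext m) (at s0)"
    and d: "\<And>i. i < m \<Longrightarrow> ((\<lambda>s. \<gamma> s i) has_field_derivative g i) (at (s0::complex))"
  shows "((\<lambda>s. f (\<gamma> s)) has_field_derivative (\<Sum>i<m. c i * g i)) (at s0)"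
proof -
  define \<delta> where "\<delta> s = (if \<gamma> s \<in> Ext m then \<gamma> s else z)" for s
  have "eventually (\<lambda>s. \<gamma> s = \<delta> s) (at s0)"
    using \<gamma>(2) by (rule eventually_mono) (simp add: \<delta>_def)
  then have ev: "eventually (\<lambda>s. \<gamma> s = \<delta> s) (nhds s0)"
    unfolding eventually_nhds_conv_at using \<gamma>(1) z by (simp add: \<delta>_def)
  have "((\<lambda>s. f (\<delta> s)) has_field_derivative (\<Sum>i<m. c i * g i)) (at s0)"
  proof (rule holo_chain[OF q z])
    fix i assume i: "i < m"
    have "eventually (\<lambda>s. \<gamma> s i = \<delta> s i) (nhds s0)"
      using ev by (rule eventually_mono) simp
    from DERIV_cong_ev[OF refl this refl, THEN iffD1, OF d[OF i]]
    show "((\<lambda>s. \<delta> s i) has_field_derivative g i) (at s0)" .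
  next
    show "\<delta> s0 = z" using \<gamma>(1) by (simp add: \<delta>_def)
    show "\<delta> s \<in> Ext m" for s using z by (simp add: \<delta>_def)
  qed
  moreover have ev': "eventually (\<lambda>s. f (\<gamma> s) = f (\<delta> s)) (nhds s0)"
    using ev by (rule eventually_mono) simp
  ultimately show ?thesis
    by (simp only: DERIV_cong_ev[OF refl ev' refl])
qed

text \<open>
  A chart and its inverse are holomorphic because they pull coordinates back to sections. If \<open>k > d\<close>, some
  direction in the \<open>k\<close>-dimensional chart is annihilated by the derivative of the map to the
  \<open>d\<close>-dimensional side; going back, the chain rule would make this direction zero.
\<close>

lemma regular_point_dim_le:
  assumes "regular_point (Cspace d) k x"
  shows "k \<le> d"
proof (rule ccontr)
  assume "\<not> k \<le> d" then have dk: "d < k" by simp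
  obtain U D \<phi> where U: "openin (Cn d) U" "x \<in> U" and D: "openin (Cn k) D"
    and iso: "fspace_iso \<phi> (open_subspace (Cspace d) U) (model_space k D)"
    using assms by (auto simp: regular_point_def Top_Cspace)
  have UE: "U \<subseteq> Ext d" and DE: "D \<subseteq> Ext k"
    using openin_subset[OF U(1)] openin_subset[OF D] by (simp_all add: topspace_Cn)
  have tU: "topspace (subtopology (Cn d) U) = U" and tD: "topspace (subtopology (Cn k) D) = D"
    using UE DE by (auto simp: topspace_Cn)
  have spaces: "Top (open_subspace (Cspace d) U) = subtopology (Cn d) U"
    "Sh (open_subspace (Cspace d) U) = Sh (Cspace d)"
    "Top (model_space k D) = subtopology (Cn k) D"
    by (simp_all add: open_subspace_def Top_Cspace model_space_def)
  have hm: "homeomorphic_map (subtopology (Cn d) U) (subtopology (Cn k) D) \<phi>"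
    and sh: "\<And>W g. openin (subtopology (Cn k) D) W \<Longrightarrow>
      g \<in> Sh (model_space k D) W \<longleftrightarrow> g \<circ> \<phi> \<in> Sh (Cspace d) {x \<in> U. \<phi> x \<in> W}"
    using iso unfolding fspace_iso_def spaces tU by blast+
  obtain \<psi> where hms: "homeomorphic_maps (subtopology (Cn d) U) (subtopology (Cn k) D) \<phi> \<psi>"
    using hm homeomorphic_map_maps by blast
  have \<phi>: "continuous_map (subtopology (Cn d) U) (subtopology (Cn k) D) \<phi>"
    and \<psi>: "continuous_map (subtopology (Cn k) D) (subtopology (Cn d) U) \<psi>"
    and \<psi>\<phi>: "\<And>w. w \<in> U \<Longrightarrow> \<psi> (\<phi> w) = w" and \<phi>\<psi>: "\<And>v. v \<in> D \<Longrightarrow> \<phi> (\<psi> v) = v"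
    using hms unfolding homeomorphic_maps_def tU tD by blast+
  have \<phi>D: "\<phi> w \<in> D" if "w \<in> U" for w
    using continuous_map_funspace[OF \<phi>] that unfolding tU tD by blast
  have \<psi>U: "\<psi> v \<in> U" if "v \<in> D" for v
    using continuous_map_funspace[OF \<psi>] that unfolding tU tD by blast
  have oD: "openin (subtopology (Cn k) D) D" using tD openin_topspace by metis
  have pre: "{x \<in> U. \<phi> x \<in> D} = U" using \<phi>D by auto
  define y where "y = \<phi> x"
  have y: "y \<in> D" "y \<in> Ext k" using \<phi>D U(2) DE by (auto simp: y_def)
  have ShX: "f \<in> Sh (Cspace d) W \<longleftrightarrow> (\<forall>z\<in>W. \<exists>V G. z \<in> V \<and> holo_on d V G \<and> (\<forall>w\<in>W \<inter> V. f w = G w))" for f W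
    unfolding Cspace_def by (rule model_section_iff)
  have ShY: "f \<in> Sh (model_space k D) W \<longleftrightarrow> (\<forall>z\<in>W. \<exists>V G. z \<in> V \<and> holo_on k V G \<and> (\<forall>w\<in>W \<inter> V. f w = G w))" for f W
    by (rule model_section_iff)
  have "\<exists>V G. x \<in> V \<and> holo_on d V G \<and> (\<forall>w\<in>U \<inter> V. \<phi> w j = G w)" if "j < k" for j
  proof -
    have "(\<lambda>v. v j) \<in> Sh (model_space k D) D"
      unfolding ShY using caratheodory_holo_on[OF caratheodory_coord[OF that] D] by blast
    then show ?thesis
      using sh[OF oD, of "\<lambda>v. v j"] U(2) unfolding pre ShX by auto
  qed
  then obtain V G where VG: "\<And>j. j < k \<Longrightarrow> x \<in> V j" "\<And>j. j < k \<Longrightarrow> holo_on d (V j) (G j)"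
    "\<And>j w. j < k \<Longrightarrow> w \<in> U \<Longrightarrow> w \<in> V j \<Longrightarrow> \<phi> w j = G j w"
    by (metis IntI)
  have "\<exists>V G. y \<in> V \<and> holo_on k V G \<and> (\<forall>v\<in>D \<inter> V. \<psi> v i = G v)" if "i < d" for i
  proof -
    have "(\<lambda>v. \<psi> v i) \<circ> \<phi> \<in> Sh (Cspace d) U"
      unfolding ShX
    proof
      fix z assume "z \<in> U"
      then show "\<exists>V G. z \<in> V \<and> holo_on d V G \<and> (\<forall>w\<in>U \<inter> V. ((\<lambda>v. \<psi> v i) \<circ> \<phi>) w = G w)"
        using caratheodory_holo_on[OF caratheodory_coord[OF that] U(1)] \<psi>\<phi> by (intro exI[of _ U] exI[of _ "\<lambda>w. w i"]) auto
    qed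
    then have "(\<lambda>v. \<psi> v i) \<in> Sh (model_space k D) D"
      using sh[OF oD, of "\<lambda>v. \<psi> v i"] unfolding pre by blast
    then show ?thesis using y(1) unfolding ShY by blast
  qed
  then obtain V' G' where VG': "\<And>i. i < d \<Longrightarrow> y \<in> V' i" "\<And>i. i < d \<Longrightarrow> holo_on k (V' i) (G' i)"
    "\<And>i v. i < d \<Longrightarrow> v \<in> D \<Longrightarrow> v \<in> V' i \<Longrightarrow> \<psi> v i = G' i v"
    by (metis IntI)
  have "\<exists>c. (dquot d (G j) x c \<longlongrightarrow> 0) (at x within Ext d)" if "j < k" for j
    using VG(1,2)[OF that] by (auto simp: holo_on_iff)
  then obtain c where c: "\<And>j. j < k \<Longrightarrow> (dquot d (G j) x (c j) \<longlongrightarrow> 0) (at x within Ext d)" by metis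
  have "\<exists>b. (dquot k (G' i) y b \<longlongrightarrow> 0) (at y within Ext k)" if "i < d" for i
    using VG'(1,2)[OF that] by (auto simp: holo_on_iff)
  then obtain b where b: "\<And>i. i < d \<Longrightarrow> (dquot k (G' i) y (b i) \<longlongrightarrow> 0) (at y within Ext k)" by metis
  obtain v l where v: "l < k" "v l \<noteq> 0" "\<And>i. i < d \<Longrightarrow> (\<Sum>l<k. b i l * v l) = 0"
    using homogeneous_system[OF dk, of b] by blast
  define \<gamma> where "\<gamma> s = restrict (\<lambda>l. y l + s * v l) {..<k}" for s
  note \<gamma> = curve_line[OF y(2), where v = v, folded \<gamma>_def]
  have near: "eventually (\<lambda>s. \<gamma> s \<in> W) (nhds 0)" if "openin (Cn k) W" "y \<in> W" for W
  proof -
    from that(1) have "\<exists>T. open T \<and> W = Ext k \<inter> T" by (simp only: Cn_eq openin_open)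
    then obtain T where T: "open T" "W = Ext k \<inter> T" by (elim exE conjE)
    then have "open (\<gamma> -` T)" using \<gamma>(3) by (simp add: open_vimage)
    then have "eventually (\<lambda>s. s \<in> \<gamma> -` T) (nhds 0)"
      using \<gamma>(1) that(2) T by (intro eventually_nhds_in_open) auto
    then show ?thesis by eventually_elim (use T \<gamma>(2) in auto)
  qed
  \<comment> \<open>the image of a line in the annihilated direction, which is stationary to first order\<close>
  define \<delta> where "\<delta> s = \<psi> (\<gamma> s)" for s
  have inD: "eventually (\<lambda>s. \<gamma> s \<in> D) (nhds 0)" by (rule near[OF D y(1)])
  have \<delta>0: "\<delta> 0 = x" using \<gamma>(1) \<psi>\<phi> U(2) by (simp add: \<delta>_def y_def)
  have d\<delta>: "((\<lambda>s. \<delta> s i) has_field_derivative 0) (at 0)" if i: "i < d" for i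
  proof -
    have D0: "((\<lambda>s. G' i (\<gamma> s)) has_field_derivative (\<Sum>l<k. b i l * v l)) (at 0)"
      by (rule holo_chain[OF b[OF i] y(2)]) (use \<gamma> in auto)
    have "openin (Cn k) (V' i)" using VG'(2)[OF i] by (simp add: holo_on_iff)
    from inD near[OF this VG'(1)[OF i]]
    have ev: "eventually (\<lambda>s. \<delta> s i = G' i (\<gamma> s)) (nhds 0)"
      by eventually_elim (simp add: \<delta>_def VG'(3)[OF i])
    show ?thesis
      using DERIV_cong_ev[OF refl ev refl, THEN iffD2, OF D0] unfolding v(3)[OF i] .
  qed
  have inE: "eventually (\<lambda>s. \<delta> s \<in> Ext d) (at 0)"
  proof -
    have "eventually (\<lambda>s. \<gamma> s \<in> D) (at 0)" using inD by (simp add: eventually_nhds_conv_at)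
    then show ?thesis by (rule eventually_mono) (use \<psi>U UE in \<open>auto simp: \<delta>_def\<close>)
  qed
  have D1: "((\<lambda>s. G l (\<delta> s)) has_field_derivative (\<Sum>i<d. c l i * 0)) (at 0)"
  proof (rule holo_chain_ev[where g = "\<lambda>_. 0", OF c[OF v(1)]])
    show "x \<in> Ext d" using U(2) UE by blast
  qed (simp_all add: \<delta>0 inE d\<delta>)
  have "eventually (\<lambda>s. \<gamma> s l = G l (\<delta> s)) (nhds 0)"
  proof -
    have "openin (Cn d) (V l)" using VG(2)[OF v(1)] by (simp add: holo_on_iff)
    then have "openin (subtopology (Cn d) U) (V l \<inter> U)" by (auto simp: openin_subtopology)
    then have "openin (subtopology (Cn k) D) {v \<in> D. \<psi> v \<in> V l \<inter> U}"
      using openin_continuous_map_preimage[OF \<psi>] tD by metis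
    then have "openin (Cn k) {v \<in> D. \<psi> v \<in> V l \<inter> U}" using D openin_trans_full by blast
    moreover have "y \<in> {v \<in> D. \<psi> v \<in> V l \<inter> U}"
      using y(1) VG(1)[OF v(1)] U(2) \<psi>\<phi> by (simp add: y_def)
    ultimately have "eventually (\<lambda>s. \<gamma> s \<in> {v \<in> D. \<psi> v \<in> V l \<inter> U}) (nhds 0)" by (rule near)
    then show ?thesis
    proof (rule eventually_mono)
      fix s assume "\<gamma> s \<in> {v \<in> D. \<psi> v \<in> V l \<inter> U}"
      then show "\<gamma> s l = G l (\<delta> s)"
        using VG(3)[OF v(1), of "\<delta> s"] \<phi>\<psi>[of "\<gamma> s"] by (simp add: \<delta>_def)
    qed
  qed
  from DERIV_cong_ev[OF refl this refl, THEN iffD2, OF D1]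
  have "((\<lambda>s. \<gamma> s l) has_field_derivative 0) (at 0)" by simp
  with \<gamma>(4)[OF v(1)] have "v l = 0" by (rule DERIV_unique)
  with v(2) show False by simp
qed

lemma analytic_subset_Ext: "analytic_subset d (Ext d) (Ext d)"
proof -
  have o: "openin (Cn d) (Ext d)" using openin_topspace[of "Cn d"] by (simp add: topspace_Cn)
  show ?thesis
    unfolding analytic_subset_def
  proof (intro conjI ballI o subset_refl)
    fix z assume "z \<in> Ext d"
    with o show "\<exists>V F. openin (Cn d) V \<and> z \<in> V \<and> V \<subseteq> Ext d \<and> finite F \<and> (\<forall>f\<in>F. holo_on d V f) \<and>
        Ext d \<inter> V = {w \<in> V. \<forall>f\<in>F. f w = 0}"
      by (intro exI[of _ "Ext d"] exI[of _ "{}"]) simp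
  qed
qed

lemma reduced_complex_space_Cspace: "reduced_complex_space (Cspace d)"
  unfolding reduced_complex_space_def
proof (intro conjI ballI)
  show "Hausdorff_space (Top (Cspace d))"
    unfolding Top_Cspace Cn_eq by (intro Hausdorff_space_subtopology) simp
  have "second_countable (euclidean :: (nat \<Rightarrow> complex) topology)"
  proof -
    obtain B :: "(nat \<Rightarrow> complex) set set" where B: "countable B" "topological_basis B"
      using ex_countable_basis by blast
    show ?thesis
      unfolding second_countable_def
    proof (intro exI[of _ B] conjI B(1) ballI allI impI)
      show "openin euclidean V" if "V \<in> B" for V
        using topological_basis_open[OF B(2) that] by simp
      fix U :: "(nat \<Rightarrow> complex) set" and x assume "openin euclidean U \<and> x \<in> U"
      then have "open U" "x \<in> U" by simp_all
      from topological_basisE[OF B(2) this] show "\<exists>V\<in>B. x \<in> V \<and> V \<subseteq> U" by metis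
    qed
  qed
  then show "second_countable (Top (Cspace d))"
    unfolding Top_Cspace Cn_eq by (rule second_countable_subtopology)
  show "function_sheaf (Cspace d)" unfolding Cspace_def by (rule function_sheaf_model)
  fix x assume "x \<in> topspace (Top (Cspace d))"
  then have "x \<in> Ext d" by (simp add: Top_Cspace topspace_Cn)
  moreover have "openin (Top (Cspace d)) (Ext d)"
    using openin_topspace[of "Cn d"] by (simp add: Top_Cspace topspace_Cn)
  ultimately show "\<exists>U m D A \<phi>. openin (Top (Cspace d)) U \<and> x \<in> U \<and> analytic_subset m D A \<and>
        fspace_iso \<phi> (open_subspace (Cspace d) U) (model_space m A)"
    using analytic_subset_Ext fspace_iso_id by blast
qed

lemma has_complex_dim_Cspace: "has_complex_dim (Cspace d) d"
  unfolding has_complex_dim_def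
proof
  have o: "openin (Cn d) (Ext d)" using openin_topspace[of "Cn d"] by (simp add: topspace_Cn)
  have "regular_point (Cspace d) d x" if "x \<in> Ext d" for x
    unfolding regular_point_def Top_Cspace using o that fspace_iso_id by blast
  moreover have "restrict (\<lambda>_. 0) {..<d} \<in> Ext d" by simp
  ultimately show "\<exists>x\<in>topspace (Top (Cspace d)). regular_point (Cspace d) d x"
    unfolding Top_Cspace topspace_Cn by blast
qed (use regular_point_dim_le in blast)

lemma hol_functions_coord: "i < d \<Longrightarrow> (\<lambda>w. w i) \<in> hol_functions (Cspace d)"
  using openin_topspace[of "Cn d"]
  by (auto simp: hol_functions_Cspace topspace_Cn intro!: caratheodory_holo_on caratheodory_coord)

text \<open>
  The coordinates are holomorphic. They separate points and confine each hull to a closed polydisc.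
\<close>

lemma reduced_stein_space_Cspace: "reduced_stein_space (Cspace d)"
  unfolding reduced_stein_space_def
proof (intro conjI reduced_complex_space_Cspace)
  show "hol_separable (Cspace d)"
    unfolding hol_separable_def Top_Cspace topspace_Cn
  proof (intro ballI impI)
    fix x y assume "x \<in> Ext d" "y \<in> Ext d" "x \<noteq> y"
    then obtain i where "i < d" "x i \<noteq> y i" by (metis PiE_ext lessThan_iff)
    then show "\<exists>f\<in>hol_functions (Cspace d). f x \<noteq> f y"
      by (intro bexI[of _ "\<lambda>w. w i"] hol_functions_coord)
  qed
  show "hol_convex (Cspace d)"
    unfolding hol_convex_def Top_Cspace
  proof (intro allI impI)
    fix K :: "(nat \<Rightarrow> complex) set"
    let ?F = "hol_functions (Cspace d)" and ?s = "\<lambda>f. SUP y\<in>K. cmod (f y :: complex)"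
    \<comment> \<open>the hull is bounded by the suprema of the coordinates themselves\<close>
    let ?P = "PiE {..<d} (\<lambda>i. cball 0 (?s (\<lambda>w. w i)))"
    have hull: "hol_hull (Cspace d) K = {x \<in> Ext d. \<forall>f\<in>?F. cmod (f x) \<le> ?s f}"
      by (simp add: hol_hull_def Top_Cspace topspace_Cn)
    have "compactin (Cn d) ?P" by (simp add: Cn_def compactin_PiE)
    moreover have "hol_hull (Cspace d) K \<subseteq> ?P"
    proof
      fix x assume "x \<in> hol_hull (Cspace d) K"
      then have x: "x \<in> Ext d" "\<And>f. f \<in> ?F \<Longrightarrow> cmod (f x) \<le> ?s f"
        unfolding hull by blast+
      have "x i \<in> cball 0 (?s (\<lambda>w. w i))" if "i < d" for i
        using x(2)[OF hol_functions_coord[OF that]] by simp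
      with x(1) show "x \<in> ?P" by (simp add: PiE_iff)
    qed
    moreover have "closedin (Cn d) (hol_hull (Cspace d) K)"
    proof -
      have "closedin (Cn d) {x \<in> Ext d. cmod (f x) \<le> ?s f}" if "f \<in> ?F" for f
      proof -
        have "continuous_on (Ext d) (\<lambda>x. cmod (f x))"
          using that by (intro continuous_on_norm holo_on_continuous) (simp add: hol_functions_Cspace)
        then have "continuous_map (Cn d) euclideanreal (\<lambda>x. cmod (f x))" by (simp add: Cn_eq)
        from closedin_continuous_map_preimage[OF this, of "{..?s f}"]
        show ?thesis by (simp add: topspace_Cn)
      qed
      moreover have "(\<lambda>_. 0) \<in> ?F"
        using openin_topspace[of "Cn d"]
        by (auto simp: hol_functions_Cspace topspace_Cn intro!: caratheodory_holo_on caratheodory_const)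
      ultimately have "closedin (Cn d) (\<Inter>f\<in>?F. {x \<in> Ext d. cmod (f x) \<le> ?s f})"
        by (intro closedin_INT) auto
      moreover have "(\<Inter>f\<in>?F. {x \<in> Ext d. cmod (f x) \<le> ?s f}) = hol_hull (Cspace d) K"
        unfolding hull using \<open>(\<lambda>_. 0) \<in> ?F\<close> by blast
      ultimately show ?thesis by simp
    qed
    ultimately show "compactin (Cn d) (hol_hull (Cspace d) K)" by (rule closed_compactin)
  qed
qed

section \<open>The matrices and the lower bound\<close>

definition cont_prod :: "'n::finite \<Rightarrow> 'n \<Rightarrow> nat list \<Rightarrow> (nat \<Rightarrow> complex) \<Rightarrow> complex^'n^'n" where
  "cont_prod r s ls x = foldr (\<lambda>l M. cont_mat r s (x l) ** M) ls (mat 1)"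

lemma det_cont_prod: "r \<noteq> s \<Longrightarrow> det (cont_prod r s ls x) = 1"
  by (induction ls) (simp_all add: cont_prod_def det_mul cont_mat_def det_embed2)

lemma caratheodory_cont_prod:
  assumes "set ls \<subseteq> {..<d}"
  shows "caratheodory d (\<lambda>x. cont_prod r s ls x $ a $ b)"
  using assms
proof (induction ls arbitrary: a b)
  case Nil
  then show ?case by (simp add: cont_prod_def caratheodory_const)
next
  case (Cons l ls)
  have "caratheodory d (\<lambda>x. cont_mat r s (x l) $ a $ c)" for c
    unfolding cont_mat_def embed2_entry using Cons.prems by (simp add: caratheodory_const caratheodory_coord)
  then show ?case
    using Cons by (auto simp: cont_prod_def matrix_matrix_mult_def intro!: caratheodory_sum caratheodory_mult)
qed

lemma continuous_cont_prod: "continuous_on UNIV (cont_prod r s ls)"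
proof -
  have "continuous_on UNIV (\<lambda>x. cont_prod r s ls x $ a $ b)" for a b
  proof -
    have "set ls \<subseteq> {..<Suc (Max (set ls))}" by (auto simp: less_Suc_eq_le)
    from caratheodory_cont_prod[OF this] show ?thesis unfolding caratheodory_def by blast
  qed
  then have "continuous_on UNIV (\<lambda>x. \<chi> a b. cont_prod r s ls x $ a $ b)"
    by (intro continuous_on_vec_lambda)
  then show ?thesis by simp
qed

lemma hol_SL_cont_prod:
  assumes "r \<noteq> s" "set ls \<subseteq> {..<d}"
  shows "hol_SL (Cspace d) (cont_prod r s ls)"
  unfolding hol_SL_def hol_matrix_def hol_functions_Cspace
  using caratheodory_cont_prod[OF assms(2)] det_cont_prod[OF assms(1)] openin_topspace[of "Cn d"]
  by (auto simp: topspace_Cn intro!: caratheodory_holo_on)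

text \<open>
  Scaling the parameters to zero deforms the product into a constant without leaving the special linear
  group.
\<close>

lemma null_homotopic_cont_prod:
  assumes "r \<noteq> s"
  shows "null_homotopic (Cspace d) (cont_prod r s ls)"
proof -
  define h where "h p = cont_prod r s ls (\<lambda>l. complex_of_real (1 - fst p) * snd p l)" for p :: "real \<times> (nat \<Rightarrow> complex)"
  have "continuous_on S (\<lambda>p::real \<times> (nat \<Rightarrow> complex). \<lambda>l. complex_of_real (1 - fst p) * snd p l)" for S
    by (rule continuous_on_coordinatewise_then_product)
      (intro continuous_on_mult continuous_on_of_real continuous_on_diff continuous_on_const
        continuous_on_fst continuous_on_id continuous_coord_comp continuous_on_snd)
  from continuous_on_compose2[OF continuous_cont_prod this]
  have "continuous_on S h" for S unfolding h_def by simp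
  then have "continuous_map (prod_topology (top_of_set {0..1}) (Cn d)) (top_of_set {M. det M = 1}) h"
    by (simp add: Cn_eq h_def det_cont_prod[OF assms])
  moreover have "h (0, x) = cont_prod r s ls x" "h (1, x) = cont_prod r s ls (\<lambda>_. 0)" for x
    by (simp_all add: h_def)
  ultimately have "homotopic_with (\<lambda>_. True) (Cn d) (top_of_set {M. det M = 1}) (cont_prod r s ls) (\<lambda>_. cont_prod r s ls (\<lambda>_. 0))"
    unfolding homotopic_with_def by blast
  then show ?thesis unfolding null_homotopic_def Top_Cspace by blast
qed

text \<open>
  The chain rule turns holomorphy on complex number space into separate holomorphy of the pull-back.
\<close>

lemma sep_hol_pullback:
  assumes f: "f \<in> hol_functions (Cspace d)" and g: "\<And>l. sep_hol (g l)"
  shows "sep_hol (\<lambda>u. f (restrict (\<lambda>l. g l u) {..<d}))"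
proof (rule sep_holI)
  have h: "holo_on d (Ext d) f" using f by (simp add: hol_functions_Cspace)
  let ?p = "\<lambda>u. restrict (\<lambda>l. g l u) {..<d}"
  have "continuous_on UNIV ?p"
  proof (rule continuous_on_coordinatewise_then_product)
    show "continuous_on UNIV (\<lambda>u. ?p u i)" for i
      using sep_hol_continuous[OF g] by (cases "i < d") auto
  qed
  then show "continuous_on UNIV (\<lambda>u. f (?p u))"
    by (rule continuous_on_compose2[OF holo_on_continuous[OF h]]) (rule image_subsetI, simp)
  fix u i
  have "?p u \<in> Ext d" by simp
  then obtain c where "(dquot d f (?p u) c \<longlongrightarrow> 0) (at (?p u) within Ext d)"
    using h unfolding holo_on_iff by blast
  then have "((\<lambda>z. f (?p (u(i := z)))) has_field_derivative (\<Sum>l<d. c l * pd i (g l) u)) (at (u i))"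
    by (rule holo_chain) (auto intro: sep_hol_has_pd'[OF g])
  then show "\<exists>D. ((\<lambda>z. f (?p (u(i := z)))) has_field_derivative D) (at (u i))" by blast
qed

lemma cont_prod_not_product_of_involutions:
  fixes r s :: "'n::finite"
  assumes rs: "r \<noteq> s" and k: "N * CARD('n \<times> 'n) < k" and d: "5 * k \<le> d"
  shows "\<not> product_of_involutions (Cspace d) N (cont_prod r s [0..<5*k])"
proof
  assume "product_of_involutions (Cspace d) N (cont_prod r s [0..<5*k])"
  then obtain Bs where Bs: "length Bs = N" "\<And>B. B \<in> set Bs \<Longrightarrow> hol_involution (Cspace d) B"
    "\<And>x. x \<in> Ext d \<Longrightarrow> cont_prod r s [0..<5*k] x = foldr (\<lambda>B M. B x ** M) Bs (mat 1)"
    by (auto simp: product_of_involutions_def Top_Cspace topspace_Cn)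
  define p where "p u = restrict (\<lambda>l. frieze_par (2*k) l u) {..<d}" for u
  have p: "p u \<in> Ext d" for u by (simp add: p_def)
  let ?W = "map (\<lambda>B u. B (p u)) Bs"
  show False
  proof (rule no_involution_word[OF rs])
    show "length ?W * CARD('n \<times> 'n) < k" using k Bs(1) by simp
    fix C assume "C \<in> set ?W"
    then obtain B where C: "C = (\<lambda>u. B (p u))" and B: "hol_involution (Cspace d) B" using Bs(2) by auto
    show "msep C"
      unfolding msep_def C p_def using B
      by (auto simp: hol_involution_def hol_matrix_def intro!: sep_hol_pullback sep_hol_frieze_par)
    show "C u ** C u = mat 1" for u
      using B p by (simp add: C hol_involution_def Top_Cspace topspace_Cn)
    show "C (shift i u) = C u" if "i < 2*k" for u i
      by (simp add: C p_def frieze_par_shift[OF that])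
    show "C u = C v" if "u (2*k) = 0" "v (2*k) = 0" for u v
      by (simp add: C p_def frieze_par_def that)
  next
    fix u
    have "foldr (\<lambda>B M. B u ** M) ?W (mat 1) = cont_prod r s [0..<5*k] (p u)"
      unfolding Bs(3)[OF p] by (simp add: foldr_map o_def)
    also have "\<dots> = foldr (\<lambda>l M. cont_mat r s (frieze_par (2*k) l u) ** M) [0..<5*k] (mat 1)"
      unfolding cont_prod_def by (rule foldr_cong) (use d in \<open>auto simp: p_def\<close>)
    finally show "foldr (\<lambda>B M. B u ** M) ?W (mat 1) =
      foldr (\<lambda>l M. cont_mat r s (frieze_par (2*k) l u) ** M) [0..<5*k] (mat 1)" .
  qed
qed

text \<open>
  With \<open>k = K n\<^sup>2 + 1\<close> blocks no number \<open>N \<le> K\<close> of involutions suffices; the blocks use \<open>5k\<close> coordinates and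
  the remaining ones are idle.
\<close>

lemma I_hol_lower_bound:
  assumes "CARD('n::finite) \<ge> 2" and d: "5 * Suc (K * CARD('n \<times> 'n)) \<le> d"
  shows "I_hol TYPE('n) d \<ge> enat (Suc K)"
  unfolding I_hol_def
proof (rule Inf_greatest, clarify)
  fix N assume N: "\<forall>(X :: (nat \<Rightarrow> complex) fspace) (A :: _ \<Rightarrow> complex^'n^'n).
     reduced_stein_space X \<longrightarrow> has_complex_dim X d \<longrightarrow> hol_SL X A \<longrightarrow> null_homotopic X A \<longrightarrow>
     product_of_involutions X N A"
  show "enat (Suc K) \<le> enat N"
  proof (rule ccontr)
    assume "\<not> enat (Suc K) \<le> enat N"
    then have "N \<le> K" by simp
    obtain r s :: 'n where rs: "r \<noteq> s"
      using assms(1) by (metis One_nat_def UNIV_I card_1_singleton_iff card_le_Suc0_iff_eq finite not_less_eq_eq numeral_2_eq_2)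
    let ?k = "Suc (K * CARD('n \<times> 'n))"
    let ?A = "cont_prod r s [0..<5 * ?k]"
    have "product_of_involutions (Cspace d) N ?A"
    proof (rule N[rule_format])
      show "reduced_stein_space (Cspace d)" by (rule reduced_stein_space_Cspace)
      show "has_complex_dim (Cspace d) d" by (rule has_complex_dim_Cspace)
      show "hol_SL (Cspace d) ?A" by (rule hol_SL_cont_prod[OF rs]) (use d in auto)
      show "null_homotopic (Cspace d) ?A" by (rule null_homotopic_cont_prod[OF rs])
    qed
    moreover have "N * CARD('n \<times> 'n) < ?k"
      using \<open>N \<le> K\<close> by (simp only: less_Suc_eq_le) (rule mult_right_mono, simp_all)
    ultimately show False using cont_prod_not_product_of_involutions[OF rs _ d] by blast
  qed
qed

theorem mainTheorem6:
  assumes "CARD('n::finite) \<ge> 2"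
  shows "(\<lambda>d. I_hol TYPE('n) d) \<longlonglongrightarrow> \<infinity>"
proof (rule order_tendstoI)
  fix a :: enat assume "a < \<infinity>"
  then obtain K where K: "a = enat K" by (cases a) auto
  have "a < I_hol TYPE('n) d" if "5 * Suc (K * CARD('n \<times> 'n)) \<le> d" for d
    using I_hol_lower_bound[OF assms that] K by (metis Suc_ile_eq)
  then show "eventually (\<lambda>d. a < I_hol TYPE('n) d) sequentially"
    unfolding eventually_sequentially by blast
next
  fix a :: enat assume "\<infinity> < a"
  then show "eventually (\<lambda>d. I_hol TYPE('n) d < a) sequentially" by simp
qed

end
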